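(* Let $N\ge1$ be an integer and let $z_1,z_2\in\mathbb{H}$ with $z_2\notin\Gamma_0(N)z_1$. Then the series $$\Xi_N(z_1,z_2,s)=\frac12\sum_{\gamma\in\Gamma_0(N)}\frac{\overline{\mu_\gamma(z_1,-z_2)}\;\overline{\mu_\gamma(z_1,-\bar{z_2})}}{|\mu_\gamma(z_1,-z_2)|^{2s}\,|\mu_\gamma(z_1,-\bar{z_2})|^{2s}},$$ as a function of the complex variable $s$ (defined by absolute convergence for $\Re(s)>1$), can be analytically continued to the point $s=1$.
   Context: $\mathbb{H}=\{z\in\mathbb{C}:\Im z>0\}$; $\Gamma_0(N)=\left\{\begin{pmatrix}a&b\\c&d\end{pmatrix}\in SL_2(\mathbb{Z}): c\equiv 0\bmod N\right\}$. For $\gamma=\begin{pmatrix}a&b\\c&d\end{pmatrix}$, $\mu_\gamma(z_1,z_2)=cz_1z_2+dz_2+az_1+b$. The bar denotes complex conjugation. Note that $\mu_\gamma(z_1,-z_2)=0$ exactly when $z_2=\gamma z_1$. *)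

theory Defs
  imports "HOL-Analysis.Analysis" "HOL-Number_Theory.Cong"
begin

definition upper_half_plane :: "complex set" where
  "upper_half_plane = {z. Im z > 0}"

definition Gamma0 :: "nat \<Rightarrow> (int^2^2) set" where
  "Gamma0 N = {\<gamma>. det \<gamma> = 1 \<and> [\<gamma> $ 2 $ 1 = 0] (mod int N)}"

definition mat_act :: "int^2^2 \<Rightarrow> complex \<Rightarrow> complex" where
  "mat_act \<gamma> = moebius (of_int (\<gamma> $ 1 $ 1)) (of_int (\<gamma> $ 1 $ 2))
                       (of_int (\<gamma> $ 2 $ 1)) (of_int (\<gamma> $ 2 $ 2))"

definition Gamma0_orbit :: "nat \<Rightarrow> complex \<Rightarrow> complex set" where
  "Gamma0_orbit N z = (\<lambda>\<gamma>. mat_act \<gamma> z) ` Gamma0 N"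

definition mu :: "int^2^2 \<Rightarrow> complex \<Rightarrow> complex \<Rightarrow> complex" where
  "mu \<gamma> z1 z2 = of_int (\<gamma> $ 2 $ 1) * z1 * z2 + of_int (\<gamma> $ 2 $ 2) * z2
                + of_int (\<gamma> $ 1 $ 1) * z1 + of_int (\<gamma> $ 1 $ 2)"

definition Xi_term :: "complex \<Rightarrow> complex \<Rightarrow> complex \<Rightarrow> int^2^2 \<Rightarrow> complex" where
  "Xi_term z1 z2 s \<gamma> =
     cnj (mu \<gamma> z1 (- z2)) * cnj (mu \<gamma> z1 (- cnj z2)) /
     (of_real (norm (mu \<gamma> z1 (- z2))) powr (2 * s) *
      of_real (norm (mu \<gamma> z1 (- cnj z2))) powr (2 * s))"

text \<open>The sum \<^const>\<open>infsum\<close> is \<open>0\<close> by convention if the series does not converge, so the value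
  is only meaningful where the series is summable.\<close>

definition Xi :: "nat \<Rightarrow> complex \<Rightarrow> complex \<Rightarrow> complex \<Rightarrow> complex" where
  "Xi N z1 z2 s = 1 / 2 * (\<Sum>\<^sub>\<infinity>\<gamma>\<in>Gamma0 N. Xi_term z1 z2 s \<gamma>)"

text \<open>A function on \<open>D\<close> continues analytically to the point \<open>p\<close> if it extends holomorphically
  to some domain that contains both \<open>D\<close> and \<open>p\<close>.\<close>

definition continues_analytically_to ::
    "(complex \<Rightarrow> complex) \<Rightarrow> complex set \<Rightarrow> complex \<Rightarrow> bool" where
  "continues_analytically_to f D p \<longleftrightarrow>
     (\<exists>U F. open U \<and> connected U \<and> D \<subseteq> U \<and> p \<in> U \<and> F holomorphic_on U \<and> (\<forall>s\<in>D. F s = f s))"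

text \<open>In the situation of interest both factors are nonzero, so the complex powers of their
  absolute values have positive real bases.\<close>

lemma cz_plus_d_nonzero:
  assumes "\<gamma> \<in> Gamma0 N" "z \<in> upper_half_plane"
  shows "of_int (\<gamma> $ 2 $ 1) * z + of_int (\<gamma> $ 2 $ 2) \<noteq> 0"
proof
  assume 0: "of_int (\<gamma> $ 2 $ 1) * z + of_int (\<gamma> $ 2 $ 2) = 0"
  have "of_int (\<gamma> $ 2 $ 1) * Im z = 0"
    using arg_cong[OF 0, of Im] by simp
  then have c: "\<gamma> $ 2 $ 1 = 0"
    using assms(2) by (simp add: upper_half_plane_def)
  with 0 have "\<gamma> $ 2 $ 2 = 0"
    by simp
  with c assms(1) show False
    by (simp add: Gamma0_def det_2)
qed

lemma mu_eq_0_iff: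
  assumes "\<gamma> \<in> Gamma0 N" "z1 \<in> upper_half_plane"
  shows "mu \<gamma> z1 (- z2) = 0 \<longleftrightarrow> z2 = mat_act \<gamma> z1"
  using cz_plus_d_nonzero[OF assms]
  by (auto simp: mu_def mat_act_def moebius_def field_simps)

lemma Im_mat_act_pos:
  assumes "\<gamma> \<in> Gamma0 N" "z \<in> upper_half_plane"
  shows "Im (mat_act \<gamma> z) > 0"
proof -
  define a b c d where "a = real_of_int (\<gamma> $ 1 $ 1)" "b = real_of_int (\<gamma> $ 1 $ 2)"
    "c = real_of_int (\<gamma> $ 2 $ 1)" "d = real_of_int (\<gamma> $ 2 $ 2)"
  note defs = this
  have "real_of_int (det \<gamma>) = 1"
    using assms(1) by (simp add: Gamma0_def)
  then have det: "a * d - b * c = 1"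
    by (simp add: det_2 defs)
  have nz: "of_real c * z + of_real d \<noteq> 0"
    using cz_plus_d_nonzero[OF assms] by (simp add: defs)
  then have pos: "(c * Re z + d)\<^sup>2 + (c * Im z)\<^sup>2 > 0"
    by (simp add: complex_eq_iff sum_power2_gt_zero_iff)
  have "mat_act \<gamma> z = (of_real a * z + of_real b) / (of_real c * z + of_real d)"
    by (simp add: mat_act_def moebius_def defs)
  then have "Im (mat_act \<gamma> z) = (a * d - b * c) * Im z / ((c * Re z + d)\<^sup>2 + (c * Im z)\<^sup>2)"
    by (simp add: Im_divide algebra_simps)
  with det pos assms(2) show ?thesis
    by (simp add: upper_half_plane_def)
qed

lemma mu_nonzero:
  assumes "\<gamma> \<in> Gamma0 N" "z1 \<in> upper_half_plane" "z2 \<in> upper_half_plane"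
    and "z2 \<notin> Gamma0_orbit N z1"
  shows "mu \<gamma> z1 (- z2) \<noteq> 0" and "mu \<gamma> z1 (- cnj z2) \<noteq> 0"
proof -
  show "mu \<gamma> z1 (- z2) \<noteq> 0"
    using assms by (auto simp: mu_eq_0_iff Gamma0_orbit_def)
  have "cnj z2 \<noteq> mat_act \<gamma> z1"
    using Im_mat_act_pos[OF assms(1,2)] assms(3) by (auto simp: upper_half_plane_def dest: arg_cong[where f = Im])
  then show "mu \<gamma> z1 (- cnj z2) \<noteq> 0"
    using mu_eq_0_iff[OF assms(1,2)] by blast
qed

end

theory Submission
  imports Defs "HOL-Number_Theory.Number_Theory" "HOL-Complex_Analysis.Complex_Analysis"
    "HOL-Real_Asymp.Real_Asymp"
begin

text \<open>
  Write \<open>P\<close> for the product of the two values of \<open>mu\<close> in a term of the series. The term is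
  \<open>cnj P / |P|^(2s)\<close>, and \<open>v \<mapsto> cnj v / |v|^(2s)\<close> is completely multiplicative. About \<open>X^2\<close>
  matrices have entries of size at most \<open>X\<close>, and the term has size \<open>X^(2 - 4 Re s)\<close>, so absolute convergence
  ends exactly at \<open>Re s = 1\<close>; going further needs cancellation.

  Up to sign, a matrix with lower left entry \<open>c \<noteq> 0\<close> is a pair \<open>(a, d)\<close> with
  \<open>a d \<equiv> 1 (mod c)\<close>, and \<open>mu = c ((d/c + z1)(a/c - z2) - 1/c^2)\<close>. Dropping the
  \<open>1/c^2\<close> changes the term by a factor \<open>1 + O(1/c^2)\<close>, and the difference converges absolutely
  well to the left of \<open>1\<close>. What is left factors into a function of \<open>c\<close>, one of
  \<open>d/c\<close> and one of \<open>a/c\<close>. Summing \<open>a\<close> and \<open>d\<close> over their residue classes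
  modulo \<open>c\<close> makes the last two functions periodic, and the series becomes
  \<open>\<Sum> c^(2-4s) \<Sum> G(\<delta>/c) K(\<alpha>/c)\<close>, the inner sum over the pairs of mutually inverse
  residues modulo \<open>c\<close>.

  These pairs are equidistributed in the torus with a power saving: expanding \<open>G\<close> and \<open>K\<close> into
  characters modulo \<open>c\<close> turns the inner sum into Kloosterman sums, which are
  \<open>O(c^(3/4) d(c))\<close> up to the fourth root of the frequency. The proof is Kloosterman's own: the sum with
  parameters \<open>(m, n)\<close> equals the one with \<open>(m u, n / u)\<close> for every unit \<open>u\<close>,
  so its fourth power is at most \<open>gcd(m, c)/\<phi>(c)\<close> times the fourth moment over all parameters, and that
  moment counts the solutions of \<open>a1 + a2 = a3 + a4\<close>, \<open>1/a1 + 1/a2 = 1/a3 + 1/a4\<close>, of which there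
  are hardly more than the trivial ones
  (\<open>kloosterman_bound\<close>, \<open>inverse_pairs_equidistributed\<close>). Hence the inner sum is
  \<open>\<phi>(c) I(s) J(s)\<close>, where \<open>I\<close> and \<open>J\<close> are the means of \<open>G\<close> and
  \<open>K\<close>, up to an error whose contribution converges absolutely for \<open>Re s > 15/16\<close>.

  The main term is \<open>I(s) J(s) \<Sum> \<phi>(c) c^(2-4s)\<close> over the multiples of \<open>N\<close>. This Dirichlet
  series is \<open>\<zeta>(4s-3)\<close> times an absolutely convergent series, so it has at most a simple pole at \<open>1\<close>
  (\<open>totient_series\<close>, \<open>zeta_cont_eq\<close>). The pole is cancelled by \<open>I(1) = 0\<close>: at
  \<open>s = 1\<close> the mean of \<open>G\<close> is the integral of \<open>1/(x + z1)^2\<close> over the real line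
  (\<open>circle_mean_at_1\<close>).

  All estimates are made uniformly on the sets \<open>Re s > 31/32\<close>, \<open>|s| < R\<close>. The abscissa
  \<open>31/32\<close> is one admissible choice between \<open>15/16\<close> and \<open>1\<close>; the exponents \<open>15/16\<close>,
  \<open>15/8\<close> and \<open>9/8\<close> that occur below are \<open>2 Re s - 1\<close>, \<open>4 Re s - 2\<close> and
  \<open>4 Re s - 2 - 3/4\<close> at this abscissa.
\<close>

section \<open>Additive characters, inverse pairs and Kloosterman sums\<close>

definition add_char :: "nat \<Rightarrow> int \<Rightarrow> complex" where
  "add_char c x = cis (2 * pi * of_int x / of_nat c)"

lemma norm_add_char [simp]: "norm (add_char c x) = 1"
  by (simp add: add_char_def)

lemma add_char_0 [simp]: "add_char c 0 = 1"
  by (simp add: add_char_def)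

lemma add_char_add: "add_char c (x + y) = add_char c x * add_char c y"
  by (simp add: add_char_def cis_mult add_divide_distrib ring_distribs)

lemma cnj_add_char: "cnj (add_char c x) = add_char c (- x)"
  by (simp add: add_char_def cis_cnj)

lemma add_char_eq_1_iff:
  assumes "c > 0"
  shows "add_char c x = 1 \<longleftrightarrow> int c dvd x"
proof -
  have "add_char c x = 1 \<longleftrightarrow> (\<exists>n::int. 2 * pi * of_int x / of_nat c = of_int (2 * n) * pi)"
    by (simp add: add_char_def cis_conv_exp exp_eq_1 mult.commute)
  also have "\<dots> \<longleftrightarrow> (\<exists>n::int. real_of_int x = real_of_int (int c * n))"
    using assms by (intro ex_cong1) (auto simp: field_simps)
  also have "\<dots> \<longleftrightarrow> int c dvd x"
    unfolding of_int_eq_iff by (auto simp: dvd_def)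
  finally show ?thesis .
qed

lemma add_char_cong:
  assumes "c > 0" "[x = y] (mod int c)"
  shows "add_char c x = add_char c y"
proof -
  have "add_char c (x - y) = 1"
    using assms by (simp add: add_char_eq_1_iff cong_iff_dvd_diff)
  then show ?thesis
    using add_char_add[of c "x - y" y] by simp
qed

lemma add_char_power: "add_char c x ^ n = add_char c (int n * x)"
  by (induction n) (auto simp: add_char_add ring_distribs)

lemma sum_add_char:
  assumes "c > 0"
  shows "(\<Sum>a\<in>{0..<int c}. add_char c (a * x)) = (if int c dvd x then of_nat c else 0)"
proof -
  have eq: "(\<Sum>a\<in>{0..<int c}. add_char c (a * x)) = (\<Sum>k<c. add_char c x ^ k)"
    unfolding add_char_power
    by (rule sum.reindex_bij_witness[of _ int nat]) (use assms in auto)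
  show ?thesis
  proof (cases "int c dvd x")
    case True
    then have "add_char c x = 1" using assms add_char_eq_1_iff by blast
    then show ?thesis using True eq by simp
  next
    case False
    then have "add_char c x \<noteq> 1" using assms add_char_eq_1_iff by blast
    moreover have "add_char c x ^ c = 1"
      using assms by (simp add: add_char_power add_char_eq_1_iff)
    ultimately show ?thesis using False eq by (simp add: geometric_sum)
  qed
qed

text \<open>
  Orthogonality in two variables at once: the case \<open>g = 0\<close> is Parseval's identity for the discrete Fourier
  transform, and \<open>w = 1\<close> turns moments of exponential sums into counts of solutions of congruences.
\<close>

lemma parseval_mod:
  fixes f g :: "'a \<Rightarrow> int" and w :: "'a \<Rightarrow> complex"
  assumes "c > 0" "finite X"
  shows "(\<Sum>a\<in>{0..<int c}. \<Sum>b\<in>{0..<int c}.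
            complex_of_real ((norm (\<Sum>x\<in>X. w x * add_char c (a * f x + b * g x)))\<^sup>2)) =
         of_nat c ^ 2 * (\<Sum>x\<in>X. \<Sum>y\<in>X.
            if [f x = f y] (mod int c) \<and> [g x = g y] (mod int c) then w x * cnj (w y) else 0)"
proof -
  have 1: "complex_of_real ((norm (\<Sum>x\<in>X. w x * add_char c (a * f x + b * g x)))\<^sup>2) =
     (\<Sum>x\<in>X. \<Sum>y\<in>X. w x * cnj (w y) * (add_char c (a * (f x - f y)) * add_char c (b * (g x - g y))))" for a b
    unfolding complex_norm_square cnj_sum sum_product
    by (intro sum.cong refl) (simp add: cnj_add_char add_char_add[symmetric] algebra_simps)
  have "(\<Sum>a\<in>{0..<int c}. \<Sum>b\<in>{0..<int c}.
            complex_of_real ((norm (\<Sum>x\<in>X. w x * add_char c (a * f x + b * g x)))\<^sup>2)) =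
        (\<Sum>a\<in>{0..<int c}. \<Sum>x\<in>X. \<Sum>y\<in>X. \<Sum>b\<in>{0..<int c}.
            w x * cnj (w y) * (add_char c (a * (f x - f y)) * add_char c (b * (g x - g y))))"
    unfolding 1 by (subst (2) sum.swap, subst (3) sum.swap) simp
  also have "\<dots> = (\<Sum>x\<in>X. \<Sum>y\<in>X. \<Sum>a\<in>{0..<int c}. \<Sum>b\<in>{0..<int c}.
            w x * cnj (w y) * (add_char c (a * (f x - f y)) * add_char c (b * (g x - g y))))"
    by (subst sum.swap, subst (2) sum.swap) simp
  also have "\<dots> = (\<Sum>x\<in>X. \<Sum>y\<in>X. w x * cnj (w y) *
       ((\<Sum>a\<in>{0..<int c}. add_char c (a * (f x - f y))) * (\<Sum>b\<in>{0..<int c}. add_char c (b * (g x - g y)))))"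
    by (simp only: sum_product) (simp only: sum_distrib_left)
  also have "\<dots> = of_nat c ^ 2 * (\<Sum>x\<in>X. \<Sum>y\<in>X.
            if [f x = f y] (mod int c) \<and> [g x = g y] (mod int c) then w x * cnj (w y) else 0)"
    unfolding sum_add_char[OF assms(1)] sum_distrib_left
    by (intro sum.cong refl) (auto simp: cong_iff_dvd_diff power2_eq_square)
  finally show ?thesis .
qed

text \<open>
  Pairs, rather than units with an inversion function, keep the symmetry between \<open>a\<close> and \<open>d\<close>. For
  \<open>c = 1\<close> the single pair is \<open>(0, 0)\<close>.
\<close>

definition inv_pairs :: "nat \<Rightarrow> (int \<times> int) set" where
  "inv_pairs c = {(a, d). a \<in> {0..<int c} \<and> d \<in> {0..<int c} \<and> [a * d = 1] (mod int c)}"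

lemma inv_pairsD:
  assumes "(a, d) \<in> inv_pairs c"
  shows "0 \<le> a" "a < int c" "0 \<le> d" "d < int c" "[a * d = 1] (mod int c)" "coprime a (int c)"
proof -
  show 1: "0 \<le> a" "a < int c" "0 \<le> d" "d < int c" "[a * d = 1] (mod int c)"
    using assms by (auto simp: inv_pairs_def)
  show "coprime a (int c)"
    using 1(5) coprime_iff_invertible_int by blast
qed

lemma finite_inv_pairs [simp]: "finite (inv_pairs c)"
  by (rule finite_subset[of _ "{0..<int c} \<times> {0..<int c}"]) (auto simp: inv_pairs_def)

lemma inv_pairs_unique:
  assumes "(a, d) \<in> inv_pairs c" "(a', d') \<in> inv_pairs c" "[a = a'] (mod int c)"
  shows "a = a'" "d = d'"
proof -
  note A = inv_pairsD[OF assms(1)] and B = inv_pairsD[OF assms(2)]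
  show "a = a'"
    using A B assms(3) by (simp add: cong_def)
  then have "[a * d = a * d'] (mod int c)"
    using A(5) B(5) by (metis cong_sym cong_trans)
  then have "[d = d'] (mod int c)"
    using A(6) cong_mult_lcancel by blast
  then show "d = d'"
    using A B by (simp add: cong_def)
qed

lemma inj_on_fst_inv_pairs: "inj_on fst (inv_pairs c)"
  using inv_pairs_unique by (auto simp: inj_on_def)

lemma card_inv_pairs:
  assumes "c > 0"
  shows "card (inv_pairs c) = totient c"
proof -
  have "bij_betw fst (inv_pairs c) {a\<in>{0..<int c}. coprime a (int c)}"
  proof (rule bij_betw_imageI[OF inj_on_fst_inv_pairs])
    have "\<exists>d. (a, d) \<in> inv_pairs c" if "a \<in> {0..<int c}" "coprime a (int c)" for a
    proof -
      from that(2) obtain x where "[a * x = 1] (mod int c)"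
        unfolding coprime_iff_invertible_int by (elim exE)
      with that(1) have "(a, x mod int c) \<in> inv_pairs c"
        using assms by (auto simp: inv_pairs_def cong_def mod_mult_right_eq)
      then show ?thesis by blast
    qed
    note ex = this
    show "fst ` inv_pairs c = {a\<in>{0..<int c}. coprime a (int c)}"
    proof (intro equalityI subsetI)
      fix a assume "a \<in> fst ` inv_pairs c"
      then obtain d where "(a, d) \<in> inv_pairs c" by auto
      then show "a \<in> {a\<in>{0..<int c}. coprime a (int c)}"
        using inv_pairsD[of a d c] by simp
    next
      fix a assume "a \<in> {a\<in>{0..<int c}. coprime a (int c)}"
      then obtain d where "(a, d) \<in> inv_pairs c" using ex by blast
      then show "a \<in> fst ` inv_pairs c" by (rule image_eqI[rotated]) simp
    qed
  qed
  then have "card (inv_pairs c) = card {a\<in>{0..<int c}. coprime a (int c)}"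
    by (rule bij_betw_same_card)
  also have "\<dots> = card (totatives c)"
  proof (cases "c = 1")
    case True
    then have "{a\<in>{0..<int c}. coprime a (int c)} = {0}" by auto
    then show ?thesis using True by simp
  next
    case False
    have "bij_betw int (totatives c) {a\<in>{0..<int c}. coprime a (int c)}"
    proof (rule bij_betw_imageI)
      show "int ` totatives c = {a\<in>{0..<int c}. coprime a (int c)}"
      proof (intro equalityI subsetI)
        fix a assume "a \<in> int ` totatives c"
        then obtain k where k: "a = int k" "0 < k" "k \<le> c" "coprime k c"
          by (auto simp: totatives_def)
        then have "k \<noteq> c" using False by auto
        then show "a \<in> {a\<in>{0..<int c}. coprime a (int c)}"
          using k by auto
      next
        fix a assume a: "a \<in> {a\<in>{0..<int c}. coprime a (int c)}"
        then have "a \<noteq> 0" using False by auto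
        then have "nat a \<in> totatives c"
          using a by (auto simp: totatives_def coprime_int_iff[symmetric] simp del: coprime_int_iff)
        moreover have "a = int (nat a)" using a by simp
        ultimately show "a \<in> int ` totatives c" by blast
      qed
    qed auto
    then show ?thesis by (rule bij_betw_same_card[symmetric])
  qed
  finally show ?thesis by (simp add: totient_def)
qed

definition kloosterman :: "nat \<Rightarrow> int \<Rightarrow> int \<Rightarrow> complex" where
  "kloosterman c m n = (\<Sum>(a, d)\<in>inv_pairs c. add_char c (m * d + n * a))"

lemma kloosterman_cong:
  assumes "c > 0" "[m = m'] (mod int c)" "[n = n'] (mod int c)"
  shows "kloosterman c m n = kloosterman c m' n'"
  unfolding kloosterman_def
  by (rule sum.cong) (use assms in \<open>auto intro!: add_char_cong cong_add cong_mult\<close>)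

lemma inv_pairs_swap: "(a, d) \<in> inv_pairs c \<longleftrightarrow> (d, a) \<in> inv_pairs c"
  by (auto simp: inv_pairs_def mult.commute)

lemma kloosterman_commute: "kloosterman c m n = kloosterman c n m"
  unfolding kloosterman_def
  by (rule sum.reindex_bij_witness[of _ prod.swap prod.swap])
     (auto simp: inv_pairs_swap add.commute)

text \<open>
  Multiplication by \<open>(v, u)\<close> permutes the inverse pairs. This orbit of equal values is what makes one single sum
  visible in a moment over all frequencies.
\<close>

lemma kloosterman_unit_invariant:
  assumes "c > 0" "(u, v) \<in> inv_pairs c"
  shows "kloosterman c (m * u) (n * v) = kloosterman c m n"
proof -
  note uv = inv_pairsD[OF assms(2)]
  define t where "t = (\<lambda>u v (a, d). ((v * a) mod int c, (u * d) mod int c))"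
  have closed: "t u v x \<in> inv_pairs c" if "[u * v = 1] (mod int c)" "x \<in> inv_pairs c" for u v x
  proof -
    obtain a d where x: "x = (a, d)" by force
    have "[(u * v) * (a * d) = 1 * 1] (mod int c)"
      using that x by (intro cong_mult) (auto dest: inv_pairsD)
    then have "[(v * a mod int c) * (u * d mod int c) = 1] (mod int c)"
      by (simp add: cong_def mod_mult_eq mult_ac)
    then show ?thesis
      using assms(1) by (simp add: x t_def inv_pairs_def)
  qed
  have inv: "t u v (t v u x) = x" if "[u * v = 1] (mod int c)" "x \<in> inv_pairs c" for u v x
  proof -
    obtain a d where x: "x = (a, d)" by force
    have "[(v * ((u * a) mod int c)) = a] (mod int c)" for a
    proof -
      have "[v * ((u * a) mod int c) = (u * v) * a] (mod int c)"
        by (simp add: cong_def mod_mult_right_eq mult_ac)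
      also have "[(u * v) * a = 1 * a] (mod int c)"
        by (rule cong_scalar_right) fact
      finally show ?thesis by simp
    qed
    moreover have "[(u * ((v * a) mod int c)) = a] (mod int c)" for a
    proof -
      have "[u * ((v * a) mod int c) = (u * v) * a] (mod int c)"
        by (simp add: cong_def mod_mult_right_eq mult_ac)
      also have "[(u * v) * a = 1 * a] (mod int c)"
        by (rule cong_scalar_right) fact
      finally show ?thesis by simp
    qed
    ultimately show ?thesis
      using inv_pairsD[of a d c] that(2) unfolding x t_def by (simp add: cong_def)
  qed
  have vu: "[v * u = 1] (mod int c)" using uv(5) by (simp add: mult.commute)
  have "kloosterman c m n = (\<Sum>x\<in>inv_pairs c. (\<lambda>(a, d). add_char c (m * d + n * a)) (t u v x))"
    unfolding kloosterman_def
    by (rule sum.reindex_bij_witness[of _ "t u v" "t v u"])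
       (use closed[OF uv(5)] closed[OF vu] inv[OF uv(5)] inv[OF vu] in auto)
  also have "\<dots> = kloosterman c (m * u) (n * v)"
    unfolding kloosterman_def t_def
  proof (rule sum.cong[OF refl], goal_cases)
    case (1 x)
    obtain a d where x: "x = (a, d)" by force
    have "[m * (u * d mod int c) + n * (v * a mod int c) = m * (u * d) + n * (v * a)] (mod int c)"
      by (intro cong_add cong_scalar_left) (auto simp: cong_def)
    then show ?case
      using add_char_cong[OF assms(1)] by (simp add: x mult.assoc)
  qed
  finally show ?thesis by simp
qed

section \<open>A power-saving bound for Kloosterman sums\<close>

definition divisor_count :: "nat \<Rightarrow> nat" where
  "divisor_count c = card {e. e dvd c}"

text \<open>
  From \<open>\<Sum>\<phi>(e) = c\<close> over the divisors \<open>e\<close> of \<open>c\<close>, since each \<open>\<phi>(e)\<close> divides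
  \<open>\<phi>(c)\<close>. It replaces any finer lower bound for the totient.
\<close>

lemma le_divisor_count_totient: "c \<le> divisor_count c * totient c"
proof (cases "c = 0")
  case False
  have "(\<Sum>e | e dvd c. totient e) \<le> of_nat (card {e. e dvd c}) * totient c"
    by (rule sum_bounded_above) (use False in \<open>auto intro!: dvd_imp_le totient_dvd\<close>)
  then show ?thesis
    by (simp add: totient_divisor_sum divisor_count_def)
qed auto

lemma int_div_in_range:
  assumes "0 \<le> (u::int)" "u < g * k" "0 < k"
  shows "u div k \<in> {0..<g}"
proof -
  have "k * (u div k) \<le> u"
    using assms(3) by (metis minus_mod_eq_mult_div pos_mod_sign diff_le_eq le_add_same_cancel1)
  then have "k * (u div k) < k * g" using assms(2) by (simp add: mult.commute)
  then show ?thesis using assms by (simp add: pos_imp_zdiv_nonneg_iff)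
qed

text \<open>
  The solutions agree modulo \<open>c' = c / gcd(m, c)\<close>, so the quotient by \<open>c'\<close> tells them apart.
\<close>

lemma card_linear_congruence_le:
  assumes "c > 0"
  shows "card {u\<in>{0..<int c}. [m * u = a] (mod int c)} \<le> nat (gcd m (int c))"
proof -
  define S where "S = {u\<in>{0..<int c}. [m * u = a] (mod int c)}"
  define g where "g = gcd m (int c)"
  have g: "g > 0" using assms by (simp add: g_def)
  then have "gcd m (int c) \<noteq> 0" by (simp add: g_def)
  from gcd_coprime_exists[OF this] obtain m' c'
    where m': "m = m' * g" "int c = c' * g" "coprime m' c'"
    unfolding g_def by blast
  have "c' * g > 0" using assms m'(2) by linarith
  then have c': "c' > 0" using g by (simp add: zero_less_mult_iff)
  have inj: "inj_on (\<lambda>u. u div c') S"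
  proof (rule inj_onI)
    fix u v assume uv: "u \<in> S" "v \<in> S" "u div c' = v div c'"
    then have "[m * u = a] (mod int c)" "[m * v = a] (mod int c)" by (auto simp: S_def)
    then have "[m * u = m * v] (mod int c)"
      using cong_sym cong_trans by blast
    then have "c' * g dvd (m' * g) * (u - v)"
      unfolding cong_iff_dvd_diff m'(2)[symmetric] m'(1)[symmetric] right_diff_distrib .
    then have "c' * g dvd (m' * (u - v)) * g" by (simp only: mult_ac)
    then have "c' dvd m' * (u - v)" using g by simp
    then have "c' dvd u - v"
      using m'(3) by (simp add: coprime_commute coprime_dvd_mult_right_iff)
    then have "u mod c' = v mod c'" by (simp add: mod_eq_dvd_iff)
    with uv(3) show "u = v" by (metis div_mult_mod_eq)
  qed
  have "(\<lambda>u. u div c') ` S \<subseteq> {0..<g}"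
  proof clarify
    fix u assume u: "u \<in> S"
    then have "0 \<le> u" "u < int c" by (auto simp: S_def)
    then have "u < g * c'" using m'(2) by (simp only: mult.commute)
    then show "u div c' \<in> {0..<g}"
      using \<open>0 \<le> u\<close> by (intro int_div_in_range c')
  qed
  then have "card S \<le> card {0..<g}"
    using inj by (intro card_inj_on_le) auto
  then show ?thesis by (simp add: S_def g_def)
qed

lemma gcd_mult_dvd: "gcd (x * y) (c::int) dvd gcd x c * gcd y c"
proof -
  obtain u v where 1: "u * x + v * c = gcd x c" using bezout_int by blast
  obtain u' v' where 2: "u' * y + v' * c = gcd y c" using bezout_int by blast
  have "gcd x c * gcd y c = (u * u') * (x * y) + (u * x * v' + v * u' * y + v * v' * c) * c"
    unfolding 1[symmetric] 2[symmetric] by (simp add: algebra_simps)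
  then show ?thesis by simp
qed

text \<open>
  Each divisor \<open>g\<close> is the value of the gcd at no more than \<open>c / g\<close> residues, so it contributes at most
  \<open>c\<close>.
\<close>

lemma sum_gcd_le:
  assumes "c > 0"
  shows "(\<Sum>x\<in>{0..<int c}. nat (gcd x (int c))) \<le> c * divisor_count c"
proof -
  have fin: "finite {e. e dvd c}" using assms by simp
  have "(\<Sum>x\<in>{0..<int c}. nat (gcd x (int c))) =
        (\<Sum>g | g dvd c. \<Sum>x | x \<in> {0..<int c} \<and> nat (gcd x (int c)) = g. nat (gcd x (int c)))"
    by (rule sum.group[symmetric]) (use fin in \<open>auto simp: nat_dvd_iff\<close>)
  also have "\<dots> \<le> (\<Sum>g | g dvd c. c)"
  proof (rule sum_mono)
    fix g assume "g \<in> {g. g dvd c}"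
    then obtain k where k: "c = g * k" by auto
    then have g: "g > 0" using assms by auto
    have "(\<Sum>x | x \<in> {0..<int c} \<and> nat (gcd x (int c)) = g. nat (gcd x (int c))) =
          card {x \<in> {0..<int c}. nat (gcd x (int c)) = g} * g" by simp
    also have "\<dots> \<le> card {0..<int k} * g"
    proof (intro mult_right_mono card_inj_on_le)
      have *: "int g dvd x" "int g * (x div int g) = x"
        if "x \<in> {x \<in> {0..<int c}. nat (gcd x (int c)) = g}" for x
      proof -
        from that have "int g = gcd x (int c)" by auto
        then show "int g dvd x" by simp
        then show "int g * (x div int g) = x" by simp
      qed
      show "inj_on (\<lambda>x. x div int g) {x \<in> {0..<int c}. nat (gcd x (int c)) = g}"
        by (rule inj_onI) (metis *(2))
      show "(\<lambda>x. x div int g) ` {x \<in> {0..<int c}. nat (gcd x (int c)) = g} \<subseteq> {0..<int k}"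
      proof (rule image_subsetI)
        fix x assume "x \<in> {x \<in> {0..<int c}. nat (gcd x (int c)) = g}"
        then have x: "x \<in> {0..<int c}" by blast
        have "0 \<le> x" "x < int k * int g" using k x by (simp_all add: mult.commute)
        then show "x div int g \<in> {0..<int k}"
          by (intro int_div_in_range) (use g in auto)
      qed
    qed auto
    also have "\<dots> = c" using k by simp
    finally show "(\<Sum>x | x \<in> {0..<int c} \<and> nat (gcd x (int c)) = g. nat (gcd x (int c))) \<le> c" .
  qed
  also have "\<dots> = c * divisor_count c" by (simp add: divisor_count_def)
  finally show ?thesis .
qed

text \<open>
  Given \<open>x\<close> and \<open>y\<close>, the number of \<open>z\<close> is at most \<open>gcd(xy, c)\<close>, which is at most
  \<open>gcd(x, c) gcd(y, c)\<close>.
\<close>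

lemma card_zero_triples_le:
  assumes "c > 0"
  shows "card {(x, y, z). x \<in> {0..<int c} \<and> y \<in> {0..<int c} \<and> z \<in> {0..<int c} \<and> int c dvd x * y * z}
           \<le> (c * divisor_count c)\<^sup>2"
proof -
  let ?R = "{0..<int c}"
  have eq: "{(x, y, z). x \<in> ?R \<and> y \<in> ?R \<and> z \<in> ?R \<and> int c dvd x * y * z} =
      (SIGMA x:?R. SIGMA y:?R. {z\<in>?R. [(x * y) * z = 0] (mod int c)})"
    by (auto simp: cong_0_iff)
  have "card {(x, y, z). x \<in> ?R \<and> y \<in> ?R \<and> z \<in> ?R \<and> int c dvd x * y * z} =
      (\<Sum>x\<in>?R. \<Sum>y\<in>?R. card {z\<in>?R. [(x * y) * z = 0] (mod int c)})"
  proof -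
    have fin: "finite {z\<in>?R. [(x * y) * z = 0] (mod int c)}" for x y
      by (rule finite_subset[of _ ?R]) auto
    show ?thesis
      unfolding eq by (subst card_SigmaI; (intro ballI finite_SigmaI fin sum.cong refl)?; (rule card_SigmaI)?; simp add: fin del: atLeastLessThan_iff)
  qed
  also have "\<dots> \<le> (\<Sum>x\<in>?R. \<Sum>y\<in>?R. nat (gcd x (int c)) * nat (gcd y (int c)))"
  proof (intro sum_mono)
    fix x y
    have "card {z\<in>?R. [(x * y) * z = 0] (mod int c)} \<le> nat (gcd (x * y) (int c))"
      by (rule card_linear_congruence_le) fact
    also have "\<dots> \<le> nat (gcd x (int c) * gcd y (int c))"
      using gcd_mult_dvd[of x y "int c"] assms by (intro nat_mono zdvd_imp_le) auto
    finally show "card {z\<in>?R. [(x * y) * z = 0] (mod int c)} \<le> nat (gcd x (int c)) * nat (gcd y (int c))"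
      by (simp add: nat_mult_distrib)
  qed
  also have "\<dots> = (\<Sum>x\<in>?R. nat (gcd x (int c)))\<^sup>2"
    by (simp add: power2_eq_square sum_product)
  also have "\<dots> \<le> (c * divisor_count c)\<^sup>2"
    by (intro power_mono sum_gcd_le assms) simp
  finally show ?thesis .
qed

text \<open>
  The two congruences imply \<open>(a3 - a1)(a3 - a2)(a1 + a2) \<equiv> 0\<close>, because \<open>a1 + a2 = a3 + a4\<close> and
  \<open>(a1 + a2) a3 a4 \<equiv> (a3 + a4) a1 a2\<close>. The three factors determine \<open>2 a3\<close>, hence \<open>a3\<close> up to
  one binary choice, and then everything else. This works for every modulus, prime or not.
\<close>

lemma card_additive_quadruples_le:
  assumes "c > 0"
  defines "Q \<equiv> {(x, y). x \<in> inv_pairs c \<times> inv_pairs c \<and> y \<in> inv_pairs c \<times> inv_pairs c \<and>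
      [snd (fst x) + snd (snd x) = snd (fst y) + snd (snd y)] (mod int c) \<and>
      [fst (fst x) + fst (snd x) = fst (fst y) + fst (snd y)] (mod int c)}"
  shows "card Q \<le> 2 * (c * divisor_count c)\<^sup>2"
proof -
  let ?R = "{0..<int c}"
  define T where "T = {(x, y, z). x \<in> ?R \<and> y \<in> ?R \<and> z \<in> ?R \<and> int c dvd x * y * z}"
  \<comment> \<open>The Boolean tells apart the two residues \<open>a3\<close> with the same double modulo \<open>c\<close>.\<close>
  define \<phi> where "\<phi> = (\<lambda>(((a1, d1 :: int), (a2, d2 :: int)), ((a3, d3 :: int), (a4 :: int, d4 :: int))).
      ((((a3 - a1 :: int) mod int c, (a3 - a2) mod int c, (a1 + a2) mod int c), 2 * a3 \<ge> int c) ::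
        (int \<times> int \<times> int) \<times> bool))"
  have Q: "(((a1, d1), (a2, d2)), ((a3, d3), (a4, d4))) \<in> Q \<longleftrightarrow>
      (a1, d1) \<in> inv_pairs c \<and> (a2, d2) \<in> inv_pairs c \<and> (a3, d3) \<in> inv_pairs c \<and> (a4, d4) \<in> inv_pairs c \<and>
      [d1 + d2 = d3 + d4] (mod int c) \<and> [a1 + a2 = a3 + a4] (mod int c)" for a1 d1 a2 d2 a3 d3 a4 d4
    by (auto simp: Q_def)
  have "\<phi> ` Q \<subseteq> T \<times> UNIV"
  proof (rule image_subsetI)
    fix x assume x: "x \<in> Q"
    obtain a1 d1 a2 d2 a3 d3 a4 d4 where x_eq: "x = (((a1, d1), (a2, d2)), ((a3, d3), (a4, d4)))"
      by (metis surj_pair)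
    have q: "(((a1, d1), (a2, d2)), ((a3, d3), (a4, d4))) \<in> Q"
      using x x_eq by simp
    note q' = q[unfolded Q]
    have inv: "[a1 * d1 = 1] (mod int c)" "[a2 * d2 = 1] (mod int c)"
        "[a3 * d3 = 1] (mod int c)" "[a4 * d4 = 1] (mod int c)"
      using q' by (auto dest: inv_pairsD)
    have "[(a1 + a2) * (a3 * a4) = (a1 * a2) * (a3 + a4)] (mod int c)"
    proof -
      have "[(a1 + a2) * (a3 * a4) = (a1 * (a2 * d2) + a2 * (a1 * d1)) * (a3 * a4)] (mod int c)"
        by (intro cong_scalar_right cong_add)
           (use cong_scalar_left[OF inv(2), of a1] cong_scalar_left[OF inv(1), of a2] in \<open>auto simp: cong_sym_eq\<close>)
      also have "(a1 * (a2 * d2) + a2 * (a1 * d1)) * (a3 * a4) = (a1 * a2 * a3 * a4) * (d1 + d2)"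
        by (simp add: algebra_simps)
      also have "[\<dots> = (a1 * a2 * a3 * a4) * (d3 + d4)] (mod int c)"
        using q' by (intro cong_scalar_left) auto
      also have "(a1 * a2 * a3 * a4) * (d3 + d4) = (a1 * a2) * (a4 * (a3 * d3) + a3 * (a4 * d4))"
        by (simp add: algebra_simps)
      also have "[\<dots> = (a1 * a2) * (a4 * 1 + a3 * 1)] (mod int c)"
        by (intro cong_scalar_left cong_add inv)
      finally show ?thesis by (simp add: add.commute)
    qed
    moreover have "[(a1 * a2) * (a3 + a4) = (a1 * a2) * (a1 + a2)] (mod int c)"
      using q' by (intro cong_scalar_left) (auto simp: cong_sym_eq)
    ultimately have key: "[(a1 + a2) * (a3 * a4) = (a1 * a2) * (a1 + a2)] (mod int c)"
      by (rule cong_trans)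
    have "[a4 = a1 + a2 - a3] (mod int c)"
    proof -
      have "[a1 + a2 - a3 = (a3 + a4) - a3] (mod int c)"
        using q' by (intro cong_diff) auto
      then show ?thesis by (simp add: cong_sym_eq)
    qed
    then have "[(a1 + a2) * (a3 * a4) = (a1 + a2) * (a3 * (a1 + a2 - a3))] (mod int c)"
      by (intro cong_scalar_left)
    with key have "[(a1 * a2) * (a1 + a2) = (a1 + a2) * (a3 * (a1 + a2 - a3))] (mod int c)"
      by (metis cong_sym cong_trans)
    then have "int c dvd (a1 * a2) * (a1 + a2) - (a1 + a2) * (a3 * (a1 + a2 - a3))"
      by (simp add: cong_iff_dvd_diff)
    also have "(a1 * a2) * (a1 + a2) - (a1 + a2) * (a3 * (a1 + a2 - a3)) =
               (a3 - a1) * (a3 - a2) * (a1 + a2)"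
      by (simp add: algebra_simps)
    finally have "int c dvd (((a3 - a1) mod int c) * ((a3 - a2) mod int c) mod int c) *
        ((a1 + a2) mod int c) mod int c"
      by (metis dvd_mod_iff dvd_refl mod_mult_eq)
    then have "int c dvd ((a3 - a1) mod int c) * ((a3 - a2) mod int c) * ((a1 + a2) mod int c)"
      by (metis dvd_mod_iff dvd_refl mod_mult_left_eq)
    then show "\<phi> x \<in> T \<times> UNIV"
      using assms(1) by (auto simp: T_def \<phi>_def x_eq)
  qed
  moreover have "inj_on \<phi> Q"
  proof (rule inj_onI)
    fix x y assume xy: "x \<in> Q" "y \<in> Q" "\<phi> x = \<phi> y"
    obtain a1 d1 a2 d2 a3 d3 a4 d4 where x: "x = (((a1, d1), (a2, d2)), ((a3, d3), (a4, d4)))"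
      by (metis surj_pair)
    obtain a1' d1' a2' d2' a3' d3' a4' d4'
      where y: "y = (((a1', d1'), (a2', d2')), ((a3', d3'), (a4', d4')))"
      by (metis surj_pair)
    have q: "(((a1, d1), (a2, d2)), ((a3, d3), (a4, d4))) \<in> Q"
      and q': "(((a1', d1'), (a2', d2')), ((a3', d3'), (a4', d4'))) \<in> Q"
      and eq: "\<phi> (((a1, d1), (a2, d2)), ((a3, d3), (a4, d4))) =
               \<phi> (((a1', d1'), (a2', d2')), ((a3', d3'), (a4', d4')))"
      using xy unfolding x y by this+
    note q = q[unfolded Q] and q' = q'[unfolded Q]
    have e: "[a3 - a1 = a3' - a1'] (mod int c)" "[a3 - a2 = a3' - a2'] (mod int c)"
       "[a1 + a2 = a1' + a2'] (mod int c)" and b: "2 * a3 \<ge> int c \<longleftrightarrow> 2 * a3' \<ge> int c"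
      using eq by (auto simp: \<phi>_def cong_def)
    have "[(a3 - a1) + (a3 - a2) + (a1 + a2) = (a3' - a1') + (a3' - a2') + (a1' + a2')] (mod int c)"
      by (intro cong_add e)
    then have dv: "int c dvd 2 * a3 - 2 * a3'"
      by (simp add: cong_iff_dvd_diff)
    have r: "0 \<le> a3" "a3 < int c" "0 \<le> a3'" "a3' < int c"
      using q q' by (auto dest: inv_pairsD)
    have "2 * a3 - 2 * a3' = 0"
    proof (rule ccontr)
      assume "2 * a3 - 2 * a3' \<noteq> 0"
      then have "int c \<le> \<bar>2 * a3 - 2 * a3'\<bar>"
        using dv by (simp add: zdvd_imp_le dvd_imp_le_int)
      then show False using r b by linarith
    qed
    then have a3: "a3 = a3'" by simp
    have "[a3 - (a3 - a1) = a3' - (a3' - a1')] (mod int c)"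
      by (intro cong_diff e) (simp add: a3)
    then have a1: "[a1 = a1'] (mod int c)" by simp
    have "[a3 - (a3 - a2) = a3' - (a3' - a2')] (mod int c)"
      by (intro cong_diff e) (simp add: a3)
    then have a2: "[a2 = a2'] (mod int c)" by simp
    have "[a3 + a4 = a3' + a4'] (mod int c)"
      using q q' e(3) by (metis cong_sym cong_trans)
    then have a4: "[a4 = a4'] (mod int c)"
      by (simp add: a3 cong_add_lcancel)
    show "x = y"
      unfolding x y
      using q q' inv_pairs_unique[OF _ _ a1, of d1 d1'] inv_pairs_unique[OF _ _ a2, of d2 d2']
        inv_pairs_unique[of a3 d3 c a3' d3'] inv_pairs_unique[OF _ _ a4, of d4 d4'] a3
      by auto
  qed
  moreover have fin: "finite T"
    by (rule finite_subset[of _ "?R \<times> ?R \<times> ?R"]) (auto simp: T_def)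
  ultimately have "card Q \<le> card (T \<times> (UNIV :: bool set))"
    by (intro card_inj_on_le) auto
  also have "\<dots> = 2 * card T" by (simp add: card_cartesian_product)
  also have "\<dots> \<le> 2 * (c * divisor_count c)\<^sup>2"
    using card_zero_triples_le[OF assms(1)] by (simp add: T_def)
  finally show ?thesis .
qed

text \<open>
  The square of a Kloosterman sum is an exponential sum over pairs of inverse pairs, so Parseval's identity counts
  the coincidences of \<open>(d1 + d2, a1 + a2)\<close>.
\<close>

lemma kloosterman_fourth_moment:
  assumes "c > 0"
  shows "(\<Sum>p\<in>{0..<int c} \<times> {0..<int c}. norm (kloosterman c (fst p) (snd p)) ^ 4)
           \<le> 2 * real c ^ 4 * real (divisor_count c) ^ 2"
proof -
  define X where "X = inv_pairs c \<times> inv_pairs c"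
  have fin: "finite X" by (simp add: X_def)
  define f g where "f = (\<lambda>x :: (int \<times> int) \<times> (int \<times> int). snd (fst x) + snd (snd x))"
    and "g = (\<lambda>x :: (int \<times> int) \<times> (int \<times> int). fst (fst x) + fst (snd x))"
  have sq: "kloosterman c a b ^ 2 = (\<Sum>x\<in>X. 1 * add_char c (a * f x + b * g x))" for a b
    unfolding kloosterman_def power2_eq_square sum_product X_def sum.cartesian_product
    by (intro sum.cong refl) (auto simp: f_def g_def add_char_add[symmetric] algebra_simps)
  define Q where "Q = {(x, y). x \<in> inv_pairs c \<times> inv_pairs c \<and> y \<in> inv_pairs c \<times> inv_pairs c \<and>
      [snd (fst x) + snd (snd x) = snd (fst y) + snd (snd y)] (mod int c) \<and>
      [fst (fst x) + fst (snd x) = fst (fst y) + fst (snd y)] (mod int c)}"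
  have "complex_of_real (\<Sum>p\<in>{0..<int c} \<times> {0..<int c}. norm (kloosterman c (fst p) (snd p)) ^ 4) =
     (\<Sum>a\<in>{0..<int c}. \<Sum>b\<in>{0..<int c}. complex_of_real ((norm (kloosterman c a b ^ 2))\<^sup>2))"
    by (simp add: sum.cartesian_product norm_power case_prod_unfold flip: power_mult)
  also have "\<dots> = of_nat c ^ 2 * (\<Sum>x\<in>X. \<Sum>y\<in>X.
            if [f x = f y] (mod int c) \<and> [g x = g y] (mod int c) then 1 * cnj 1 else 0)"
    unfolding sq by (rule parseval_mod[OF assms fin])
  also have "(\<Sum>x\<in>X. \<Sum>y\<in>X.
            if [f x = f y] (mod int c) \<and> [g x = g y] (mod int c) then 1 * cnj 1 else 0) = complex_of_real (card Q)"
  proof -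
    have "Q = {z \<in> X \<times> X. [f (fst z) = f (snd z)] (mod int c) \<and> [g (fst z) = g (snd z)] (mod int c)}"
      by (auto simp: Q_def X_def f_def g_def)
    then have "complex_of_real (card Q) = (\<Sum>z\<in>X \<times> X.
       if [f (fst z) = f (snd z)] (mod int c) \<and> [g (fst z) = g (snd z)] (mod int c) then 1 else 0)"
      using fin by (simp add: sum.If_cases Int_def)
    then show ?thesis
      by (unfold sum.cartesian_product case_prod_unfold complex_cnj_one mult_1_right) (erule sym)
  qed
  finally have "complex_of_real (\<Sum>p\<in>{0..<int c} \<times> {0..<int c}. norm (kloosterman c (fst p) (snd p)) ^ 4) =
     complex_of_real (real c ^ 2 * card Q)" by simp
  then have "(\<Sum>p\<in>{0..<int c} \<times> {0..<int c}. norm (kloosterman c (fst p) (snd p)) ^ 4) =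
     real c ^ 2 * card Q" by (simp only: of_real_eq_iff)
  also have "\<dots> \<le> real c ^ 2 * real (2 * (c * divisor_count c)\<^sup>2)"
    using card_additive_quadruples_le[OF assms] by (intro mult_left_mono of_nat_mono) (auto simp: Q_def)
  also have "\<dots> = 2 * real c ^ 4 * real (divisor_count c) ^ 2"
    by (simp add: power_mult_distrib power4_eq_xxxx power2_eq_square)
  finally show ?thesis .
qed

text \<open>
  The left side is the fourth moment restricted to the orbit of \<open>(m, n)\<close>; a given frequency pair is hit by at
  most \<open>gcd(m, c)\<close> units.
\<close>

lemma totient_kloosterman_fourth_power_le:
  assumes "c > 0"
  shows "real (totient c) * norm (kloosterman c m n) ^ 4
           \<le> real_of_int (gcd m (int c)) * (2 * real c ^ 4 * real (divisor_count c) ^ 2)"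
proof -
  let ?R = "{0..<int c}"
  let ?F = "\<lambda>p. norm (kloosterman c (fst p) (snd p)) ^ 4"
  define \<pi> where "\<pi> = (\<lambda>(u, v). ((m * u) mod int c, (n * v) mod int c))"
  have "real (totient c) * norm (kloosterman c m n) ^ 4 = (\<Sum>x\<in>inv_pairs c. norm (kloosterman c m n) ^ 4)"
    by (simp add: card_inv_pairs assms)
  also have "\<dots> = (\<Sum>x\<in>inv_pairs c. ?F (\<pi> x))"
  proof (intro sum.cong refl)
    fix x assume "x \<in> inv_pairs c"
    moreover obtain u v where x: "x = (u, v)" by force
    ultimately have "kloosterman c m n = kloosterman c (m * u) (n * v)"
      using kloosterman_unit_invariant[OF assms] by auto
    also have "\<dots> = kloosterman c ((m * u) mod int c) ((n * v) mod int c)"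
      by (rule kloosterman_cong[OF assms]) (auto simp: cong_def)
    finally show "norm (kloosterman c m n) ^ 4 = ?F (\<pi> x)" by (simp add: x \<pi>_def)
  qed
  also have "\<dots> = (\<Sum>p\<in>?R \<times> ?R. \<Sum>x | x \<in> inv_pairs c \<and> \<pi> x = p. ?F (\<pi> x))"
    by (rule sum.group[symmetric]) (use assms in \<open>auto simp: \<pi>_def\<close>)
  also have "\<dots> \<le> (\<Sum>p\<in>?R \<times> ?R. real_of_int (gcd m (int c)) * ?F p)"
  proof (rule sum_mono)
    fix p assume "p \<in> ?R \<times> ?R"
    have "card {x \<in> inv_pairs c. \<pi> x = p} \<le> card {u\<in>?R. [m * u = fst p] (mod int c)}"
    proof (rule card_inj_on_le)
      show "inj_on fst {x \<in> inv_pairs c. \<pi> x = p}"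
        by (rule inj_on_subset[OF inj_on_fst_inv_pairs]) auto
      show "fst ` {x \<in> inv_pairs c. \<pi> x = p} \<subseteq> {u\<in>?R. [m * u = fst p] (mod int c)}"
        by (auto simp: \<pi>_def cong_def dest: inv_pairsD)
      show "finite {u\<in>?R. [m * u = fst p] (mod int c)}" by (rule finite_Collect_conjI) auto
    qed
    also have "\<dots> \<le> nat (gcd m (int c))"
      by (rule card_linear_congruence_le) fact
    finally have "real (card {x \<in> inv_pairs c. \<pi> x = p}) \<le> real_of_int (gcd m (int c))"
      by (metis gcd_ge_0_int of_nat_le_iff of_nat_nat of_int_of_nat_eq)
    then have "real (card {x \<in> inv_pairs c. \<pi> x = p}) * ?F p \<le> real_of_int (gcd m (int c)) * ?F p"
      by (rule mult_right_mono) simp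
    then show "(\<Sum>x | x \<in> inv_pairs c \<and> \<pi> x = p. ?F (\<pi> x)) \<le> real_of_int (gcd m (int c)) * ?F p"
      by simp
  qed
  also have "\<dots> \<le> real_of_int (gcd m (int c)) * (2 * real c ^ 4 * real (divisor_count c) ^ 2)"
    unfolding sum_distrib_left[symmetric]
    by (rule mult_left_mono[OF kloosterman_fourth_moment[OF assms]]) simp
  finally show ?thesis .
qed

lemma divisor_count_pos: "c > 0 \<Longrightarrow> divisor_count c > 0"
  by (auto simp: divisor_count_def card_gt_0_iff)

text \<open>
  Any exponent below \<open>1\<close> would serve; the divisor function is harmless because
  \<open>\<Sum> d(c) c^(-p)\<close> converges for \<open>p > 1\<close>. The bound is useful as soon as one of the two frequencies is nonzero
  modulo \<open>c\<close>, however divisible the modulus is.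
\<close>

lemma kloosterman_bound:
  assumes "c > 0"
  shows "norm (kloosterman c m n)
           \<le> 2 * real_of_int (gcd m (int c)) powr (1/4) * real c powr (3/4) * real (divisor_count c)"
proof -
  let ?d = "real (divisor_count c)" and ?g = "real_of_int (gcd m (int c))"
  let ?K = "norm (kloosterman c m n)"
  have d: "?d \<ge> 1" using divisor_count_pos[OF assms] by simp
  have g: "?g > 0" using assms by simp
  have "real c * ?K ^ 4 \<le> (?d * real (totient c)) * ?K ^ 4"
    using le_divisor_count_totient[of c]
    by (intro mult_right_mono) (auto simp flip: of_nat_mult)
  also have "\<dots> = ?d * (real (totient c) * ?K ^ 4)" by simp
  also have "\<dots> \<le> ?d * (?g * (2 * real c ^ 4 * ?d ^ 2))"
    by (intro mult_left_mono totient_kloosterman_fourth_power_le assms) simp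
  also have "\<dots> = real c * (2 * ?g * real c ^ 3 * ?d ^ 3)"
    by (simp add: eval_nat_numeral)
  finally have "?K ^ 4 \<le> 2 * ?g * real c ^ 3 * ?d ^ 3"
    using assms by simp
  also have "\<dots> \<le> 16 * ?g * real c ^ 3 * ?d ^ 4"
    by (intro mult_mono[OF _ power_increasing]) (use d g assms in \<open>auto intro!: mult_right_mono\<close>)
  also have "\<dots> = (2 * ?g powr (1/4) * real c powr (3/4) * ?d) ^ 4"
    using g assms by (simp add: power_mult_distrib powr_power)
  finally show ?thesis
    by (rule power_le_imp_le_base[where n = 3, simplified]) (use g in auto)
qed

lemma summable_on_nat_powr:
  assumes "p > 1"
  shows "(\<lambda>n. real n powr (- p)) summable_on UNIV"
  using assms summable_real_powr_iff[of "- p"]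
  by (intro norm_summable_imp_summable_on) simp

lemma summable_on_pos_nat_powr: "p > 1 \<Longrightarrow> (\<lambda>n. real n powr (- p)) summable_on A"
  by (rule summable_on_subset_banach[OF summable_on_nat_powr]) auto

text \<open>
  The series is the square of \<open>\<Sum> n^(-p)\<close>, summed along the products \<open>e f = c\<close>.
\<close>

lemma divisor_count_series_summable:
  assumes "p > 1"
  shows "(\<lambda>c. real (divisor_count c) * real c powr (- p)) summable_on {0<..}"
proof -
  have "(\<lambda>(e, f). real e powr (- p) * real f powr (- p)) summable_on {0<..} \<times> {0<..}"
  proof (rule summable_on_SigmaI)
    fix e :: nat show "((\<lambda>f. case (e, f) of (e, f) \<Rightarrow> real e powr (- p) * real f powr (- p)) has_sum
        real e powr (- p) * (\<Sum>\<^sub>\<infinity>f\<in>{0<..}. real f powr (- p))) {0<..}"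
      unfolding prod.case by (intro has_sum_cmult_right has_sum_infsum summable_on_pos_nat_powr assms)
  next
    show "(\<lambda>e. real e powr (- p) * (\<Sum>\<^sub>\<infinity>f\<in>{0<..}. real f powr (- p))) summable_on {0<..}"
      by (intro summable_on_cmult_left summable_on_pos_nat_powr assms)
  qed auto
  moreover have bij: "bij_betw (\<lambda>(e, f). (e * f, e)) ({0<..} \<times> {0<..}) (SIGMA c:{0<..}. {e::nat. e dvd c})"
    by (rule bij_betw_byWitness[where f' = "\<lambda>(c, e). (e, c div e)"])
       (auto intro: Nat.gr0I)
  ultimately have "(\<lambda>(c, e). real c powr (- p)) summable_on (SIGMA c:{0<..}. {e::nat. e dvd c})"
    using summable_on_reindex_bij_betw[OF bij, of "\<lambda>(c, e). real c powr (- p)"]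
    by (simp add: case_prod_unfold powr_mult)
  then have "(\<lambda>c. \<Sum>\<^sub>\<infinity>e\<in>{e. e dvd c}. real c powr (- p)) summable_on {0<..}"
    using summable_on_Sigma_banach[of "\<lambda>c e. real c powr (- p)" "{0<..}" "\<lambda>c. {e::nat. e dvd c}"] by simp
  then show ?thesis by (simp add: divisor_count_def)
qed

section \<open>Equidistribution of inverse pairs modulo c\<close>

text \<open>
  For \<open>0 \<le> m < c\<close> this is the distance from \<open>m\<close> to the nearest multiple of \<open>c\<close>, the true size of a
  frequency modulo \<open>c\<close>.
\<close>

definition circ_dist :: "nat \<Rightarrow> int \<Rightarrow> real" where
  "circ_dist c m = real_of_int (min m (int c - m))"

lemma sin_ge_half:
  assumes "0 \<le> x" "x \<le> pi / 2"
  shows "sin x \<ge> x / 2"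
proof -
  have "\<bar>sin x - x\<bar> \<le> x ^ 3 / 6"
    using Maclaurin_sin_bound[of x 3] assms(1)
    by (simp add: sin_coeff_def eval_nat_numeral divide_simps mult_ac)
  moreover have "x ^ 3 / 6 \<le> x / 2"
  proof -
    have "x \<le> 1.7" using assms(2) pi_less_4 pi_approx by simp
    then have "x * x \<le> 1.7 * 1.7" using assms(1) by (intro mult_mono) auto
    then have "x * (x * x) \<le> x * 3" using assms(1) by (intro mult_left_mono) auto
    then show ?thesis by (simp add: eval_nat_numeral)
  qed
  ultimately show ?thesis by linarith
qed

text \<open>
  The chord is \<open>2 |sin (\<pi> m / c)|\<close>; the symmetry of the sine about \<open>\<pi>/2\<close> reduces to angles of at most
  \<open>\<pi>/2\<close>.
\<close>

lemma norm_add_char_minus_1_ge: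
  assumes "m \<in> {0..<int c}"
  shows "norm (add_char c m - 1) \<ge> circ_dist c m / c"
proof -
  have c: "c > 0" using assms by auto
  define y where "y = pi * of_int m / real c"
  define t where "t = circ_dist c m / c"
  have "norm (add_char c m - 1) = 2 * \<bar>sin y\<bar>"
    using dist_exp_i_1[of "2 * y"] by (simp add: add_char_def cis_conv_exp y_def mult_ac)
  moreover have "sin y \<ge> t / 2"
  proof (cases "2 * m \<le> int c")
    case True
    have "2 * real_of_int m \<le> real c" using True by linarith
    then have "y \<ge> 0" "y \<le> pi / 2"
      using assms c by (auto simp: y_def field_simps)
    then have "sin y \<ge> y / 2" by (rule sin_ge_half)
    moreover have "real_of_int m * 1 \<le> real_of_int m * pi"
      using assms pi_ge_two by (intro mult_left_mono) auto
    then have "y \<ge> t"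
      using True c assms by (auto simp: t_def y_def circ_dist_def field_simps min_def)
    ultimately show ?thesis by linarith
  next
    case False
    then have F: "real c \<le> 2 * real_of_int m" by linarith
    have "pi - y \<ge> 0" "pi - y \<le> pi / 2"
      using assms c F by (auto simp: y_def field_simps)
    then have "sin (pi - y) \<ge> (pi - y) / 2" by (rule sin_ge_half)
    moreover have "(real c - real_of_int m) * 1 \<le> (real c - real_of_int m) * pi"
      using assms pi_ge_two by (intro mult_left_mono) auto
    then have "(real c - real_of_int m) * 1 / c \<le> (real c - real_of_int m) * pi / c"
      using c by (intro divide_right_mono) auto
    then have "pi - y \<ge> t"
      using False c
      by (simp add: t_def y_def circ_dist_def min_def diff_divide_distrib left_diff_distrib right_diff_distrib
            mult.commute[of _ pi])
    ultimately show ?thesis by simp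
  qed
  ultimately show ?thesis unfolding t_def[symmetric] by linarith
qed

text \<open>
  Normalised so that the coefficient of frequency \<open>0\<close> is the mean value.
\<close>

definition dft :: "nat \<Rightarrow> (int \<Rightarrow> complex) \<Rightarrow> int \<Rightarrow> complex" where
  "dft c G m = (\<Sum>b\<in>{0..<int c}. G b * add_char c (- (m * b))) / of_nat c"

lemma dft_inversion:
  assumes "b \<in> {0..<int c}"
  shows "G b = (\<Sum>m\<in>{0..<int c}. dft c G m * add_char c (m * b))"
proof -
  let ?R = "{0..<int c}"
  have c: "c > 0" using assms by auto
  have "(\<Sum>m\<in>?R. dft c G m * add_char c (m * b)) =
        (\<Sum>m\<in>?R. \<Sum>b'\<in>?R. G b' / of_nat c * add_char c (m * (b - b')))"
    unfolding dft_def sum_divide_distrib sum_distrib_right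
    by (intro sum.cong refl) (simp add: add_char_add[symmetric] algebra_simps)
  also have "\<dots> = (\<Sum>b'\<in>?R. G b' / of_nat c * (\<Sum>m\<in>?R. add_char c (m * (b - b'))))"
    by (subst sum.swap) (simp add: sum_distrib_left)
  also have "\<dots> = (\<Sum>b'\<in>?R. if b' = b then G b' else 0)"
  proof (intro sum.cong refl)
    fix b' assume b': "b' \<in> ?R"
    have "int c dvd b - b' \<longleftrightarrow> b' = b"
    proof
      assume "int c dvd b - b'"
      then have "b mod int c = b' mod int c" by (simp add: mod_eq_dvd_iff)
      then show "b' = b" using assms b' by simp
    qed simp
    then show "G b' / of_nat c * (\<Sum>m\<in>?R. add_char c (m * (b - b'))) = (if b' = b then G b' else 0)"
      using c by (simp add: sum_add_char)
  qed
  also have "\<dots> = G b" using assms by simp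
  finally show ?thesis by simp
qed

lemma parseval_dft:
  assumes "c > 0"
  shows "(\<Sum>m\<in>{0..<int c}. (norm (dft c G m))\<^sup>2) = (\<Sum>b\<in>{0..<int c}. (norm (G b))\<^sup>2) / c"
proof -
  let ?R = "{0..<int c}"
  have "complex_of_real (c * (\<Sum>m\<in>?R. (norm (of_nat c * dft c G m))\<^sup>2)) =
      (\<Sum>a\<in>?R. \<Sum>b\<in>?R. complex_of_real ((norm (\<Sum>x\<in>?R. G x * add_char c (a * (- x) + b * 0)))\<^sup>2))"
    using assms by (simp add: dft_def sum_distrib_left[symmetric])
  also have "\<dots> = of_nat c ^ 2 * (\<Sum>x\<in>?R. \<Sum>y\<in>?R.
      if [- x = - y] (mod int c) \<and> [0 = (0::int)] (mod int c) then G x * cnj (G y) else 0)"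
    by (rule parseval_mod) (use assms in auto)
  also have "(\<Sum>x\<in>?R. \<Sum>y\<in>?R.
      if [- x = - y] (mod int c) \<and> [0 = (0::int)] (mod int c) then G x * cnj (G y) else 0) =
      (\<Sum>x\<in>?R. \<Sum>y\<in>?R. if x = y then G x * cnj (G y) else 0)"
    unfolding cong_minus_minus_iff by (intro sum.cong refl if_cong) (auto simp: cong_def)
  also have "\<dots> = complex_of_real (\<Sum>x\<in>?R. (norm (G x))\<^sup>2)"
    unfolding of_real_sum complex_norm_square by simp
  finally have "complex_of_real (c * (\<Sum>m\<in>?R. (norm (of_nat c * dft c G m))\<^sup>2)) =
      complex_of_real (c ^ 2 * (\<Sum>x\<in>?R. (norm (G x))\<^sup>2))" by simp
  then have "c * (\<Sum>m\<in>?R. (norm (of_nat c * dft c G m))\<^sup>2) = c ^ 2 * (\<Sum>x\<in>?R. (norm (G x))\<^sup>2)"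
    by (simp only: of_real_eq_iff)
  then show ?thesis
    using assms by (simp add: norm_mult power_mult_distrib sum_distrib_left[symmetric] power2_eq_square field_simps)
qed

lemma dft_shift_diff:
  assumes "c > 0" "\<And>b. G (b + int c) = G b"
  shows "dft c (\<lambda>b. G (b + 1) - G b) m = (add_char c m - 1) * dft c G m"
proof -
  let ?R = "{0..<int c}"
  have "(\<Sum>b\<in>?R. G (b + 1) * add_char c (- (m * b))) = (\<Sum>b\<in>?R. add_char c m * (G b * add_char c (- (m * b))))"
  proof (rule sum.reindex_bij_witness[of _ "\<lambda>b. (b - 1) mod int c" "\<lambda>b. (b + 1) mod int c"], goal_cases)
    case (5 b)
    have eq: "G ((b + 1) mod int c) = G (b + 1)"
    proof (cases "b + 1 = int c")
      case True then show ?thesis using assms(2)[of 0] by simp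
    next
      case False then show ?thesis using 5 by simp
    qed
    have "add_char c (m + - (m * ((b + 1) mod int c))) = add_char c (m + - (m * (b + 1)))"
      by (intro add_char_cong assms(1) cong_add cong_refl)
         (simp add: cong_minus_minus_iff, simp add: cong_def mod_mult_right_eq)
    then show ?case unfolding eq mult.left_commute[of "add_char c m"] add_char_add[symmetric]
      by (simp add: algebra_simps)
  qed (use assms in \<open>auto simp: mod_simps\<close>)
  then show ?thesis
    by (simp add: dft_def left_diff_distrib sum_subtractf sum_distrib_left diff_divide_distrib)
qed


definition zeta_three_halves_sum :: real where
  "zeta_three_halves_sum = (\<Sum>n. real (Suc n) powr - (3/2))"

lemma summable_zeta_three_halves: "summable (\<lambda>n. real (Suc n) powr - (3/2))"
  using summable_real_powr_iff[of "- (3/2)"] by (subst summable_Suc_iff) simp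

lemma sum_zeta_three_halves_le: "(\<Sum>n<k. real (Suc n) powr - (3/2)) \<le> zeta_three_halves_sum"
  unfolding zeta_three_halves_sum_def
  by (rule sum_le_suminf[OF summable_zeta_three_halves]) auto

lemma zeta_three_halves_sum_nonneg: "zeta_three_halves_sum \<ge> 0"
  using sum_zeta_three_halves_le[of 0] by simp

lemma circ_dist_ge_1: "m \<in> {1..<int c} \<Longrightarrow> circ_dist c m \<ge> 1"
  by (auto simp: circ_dist_def)

lemma sum_circ_dist_le: "(\<Sum>m\<in>{1..<int c}. circ_dist c m powr - (3/2)) \<le> 2 * zeta_three_halves_sum"
proof -
  have "(\<Sum>m\<in>{1..<int c}. circ_dist c m powr - (3/2)) \<le>
        (\<Sum>m\<in>{1..<int c}. real_of_int m powr - (3/2) + real_of_int (int c - m) powr - (3/2))"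
    by (intro sum_mono) (auto simp: circ_dist_def min_def)
  also have "\<dots> = (\<Sum>m\<in>{1..<int c}. real_of_int m powr - (3/2)) +
      (\<Sum>m\<in>{1..<int c}. real_of_int (int c - m) powr - (3/2))"
    by (rule sum.distrib)
  also have "(\<Sum>m\<in>{1..<int c}. real_of_int (int c - m) powr - (3/2)) =
             (\<Sum>m\<in>{1..<int c}. real_of_int m powr - (3/2))"
    by (rule sum.reindex_bij_witness[of _ "\<lambda>m. int c - m" "\<lambda>m. int c - m"]) auto
  also have "(\<Sum>m\<in>{1..<int c}. real_of_int m powr - (3/2)) = (\<Sum>n<c - 1. real (Suc n) powr - (3/2))"
    by (rule sum.reindex_bij_witness[of _ "\<lambda>n. int (Suc n)" "\<lambda>m. nat (m - 1)"]) auto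
  finally show ?thesis using sum_zeta_three_halves_le[of "c - 1"] by linarith
qed

text \<open>
  The growth of the Kloosterman bound in the frequency, with value \<open>1\<close> at frequency \<open>0\<close>.
\<close>

definition freq_weight :: "nat \<Rightarrow> int \<Rightarrow> real" where
  "freq_weight c m = (if m = 0 then 1 else circ_dist c m powr (1/4))"

definition dft_const :: real where
  "dft_const = 1 + sqrt (2 * zeta_three_halves_sum)"

text \<open>
  The Fourier coefficients of the first difference are those of \<open>G\<close> times \<open>e(m/c) - 1\<close>, so Parseval bounds
  \<open>\<Sum> |m|^2 |dft m|^2\<close> in terms of the Lipschitz constant. By the Cauchy-Schwarz inequality this controls the
  \<open>l^1\<close> norm even with the weight \<open>|m|^(1/4)\<close>, because \<open>\<Sum> |m|^(-3/2)\<close> converges.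
\<close>

lemma weighted_dft_bound:
  assumes "c > 0" "\<And>b. G (b + int c) = G b" "L \<ge> 0"
    and bound: "\<And>b. b \<in> {0..<int c} \<Longrightarrow> norm (G b) \<le> L"
    and lip: "\<And>b. b \<in> {0..<int c} \<Longrightarrow> norm (G (b + 1) - G b) \<le> L / c"
  shows "(\<Sum>m\<in>{0..<int c}. norm (dft c G m) * freq_weight c m) \<le> dft_const * L"
proof -
  let ?R = "{0..<int c}" and ?S = "{1..<int c}"
  have R: "?R = insert 0 ?S" using assms(1) by auto
  have "norm (\<Sum>b\<in>?R. G b) \<le> (\<Sum>b\<in>?R. L)"
    by (rule sum_norm_le) (use bound in auto)
  then have zero: "norm (dft c G 0) \<le> L"
    using assms(1) by (simp add: dft_def norm_divide field_simps)
  have "(\<Sum>m\<in>?S. (circ_dist c m / c * norm (dft c G m))\<^sup>2) \<le>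
        (\<Sum>m\<in>?S. (norm (dft c (\<lambda>b. G (b + 1) - G b) m))\<^sup>2)"
  proof (rule sum_mono)
    fix m assume m: "m \<in> ?S"
    have "circ_dist c m / c * norm (dft c G m) \<le> norm (add_char c m - 1) * norm (dft c G m)"
      by (intro mult_right_mono norm_add_char_minus_1_ge) (use m in auto)
    moreover have "circ_dist c m / c * norm (dft c G m) \<ge> 0"
      using circ_dist_ge_1[OF m] by simp
    ultimately show "(circ_dist c m / c * norm (dft c G m))\<^sup>2 \<le>
        (norm (dft c (\<lambda>b. G (b + 1) - G b) m))\<^sup>2"
      unfolding dft_shift_diff[where G = G, OF assms(1,2)] norm_mult by (rule power_mono)
  qed
  also have "\<dots> \<le> (\<Sum>m\<in>?R. (norm (dft c (\<lambda>b. G (b + 1) - G b) m))\<^sup>2)"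
    by (rule sum_mono2) auto
  also have "\<dots> = (\<Sum>b\<in>?R. (norm (G (b + 1) - G b))\<^sup>2) / c"
    by (rule parseval_dft[OF assms(1)])
  also have "\<dots> \<le> (\<Sum>b\<in>?R. (L / c)\<^sup>2) / c"
    by (intro divide_right_mono sum_mono power_mono lip) auto
  also have "\<dots> = L\<^sup>2 / c\<^sup>2"
    using assms(1) by (simp add: power_divide)
  finally have "(\<Sum>m\<in>?S. (circ_dist c m * norm (dft c G m))\<^sup>2) / c\<^sup>2 \<le> L\<^sup>2 / c\<^sup>2"
    by (simp add: sum_divide_distrib power_divide)
  then have E: "(\<Sum>m\<in>?S. (circ_dist c m * norm (dft c G m))\<^sup>2) \<le> L\<^sup>2"
    using assms(1) by (simp add: divide_le_cancel)
  have "(\<Sum>m\<in>?S. norm (dft c G m) * freq_weight c m) =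
        (\<Sum>m\<in>?S. (circ_dist c m * norm (dft c G m)) * circ_dist c m powr - (3/4))"
  proof (intro sum.cong refl)
    fix m assume m: "m \<in> ?S"
    have pos: "circ_dist c m > 0" using circ_dist_ge_1[OF m] by simp
    have "circ_dist c m powr (1/4) = circ_dist c m powr 1 * circ_dist c m powr - (3/4)"
      unfolding powr_add[symmetric] by simp
    then show "norm (dft c G m) * freq_weight c m =
        (circ_dist c m * norm (dft c G m)) * circ_dist c m powr - (3/4)"
      using m pos by (simp add: freq_weight_def)
  qed
  also have "\<dots> \<le> sqrt (L\<^sup>2 * (2 * zeta_three_halves_sum))"
  proof (rule real_le_rsqrt)
    have "(\<Sum>m\<in>?S. (circ_dist c m * norm (dft c G m)) * circ_dist c m powr - (3/4))\<^sup>2 \<le>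
      (\<Sum>m\<in>?S. (circ_dist c m * norm (dft c G m))\<^sup>2) * (\<Sum>m\<in>?S. (circ_dist c m powr - (3/4))\<^sup>2)"
      by (rule Cauchy_Schwarz_ineq_sum)
    also have "(\<Sum>m\<in>?S. (circ_dist c m powr - (3/4))\<^sup>2) = (\<Sum>m\<in>?S. circ_dist c m powr - (3/2))"
      by (intro sum.cong refl) (simp add: power2_eq_square powr_add[symmetric])
    also have "(\<Sum>m\<in>?S. (circ_dist c m * norm (dft c G m))\<^sup>2) * (\<Sum>m\<in>?S. circ_dist c m powr - (3/2))
        \<le> L\<^sup>2 * (2 * zeta_three_halves_sum)"
      by (intro mult_mono E sum_circ_dist_le sum_nonneg) auto
    finally show "(\<Sum>m\<in>?S. (circ_dist c m * norm (dft c G m)) * circ_dist c m powr - (3/4))\<^sup>2 \<le>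
       L\<^sup>2 * (2 * zeta_three_halves_sum)" .
  qed
  also have "\<dots> = L * sqrt (2 * zeta_three_halves_sum)"
    using assms(3) by (simp add: real_sqrt_mult)
  finally have "(\<Sum>m\<in>?R. norm (dft c G m) * freq_weight c m) \<le>
      norm (dft c G 0) + L * sqrt (2 * zeta_three_halves_sum)"
    unfolding R by (subst sum.insert) (auto simp: freq_weight_def)
  also have "\<dots> \<le> dft_const * L"
    using zero by (simp add: dft_const_def ring_distribs)
  finally show ?thesis .
qed

lemma freq_weight_ge_1:
  assumes "m \<in> {0..<int c}"
  shows "freq_weight c m \<ge> 1"
  using circ_dist_ge_1[of m c] assms by (cases "m = 0") (auto simp: freq_weight_def ge_one_powr_ge_zero)

text \<open>
  For \<open>0 < m < c\<close> the gcd divides both \<open>m\<close> and \<open>c - m\<close>, so it is at most the circular distance. When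
  \<open>m = 0\<close> the symmetry of the sum puts \<open>n\<close> in its place.
\<close>

lemma kloosterman_weight_bound:
  assumes "m \<in> {0..<int c}" "n \<in> {0..<int c}" "(m, n) \<noteq> (0, 0)"
  shows "norm (kloosterman c m n) \<le>
           2 * real c powr (3/4) * real (divisor_count c) * (freq_weight c m * freq_weight c n)"
proof -
  have c: "c > 0" using assms by auto
  have *: "norm (kloosterman c m n) \<le>
           2 * real c powr (3/4) * real (divisor_count c) * (freq_weight c m * freq_weight c n)"
    if m: "m \<in> {0..<int c}" and n: "n \<in> {0..<int c}" and "m \<noteq> 0" for m n
  proof -
    have m1: "m \<in> {1..<int c}" using that by auto
    have "gcd m (int c) \<le> m" using m1 by (intro zdvd_imp_le) auto
    moreover have "gcd m (int c) \<le> int c - m"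
      using m1 by (intro zdvd_imp_le) auto
    ultimately have g: "real_of_int (gcd m (int c)) \<le> circ_dist c m" by (simp add: circ_dist_def)
    have "norm (kloosterman c m n) \<le>
        2 * real_of_int (gcd m (int c)) powr (1/4) * real c powr (3/4) * real (divisor_count c)"
      by (rule kloosterman_bound[OF c])
    also have "\<dots> = 2 * real c powr (3/4) * real (divisor_count c) * real_of_int (gcd m (int c)) powr (1/4)"
      by simp
    also have "\<dots> \<le> 2 * real c powr (3/4) * real (divisor_count c) * (freq_weight c m * freq_weight c n)"
    proof (rule mult_left_mono)
      have "real_of_int (gcd m (int c)) powr (1/4) \<le> circ_dist c m powr (1/4) * 1"
        using g by (simp add: powr_mono2)
      also have "\<dots> \<le> freq_weight c m * freq_weight c n"
        using freq_weight_ge_1[OF n] \<open>m \<noteq> 0\<close> by (intro mult_mono) (auto simp: freq_weight_def)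
      finally show "real_of_int (gcd m (int c)) powr (1/4) \<le> freq_weight c m * freq_weight c n" .
    qed auto
    finally show ?thesis .
  qed
  show ?thesis
  proof (cases "m = 0")
    case False
    then show ?thesis using *[of m n] assms by simp
  next
    case True
    then have "n \<noteq> 0" using assms by auto
    then show ?thesis
      using *[of n m] assms kloosterman_commute[of c m n] by (simp add: mult.commute)
  qed
qed

lemma kloosterman_0: "c > 0 \<Longrightarrow> kloosterman c 0 0 = of_nat (totient c)"
  by (simp add: kloosterman_def case_prod_unfold card_inv_pairs)

text \<open>
  In the expansion of \<open>G\<close> and \<open>K\<close> into characters the pair of frequencies \<open>(0, 0)\<close> gives the main
  term, and every other pair has a small Kloosterman sum.
\<close>

theorem inverse_pairs_equidistributed:
  assumes "c > 0"
    and G: "\<And>b. G (b + int c) = G b" "L \<ge> 0"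
      "\<And>b. b \<in> {0..<int c} \<Longrightarrow> norm (G b) \<le> L"
      "\<And>b. b \<in> {0..<int c} \<Longrightarrow> norm (G (b + 1) - G b) \<le> L / c"
    and K: "\<And>b. K (b + int c) = K b" "M \<ge> 0"
      "\<And>b. b \<in> {0..<int c} \<Longrightarrow> norm (K b) \<le> M"
      "\<And>b. b \<in> {0..<int c} \<Longrightarrow> norm (K (b + 1) - K b) \<le> M / c"
  shows "norm ((\<Sum>(a, d)\<in>inv_pairs c. G d * K a) - of_nat (totient c) * dft c G 0 * dft c K 0)
           \<le> 2 * dft_const\<^sup>2 * L * M * (real c powr (3/4) * real (divisor_count c))"
proof -
  let ?R = "{0..<int c}"
  let ?B = "2 * real c powr (3/4) * real (divisor_count c)"
  let ?f = "\<lambda>p. dft c G (fst p) * dft c K (snd p) * kloosterman c (fst p) (snd p)"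
  have "(\<Sum>(a, d)\<in>inv_pairs c. G d * K a) =
     (\<Sum>(a, d)\<in>inv_pairs c. \<Sum>p\<in>?R \<times> ?R. dft c G (fst p) * dft c K (snd p) *
        add_char c (fst p * d + snd p * a))"
  proof (intro sum.cong refl, clarify)
    fix a d assume "(a, d) \<in> inv_pairs c"
    then have ad: "a \<in> ?R" "d \<in> ?R" by (auto dest: inv_pairsD)
    show "G d * K a = (\<Sum>p\<in>?R \<times> ?R. dft c G (fst p) * dft c K (snd p) *
        add_char c (fst p * d + snd p * a))"
      unfolding dft_inversion[OF ad(2), of G] dft_inversion[OF ad(1), of K] sum_product
        sum.cartesian_product
      by (intro sum.cong refl) (simp add: case_prod_unfold add_char_add)
  qed
  also have "\<dots> = (\<Sum>p\<in>?R \<times> ?R. ?f p)"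
    unfolding case_prod_unfold
    by (subst sum.swap) (simp add: kloosterman_def sum_distrib_left case_prod_unfold)
  also have "\<dots> = ?f (0, 0) + (\<Sum>p\<in>?R \<times> ?R - {(0, 0)}. ?f p)"
    using assms(1) by (intro sum.remove) auto
  finally have "norm ((\<Sum>(a, d)\<in>inv_pairs c. G d * K a) - of_nat (totient c) * dft c G 0 * dft c K 0) =
     norm (\<Sum>p\<in>?R \<times> ?R - {(0, 0)}. ?f p)"
    using assms(1) by (simp add: kloosterman_0 mult_ac)
  also have "\<dots> \<le> (\<Sum>p\<in>?R \<times> ?R - {(0, 0)}. ?B *
      ((norm (dft c G (fst p)) * freq_weight c (fst p)) * (norm (dft c K (snd p)) * freq_weight c (snd p))))"
  proof (rule sum_norm_le)
    fix p assume p: "p \<in> ?R \<times> ?R - {(0, 0)}"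
    have "norm (?f p) = norm (dft c G (fst p)) * norm (dft c K (snd p)) * norm (kloosterman c (fst p) (snd p))"
      by (simp add: norm_mult)
    also have "\<dots> \<le> norm (dft c G (fst p)) * norm (dft c K (snd p)) *
        (?B * (freq_weight c (fst p) * freq_weight c (snd p)))"
      by (intro mult_left_mono kloosterman_weight_bound) (use p in auto)
    finally show "norm (?f p) \<le> ?B * ((norm (dft c G (fst p)) * freq_weight c (fst p)) *
        (norm (dft c K (snd p)) * freq_weight c (snd p)))"
      by (simp add: mult_ac)
  qed
  also have "\<dots> \<le> (\<Sum>p\<in>?R \<times> ?R. ?B *
      ((norm (dft c G (fst p)) * freq_weight c (fst p)) * (norm (dft c K (snd p)) * freq_weight c (snd p))))"
    by (rule sum_mono2) (auto simp: freq_weight_def)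
  also have "\<dots> = ?B * ((\<Sum>m\<in>?R. norm (dft c G m) * freq_weight c m) *
      (\<Sum>n\<in>?R. norm (dft c K n) * freq_weight c n))"
  proof -
    have "(\<Sum>m\<in>?R. norm (dft c G m) * freq_weight c m) * (\<Sum>n\<in>?R. norm (dft c K n) * freq_weight c n) =
       (\<Sum>p\<in>?R \<times> ?R. (norm (dft c G (fst p)) * freq_weight c (fst p)) *
          (norm (dft c K (snd p)) * freq_weight c (snd p)))"
      by (simp only: sum_product sum.cartesian_product case_prod_unfold)
    then show ?thesis by (simp only: sum_distrib_left)
  qed
  also have "\<dots> \<le> ?B * ((dft_const * L) * (dft_const * M))"
    using zeta_three_halves_sum_nonneg
    by (intro mult_left_mono mult_mono weighted_dft_bound assms sum_nonneg mult_nonneg_nonneg)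
       (auto simp: dft_const_def freq_weight_def)
  finally show ?thesis by (simp add: power2_eq_square mult_ac)
qed

section \<open>The summand as a multiplicative character\<close>

text \<open>
  For fixed \<open>s\<close> this is a character of the multiplicative group of nonzero complex numbers; it maps \<open>0\<close> to
  \<open>0\<close>. Every factorisation of \<open>mu\<close> below is used through its multiplicativity.
\<close>

definition psi :: "complex \<Rightarrow> complex \<Rightarrow> complex" where
  "psi s v = cnj v / of_real (norm v) powr (2 * s)"

lemma Xi_term_eq_psi:
  "Xi_term z1 z2 s \<gamma> = psi s (mu \<gamma> z1 (- z2)) * psi s (mu \<gamma> z1 (- cnj z2))"
  by (simp add: Xi_term_def psi_def)

lemma psi_mult: "psi s (v * w) = psi s v * psi s w"
  by (simp add: psi_def norm_mult powr_times_real)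

lemma psi_1 [simp]: "psi s 1 = 1"
  by (simp add: psi_def)

lemma psi_at_1: "v \<noteq> 0 \<Longrightarrow> psi 1 v = 1 / v"
proof -
  assume "v \<noteq> 0"
  moreover have "complex_of_real (norm v) powr 2 = v * cnj v"
    using \<open>v \<noteq> 0\<close> by (simp add: powr_numeral complex_norm_square flip: of_real_power)
  ultimately show ?thesis by (simp add: psi_def)
qed

lemma norm_psi: "norm (psi s v) = norm v powr (1 - 2 * Re s)"
  by (cases "v = 0") (auto simp: psi_def norm_divide norm_powr_real_powr powr_diff)

lemma psi_eq_exp:
  assumes "v \<noteq> 0"
  shows "psi s v = cnj v * exp (- (2 * s * of_real (ln (norm v))))"
  using assms by (simp add: psi_def powr_def exp_minus Ln_of_real divide_inverse)

lemma holomorphic_psi: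
  assumes "v \<noteq> 0"
  shows "(\<lambda>s. psi s v) holomorphic_on A"
  unfolding psi_eq_exp[OF assms] by (intro holomorphic_intros)

lemma norm_exp_minus_1_le: "norm (exp (w :: complex) - 1) \<le> norm w * exp (norm w)"
proof -
  have "norm (exp w - 1) \<le> exp (norm w) * norm (w - 0)"
    using field_differentiable_bound[of "cball 0 (norm w)" exp exp "exp (norm w)" 0 w]
    by (auto simp: norm_exp norm_minus_commute[of 1]
             intro!: DERIV_exp[THEN DERIV_subset] order.trans[OF complex_Re_le_cmod])
  then show ?thesis by (simp add: mult.commute)
qed

text \<open>
  The one estimate behind both uses of small perturbations: the Lipschitz continuity of the periodized functions and the
  \<open>1/c^2\<close> correction. The lower bound \<open>k\<close> makes the logarithm of the modulus Lipschitz, and \<open>K\<close> bounds the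
  exponential.
\<close>

lemma psi_lipschitz_at_1:
  assumes "0 < k" "k \<le> 1" "R > 0" "K > 0"
  shows "\<exists>C>0. \<forall>s u. norm s \<le> R \<longrightarrow> k \<le> norm u \<longrightarrow> norm u \<le> K \<longrightarrow>
           norm (psi s u - 1) \<le> C * norm (u - 1)"
proof -
  define W where "W = 2 * R * ((K + 1) / k)"
  define C where "C = 1 + K * (2 * R / k) * exp W"
  have "norm (psi s u - 1) \<le> C * norm (u - 1)"
    if s: "norm s \<le> R" and u: "k \<le> norm u" "norm u \<le> K" for s u
  proof -
    have u0: "norm u > 0" using u assms by linarith
    have "\<bar>ln (norm u)\<bar> \<le> norm (u - 1) / k"
    proof (cases "norm u \<ge> 1")
      case True
      have "ln (norm u) \<le> norm u - 1" using u0 by (rule ln_le_minus_one)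
      also have "\<dots> \<le> norm (u - 1)" using norm_triangle_ineq2[of u 1] by simp
      also have "\<dots> \<le> norm (u - 1) / k"
        using assms by (simp add: field_simps mult_left_le_one_le)
      finally show ?thesis using True by simp
    next
      case False
      have "ln (1 / norm u) \<le> 1 / norm u - 1" using u0 by (intro ln_le_minus_one) simp
      also have "\<dots> = (1 - norm u) / norm u" using u0 by (simp add: field_simps)
      also have "\<dots> \<le> norm (u - 1) / k"
        using norm_triangle_ineq2[of 1 u] u assms False by (intro frac_le) (auto simp: norm_minus_commute)
      finally show ?thesis using False u0 by (simp add: ln_div)
    qed
    define w where "w = - (2 * s * complex_of_real (ln (norm u)))"
    have "norm w = 2 * norm s * \<bar>ln (norm u)\<bar>"
      by (simp add: w_def norm_mult)
    also have "\<dots> \<le> 2 * R * (norm (u - 1) / k)"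
      using s \<open>\<bar>ln (norm u)\<bar> \<le> norm (u - 1) / k\<close> assms by (intro mult_mono) auto
    finally have w: "norm w \<le> 2 * R * (norm (u - 1) / k)" .
    also have "\<dots> \<le> W"
      unfolding W_def using norm_triangle_ineq4[of u 1] u assms
      by (intro mult_left_mono divide_right_mono) auto
    finally have wW: "norm w \<le> W" .
    have "norm (exp w - 1) \<le> norm w * exp (norm w)" by (rule norm_exp_minus_1_le)
    also have "\<dots> \<le> (2 * R * (norm (u - 1) / k)) * exp W"
      using w wW assms by (intro mult_mono) auto
    finally have e: "norm (exp w - 1) \<le> (2 * R * (norm (u - 1) / k)) * exp W" .
    have "psi s u - 1 = cnj (u - 1) + cnj u * (exp w - 1)"
      using u0 by (simp add: psi_eq_exp w_def algebra_simps)
    then have "norm (psi s u - 1) \<le> norm (u - 1) + norm u * norm (exp w - 1)"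
      by (metis complex_mod_cnj norm_mult norm_triangle_ineq)
    also have "\<dots> \<le> norm (u - 1) + K * ((2 * R * (norm (u - 1) / k)) * exp W)"
      using u assms e by (intro add_left_mono mult_mono) auto
    also have "\<dots> = C * norm (u - 1)"
      by (simp add: C_def algebra_simps)
    finally show ?thesis .
  qed
  moreover have "C > 0" using assms by (auto simp: C_def intro!: add_pos_nonneg)
  ultimately show ?thesis by blast
qed

text \<open>
  The half-plane \<open>Re s > 31/32\<close> cut down to a disc, so that constants can be chosen uniformly in \<open>s\<close>.
\<close>

definition cap :: "real \<Rightarrow> complex set" where
  "cap R = {s. Re s > 31/32 \<and> norm s < R}"

lemma open_cap: "open (cap R)"
  unfolding cap_def by (intro open_Collect_conj open_Collect_less continuous_intros)

lemma capD:
  assumes "s \<in> cap R"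
  shows "Re s > 31/32" "norm s < R" "Re s < R"
  using assms complex_Re_le_cmod[of s] by (auto simp: cap_def)

text \<open>
  Here \<open>t\<close> measures the lattice parameter and \<open>k\<close> the distance of the base point from the real axis; the
  factor in \<open>k\<close> absorbs the dependence on \<open>s\<close>.
\<close>

lemma norm_psi_le:
  assumes "s \<in> cap R" "0 < k" "k \<le> 1" "1 \<le> t" "k * t \<le> norm v"
  shows "norm (psi s v) \<le> k powr (1 - 2 * R) * t powr (- (15/16))"
proof -
  note s = capD[OF assms(1)]
  have "norm (psi s v) \<le> (k * t) powr (1 - 2 * Re s)"
    unfolding norm_psi using assms s by (intro powr_mono2') auto
  also have "\<dots> = k powr (1 - 2 * Re s) * t powr (1 - 2 * Re s)"
    using assms by (simp add: powr_mult)
  also have "\<dots> \<le> k powr (1 - 2 * R) * t powr (- (15/16))"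
    using assms s by (intro mult_mono powr_mono powr_mono') auto
  finally show ?thesis .
qed

text \<open>
  The decay of a product of two values of \<open>psi\<close> along a translation orbit.
\<close>

definition int_weight :: "int \<Rightarrow> real" where
  "int_weight n = (1 + \<bar>of_int n\<bar>) powr (- (15/8))"

lemma int_weight_nonneg [simp]: "int_weight n \<ge> 0"
  by (simp add: int_weight_def)

lemma int_weight_summable: "int_weight summable_on UNIV"
proof -
  have nat: "(\<lambda>n. (1 + real n) powr (- (15/8))) summable_on UNIV"
  proof -
    have "(\<lambda>n. real n powr (- (15/8))) summable_on range Suc"
      by (rule summable_on_subset_banach[OF summable_on_nat_powr]) auto
    then show ?thesis
      by (subst (asm) summable_on_reindex) (auto simp: o_def add.commute)
  qed
  have 1: "int_weight summable_on range int"
    by (subst summable_on_reindex) (use nat in \<open>auto simp: o_def int_weight_def\<close>)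
  have 2: "int_weight summable_on range (\<lambda>n. - int n)"
    by (subst summable_on_reindex) (use nat in \<open>auto simp: o_def int_weight_def inj_on_def\<close>)
  have "int_weight summable_on (range int \<union> range (\<lambda>n. - int n))"
    by (rule summable_on_union[OF 1 2])
  moreover have "range int \<union> range (\<lambda>n. - int n) = UNIV"
    by (metis (no_types, lifting) UNIV_eq_I UnCI int_cases2 rangeI)
  ultimately show ?thesis by simp
qed

text \<open>
  For \<open>|n| \<ge> 2 (1 + |z|)\<close> the integer dominates; for smaller \<open>n\<close> the assumed lower bound \<open>\<delta>\<close> is
  already of the right size.
\<close>

lemma norm_translate_ge:
  fixes z :: complex
  assumes "\<delta> > 0" "0 \<le> x" "x \<le> 1" "norm (of_real x + of_int n + z) \<ge> \<delta>"
  shows "norm (of_real x + of_int n + z) \<ge> min (1/4) (\<delta> / (3 + 2 * norm z)) * (1 + \<bar>of_int n\<bar>)"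
proof (cases "\<bar>real_of_int n\<bar> \<ge> 2 * (1 + norm z)")
  case True
  have "\<bar>real_of_int n\<bar> = norm ((of_real x + of_int n + z) - of_real x - z)"
    by (simp add: norm_of_int)
  also have "\<dots> \<le> norm (of_real x + of_int n + z) + norm (complex_of_real x) + norm z"
    by (metis norm_triangle_ineq4 add_right_mono order_trans)
  finally have "norm (of_real x + of_int n + z) \<ge> \<bar>real_of_int n\<bar> - 1 - norm z"
    using assms by simp
  moreover have "min (1/4) (\<delta> / (3 + 2 * norm z)) * (1 + \<bar>of_int n\<bar>) \<le> 1/4 * (1 + \<bar>real_of_int n\<bar>)"
    by (intro mult_right_mono min.cobounded1) auto
  moreover have "1/4 * (1 + \<bar>real_of_int n\<bar>) \<le> \<bar>real_of_int n\<bar> - 1 - norm z"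
    using True norm_ge_zero[of z] by argo
  ultimately show ?thesis by (meson order_trans)
next
  case False
  have "min (1/4) (\<delta> / (3 + 2 * norm z)) * (1 + \<bar>of_int n\<bar>) \<le>
        \<delta> / (3 + 2 * norm z) * (1 + 2 * (1 + norm z))"
    using False assms(1) norm_ge_zero[of z] by (intro mult_mono) auto
  also have "\<dots> = \<delta>"
  proof -
    have "3 + 2 * norm z \<noteq> 0" using norm_ge_zero[of z] by linarith
    moreover have "1 + 2 * (1 + norm z) = 3 + 2 * norm z" by (simp add: ring_distribs)
    ultimately show ?thesis by simp
  qed
  finally show ?thesis using assms(4) by linarith
qed

lemma holomorphic_on_if_locally:
  assumes "\<And>x. x \<in> S \<Longrightarrow> \<exists>T. open T \<and> x \<in> T \<and> f holomorphic_on T"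
  shows "f holomorphic_on S"
proof (rule holomorphic_onI)
  fix x assume "x \<in> S"
  then obtain T where "open T" "x \<in> T" "f holomorphic_on T" using assms by blast
  then have "f field_differentiable (at x)" using holomorphic_on_imp_differentiable_at by blast
  then show "f field_differentiable (at x within S)" by (rule field_differentiable_at_within)
qed

lemma holomorphic_infsum:
  fixes f :: "complex \<Rightarrow> 'a \<Rightarrow> complex"
  assumes "open S" and hol: "\<And>i. i \<in> I \<Longrightarrow> (\<lambda>s. f s i) holomorphic_on S"
    and bound: "\<And>s i. s \<in> S \<Longrightarrow> i \<in> I \<Longrightarrow> norm (f s i) \<le> M i" and M: "M summable_on I"
  shows "(\<lambda>s. \<Sum>\<^sub>\<infinity>i\<in>I. f s i) holomorphic_on S"
proof (rule holomorphic_on_if_locally)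
  fix x assume "x \<in> S"
  then obtain r where r: "r > 0" "cball x r \<subseteq> S" using assms(1) open_contains_cball by blast
  have ul: "uniform_limit (cball x r) (\<lambda>J s. \<Sum>i\<in>J. f s i) (\<lambda>s. \<Sum>\<^sub>\<infinity>i\<in>I. f s i) (finite_subsets_at_top I)"
    by (rule Weierstrass_m_test_general[OF _ M]) (use bound r in blast)
  have ev: "\<forall>\<^sub>F J in finite_subsets_at_top I. continuous_on (cball x r) (\<lambda>s. \<Sum>i\<in>J. f s i) \<and>
      (\<lambda>s. \<Sum>i\<in>J. f s i) holomorphic_on ball x r"
  proof (rule eventually_finite_subsets_at_top_weakI)
    fix J assume "finite J" "J \<subseteq> I"
    then have "(\<lambda>s. \<Sum>i\<in>J. f s i) holomorphic_on S"
      by (intro holomorphic_on_sum hol) auto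
    then show "continuous_on (cball x r) (\<lambda>s. \<Sum>i\<in>J. f s i) \<and> (\<lambda>s. \<Sum>i\<in>J. f s i) holomorphic_on ball x r"
      using r ball_subset_cball[of x r] holomorphic_on_subset holomorphic_on_imp_continuous_on
        continuous_on_subset by (metis subset_trans)
  qed
  from holomorphic_uniform_limit[OF ev ul finite_subsets_at_top_neq_bot]
  have "(\<lambda>s. \<Sum>\<^sub>\<infinity>i\<in>I. f s i) holomorphic_on ball x r" by blast
  then show "\<exists>T. open T \<and> x \<in> T \<and> (\<lambda>s. \<Sum>\<^sub>\<infinity>i\<in>I. f s i) holomorphic_on T"
    using r by (intro exI[of _ "ball x r"]) auto
qed

section \<open>Periodized summands\<close>

text \<open>
  The parameters are \<open>z = w = z1\<close> for the function of \<open>d/c\<close>, and \<open>z = -z2\<close>, \<open>w = -cnj z2\<close> for the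
  function of \<open>a/c\<close>.
\<close>

definition lattice_term :: "complex \<Rightarrow> complex \<Rightarrow> complex \<Rightarrow> real \<Rightarrow> int \<Rightarrow> complex" where
  "lattice_term s z w x n = psi s (of_real x + of_int n + z) * psi s (of_real x + of_int n + w)"

definition periodization :: "complex \<Rightarrow> complex \<Rightarrow> complex \<Rightarrow> real \<Rightarrow> complex" where
  "periodization s z w x = (\<Sum>\<^sub>\<infinity>n. lattice_term s z w x n)"

lemma nonreal_translate_bound:
  assumes "Im z \<noteq> 0"
  shows "\<exists>k. 0 < k \<and> k \<le> 1 \<and> (\<forall>x n. 0 \<le> x \<longrightarrow> x \<le> 1 \<longrightarrow>
           k * (1 + \<bar>of_int n\<bar>) \<le> norm (of_real x + of_int n + z))"
proof (intro exI conjI allI impI)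
  let ?k = "min (1/4) (\<bar>Im z\<bar> / (3 + 2 * norm z))"
  show "0 < ?k" using assms by (simp add: add_pos_nonneg)
  show "?k \<le> 1" by linarith
  fix x n assume x: "0 \<le> x" "(x::real) \<le> 1"
  have "\<bar>Im z\<bar> \<le> norm (of_real x + of_int n + z)"
    using abs_Im_le_cmod[of "of_real x + of_int n + z"] by simp
  then show "?k * (1 + \<bar>of_int n\<bar>) \<le> norm (of_real x + of_int n + z)"
    using assms x by (intro norm_translate_ge) auto
qed

lemma int_weight_eq: "int_weight n = (1 + \<bar>of_int n\<bar>) powr (- (15/16)) * (1 + \<bar>of_int n\<bar>) powr (- (15/16))"
  by (simp add: int_weight_def flip: powr_add)

lemma lattice_term_bound:
  assumes "Im z \<noteq> 0" "Im w \<noteq> 0"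
  shows "\<exists>C>0. \<forall>s\<in>cap R. \<forall>x\<in>{0..1}. \<forall>n. norm (lattice_term s z w x n) \<le> C * int_weight n"
proof -
  from nonreal_translate_bound[OF assms(1)] obtain k where k: "0 < k" "k \<le> 1"
    "\<And>x n. 0 \<le> x \<Longrightarrow> x \<le> 1 \<Longrightarrow> k * (1 + \<bar>of_int n\<bar>) \<le> norm (of_real x + of_int n + z)" by blast
  from nonreal_translate_bound[OF assms(2)] obtain l where l: "0 < l" "l \<le> 1"
    "\<And>x n. 0 \<le> x \<Longrightarrow> x \<le> 1 \<Longrightarrow> l * (1 + \<bar>of_int n\<bar>) \<le> norm (of_real x + of_int n + w)" by blast
  define C where "C = k powr (1 - 2 * R) * l powr (1 - 2 * R)"
  have "norm (lattice_term s z w x n) \<le> C * int_weight n"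
    if s: "s \<in> cap R" and x: "x \<in> {0..1}" for s x n
  proof -
    let ?t = "1 + \<bar>real_of_int n\<bar>"
    have "norm (lattice_term s z w x n) \<le>
       (k powr (1 - 2 * R) * ?t powr (- (15/16))) * (l powr (1 - 2 * R) * ?t powr (- (15/16)))"
      unfolding lattice_term_def norm_mult
      by (intro mult_mono norm_psi_le[OF s]) (use k l x in auto)
    then show ?thesis by (simp add: C_def int_weight_eq mult_ac)
  qed
  moreover have "C > 0" using k l by (simp add: C_def)
  ultimately show ?thesis by blast
qed

lemma norm_mult_minus_1_le: "norm (a * b - 1 :: complex) \<le> norm (a - 1) * (1 + norm (b - 1)) + norm (b - 1)"
proof -
  have "a * b - 1 = (a - 1) * (1 + (b - 1)) + (b - 1)" by (simp add: algebra_simps)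
  then have "norm (a * b - 1) \<le> norm (a - 1) * norm (1 + (b - 1)) + norm (b - 1)"
    by (metis norm_mult norm_triangle_ineq)
  also have "\<dots> \<le> norm (a - 1) * (1 + norm (b - 1)) + norm (b - 1)"
    using norm_triangle_ineq[of 1 "b - 1"] by (intro add_right_mono mult_left_mono) auto
  finally show ?thesis .
qed

text \<open>
  The imaginary part of \<open>z\<close> bounds the translates away from \<open>0\<close>, so nearby translates have quotients near
  \<open>1\<close>; exchanging them gives the lower bound.
\<close>

lemma translate_quotient_bounds:
  assumes "Im z \<noteq> 0" "v = of_real x + of_int n + z" "v' = of_real y + of_int n + z" "x \<in> {0..1}" "y \<in> {0..1}"
  defines "K \<equiv> 1 + 1 / \<bar>Im z\<bar>"
  shows "norm (v' / v - 1) \<le> \<bar>y - x\<bar> / \<bar>Im z\<bar>" "norm (v' / v) \<le> K" "1 / K \<le> norm (v' / v)" "v \<noteq> 0"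
proof -
  have *: "norm (v' / v - 1) \<le> \<bar>y - x\<bar> / \<bar>Im z\<bar> \<and> norm (v' / v) \<le> K \<and> v \<noteq> 0"
    if v: "v = of_real x + of_int n + z" "v' = of_real y + of_int n + z" and xy: "x \<in> {0..1}" "y \<in> {0..1}" for v v' x y
  proof -
    have "\<bar>Im z\<bar> \<le> norm v" using abs_Im_le_cmod[of v] by (simp add: v)
    moreover have pos: "\<bar>Im z\<bar> > 0" using assms by simp
    ultimately have vpos: "norm v > 0" "v \<noteq> 0" by auto
    have "v' / v - 1 = of_real (y - x) / v" using vpos by (simp add: v field_simps)
    then have "norm (v' / v - 1) = \<bar>y - x\<bar> / norm v" by (simp add: norm_divide del: of_real_diff)
    also have "\<dots> \<le> \<bar>y - x\<bar> / \<bar>Im z\<bar>"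
      using \<open>\<bar>Im z\<bar> \<le> norm v\<close> pos vpos by (intro divide_left_mono mult_pos_pos) auto
    finally have 1: "norm (v' / v - 1) \<le> \<bar>y - x\<bar> / \<bar>Im z\<bar>" .
    have "norm (v' / v) \<le> 1 + norm (v' / v - 1)"
      using norm_triangle_ineq[of 1 "v' / v - 1"] by simp
    also have "norm (v' / v - 1) \<le> 1 / \<bar>Im z\<bar>"
      using 1 by (rule order.trans) (use xy pos in \<open>auto intro!: divide_right_mono\<close>)
    finally show ?thesis using 1 vpos by (simp add: K_def)
  qed
  show "norm (v' / v - 1) \<le> \<bar>y - x\<bar> / \<bar>Im z\<bar>" "norm (v' / v) \<le> K" "v \<noteq> 0"
    using *[OF assms(2-5)] by auto
  have "norm (v / v') \<le> K" "v' \<noteq> 0" using *[OF assms(3,2,5,4)] by auto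
  moreover have "K > 0" by (simp add: K_def add_pos_nonneg)
  ultimately show "1 / K \<le> norm (v' / v)"
    using \<open>v \<noteq> 0\<close> by (simp add: norm_divide field_simps)
qed

text \<open>
  Multiplicativity turns the difference of two values into the value at a quotient near \<open>1\<close>. This avoids
  differentiating in the real variable.
\<close>

lemma psi_translate_lipschitz:
  assumes "Im z \<noteq> 0" "R > 0"
  shows "\<exists>C>0. \<forall>s\<in>cap R. \<forall>x\<in>{0..1}. \<forall>y\<in>{0..1}. \<forall>n. \<exists>u.
     psi s (of_real y + of_int n + z) = psi s (of_real x + of_int n + z) * u \<and> norm (u - 1) \<le> C * \<bar>y - x\<bar>"
proof -
  define K where "K = 1 + 1 / \<bar>Im z\<bar>"
  have K: "K \<ge> 1" by (simp add: K_def)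
  obtain C where C: "C > 0" "\<And>s u. norm s \<le> R \<Longrightarrow> 1 / K \<le> norm u \<Longrightarrow> norm u \<le> K \<Longrightarrow>
           norm (psi s u - 1) \<le> C * norm (u - 1)"
    using psi_lipschitz_at_1[of "1 / K" R K] assms(2) K by auto
  show ?thesis
  proof (intro exI[of _ "C / \<bar>Im z\<bar>"] conjI ballI allI)
    show "C / \<bar>Im z\<bar> > 0" using C assms by simp
    fix s x y n assume s: "s \<in> cap R" and xy: "(x::real) \<in> {0..1}" "(y::real) \<in> {0..1}"
    define v v' where "v = complex_of_real x + of_int n + z" and "v' = complex_of_real y + of_int n + z"
    note b = translate_quotient_bounds[OF assms(1) v_def v'_def xy, folded K_def]
    have "psi s v' = psi s v * psi s (v' / v)"
      using b(4) by (simp flip: psi_mult)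
    moreover have "norm (psi s (v' / v) - 1) \<le> C * norm (v' / v - 1)"
      by (rule C(2)) (use b capD(2)[OF s] in auto)
    moreover have "C * norm (v' / v - 1) \<le> C * (\<bar>y - x\<bar> / \<bar>Im z\<bar>)"
      using b(1) C(1) by (intro mult_left_mono) auto
    ultimately show "\<exists>u. psi s (of_real y + of_int n + z) = psi s (of_real x + of_int n + z) * u \<and>
        norm (u - 1) \<le> C / \<bar>Im z\<bar> * \<bar>y - x\<bar>"
      unfolding v_def[symmetric] v'_def[symmetric] by (intro exI[of _ "psi s (v' / v)"]) auto
  qed
qed

lemma lattice_term_lipschitz:
  assumes "Im z \<noteq> 0" "Im w \<noteq> 0" "R > 0"
  shows "\<exists>C>0. \<forall>s\<in>cap R. \<forall>x\<in>{0..1}. \<forall>y\<in>{0..1}. \<forall>n.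
     norm (lattice_term s z w y n - lattice_term s z w x n) \<le> C * \<bar>y - x\<bar> * int_weight n"
proof -
  obtain A where A: "A > 0" "\<And>s x n. s \<in> cap R \<Longrightarrow> x \<in> {0..1} \<Longrightarrow> norm (lattice_term s z w x n) \<le> A * int_weight n"
    using lattice_term_bound[OF assms(1,2), of R] by auto
  obtain B where B: "B > 0" "\<And>s x y n. s \<in> cap R \<Longrightarrow> x \<in> {0..1} \<Longrightarrow> y \<in> {0..1} \<Longrightarrow> \<exists>u.
     psi s (of_real y + of_int n + z) = psi s (of_real x + of_int n + z) * u \<and> norm (u - 1) \<le> B * \<bar>y - x\<bar>"
    using psi_translate_lipschitz[OF assms(1,3)] by metis
  obtain D where D: "D > 0" "\<And>s x y n. s \<in> cap R \<Longrightarrow> x \<in> {0..1} \<Longrightarrow> y \<in> {0..1} \<Longrightarrow> \<exists>u.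
     psi s (of_real y + of_int n + w) = psi s (of_real x + of_int n + w) * u \<and> norm (u - 1) \<le> D * \<bar>y - x\<bar>"
    using psi_translate_lipschitz[OF assms(2,3)] by metis
  show ?thesis
  proof (intro exI[of _ "A * (B * (1 + D) + D)"] conjI ballI allI)
    show "A * (B * (1 + D) + D) > 0" using A B D by (simp add: add_pos_pos)
    fix s x y n assume s: "s \<in> cap R" and xy: "(x::real) \<in> {0..1}" "(y::real) \<in> {0..1}"
    obtain u where u: "psi s (of_real y + of_int n + z) = psi s (of_real x + of_int n + z) * u" "norm (u - 1) \<le> B * \<bar>y - x\<bar>"
      using B(2)[OF s xy] by blast
    obtain v where v: "psi s (of_real y + of_int n + w) = psi s (of_real x + of_int n + w) * v" "norm (v - 1) \<le> D * \<bar>y - x\<bar>"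
      using D(2)[OF s xy] by blast
    have "norm (u * v - 1) \<le> norm (u - 1) * (1 + norm (v - 1)) + norm (v - 1)"
      by (rule norm_mult_minus_1_le)
    also have "\<dots> \<le> (B * \<bar>y - x\<bar>) * (1 + D) + D * \<bar>y - x\<bar>"
    proof (intro add_mono mult_mono u v)
      have "D * \<bar>y - x\<bar> \<le> D * 1" using D xy by (intro mult_left_mono) auto
      then show "norm (v - 1) \<le> D" using v by linarith
    qed (use B in auto)
    also have "\<dots> = (B * (1 + D) + D) * \<bar>y - x\<bar>" by (simp add: algebra_simps)
    finally have uv: "norm (u * v - 1) \<le> (B * (1 + D) + D) * \<bar>y - x\<bar>" .
    have "lattice_term s z w y n - lattice_term s z w x n = lattice_term s z w x n * (u * v - 1)"
      unfolding lattice_term_def u(1) v(1) by (simp add: algebra_simps)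
    then have "norm (lattice_term s z w y n - lattice_term s z w x n) = norm (lattice_term s z w x n) * norm (u * v - 1)"
      by (simp add: norm_mult)
    also have "\<dots> \<le> (A * int_weight n) * ((B * (1 + D) + D) * \<bar>y - x\<bar>)"
      by (intro mult_mono A uv s xy mult_nonneg_nonneg) (use A(1) in auto)
    finally show "norm (lattice_term s z w y n - lattice_term s z w x n) \<le> A * (B * (1 + D) + D) * \<bar>y - x\<bar> * int_weight n"
      by (simp add: mult_ac)
  qed
qed

lemma lattice_term_holomorphic:
  assumes "Im z \<noteq> 0" "Im w \<noteq> 0"
  shows "(\<lambda>s. lattice_term s z w x n) holomorphic_on A"
proof -
  have "of_real x + of_int n + z \<noteq> 0" "of_real x + of_int n + w \<noteq> 0"
    using assms by (auto simp: complex_eq_iff)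
  then show ?thesis
    unfolding lattice_term_def by (intro holomorphic_on_mult holomorphic_psi)
qed

lemma summable_on_bound:
  fixes f :: "'a \<Rightarrow> 'b :: banach"
  assumes "M summable_on I" "\<And>i. i \<in> I \<Longrightarrow> norm (f i) \<le> M i"
  shows "f summable_on I" "norm (infsum f I) \<le> infsum M I"
proof -
  have a: "(\<lambda>i. norm (f i)) summable_on I"
    by (rule Infinite_Sum.abs_summable_on_comparison_test') (use assms in auto)
  then show "f summable_on I" by (rule abs_summable_summable)
  have "norm (infsum f I) \<le> infsum (\<lambda>i. norm (f i)) I" by (rule norm_infsum_bound[OF a])
  also have "\<dots> \<le> infsum M I" by (rule infsum_mono[OF a assms(1)]) (use assms(2) in auto)
  finally show "norm (infsum f I) \<le> infsum M I" .
qed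

lemma summable_lattice_term:
  assumes "Im z \<noteq> 0" "Im w \<noteq> 0" "s \<in> cap R" "x \<in> {0..1}"
  shows "lattice_term s z w x summable_on UNIV"
proof -
  obtain C where C: "C > 0" "\<And>s x n. s \<in> cap R \<Longrightarrow> x \<in> {0..1} \<Longrightarrow> norm (lattice_term s z w x n) \<le> C * int_weight n"
    using lattice_term_bound[OF assms(1,2), of R] by auto
  show ?thesis
    by (rule summable_on_bound(1)[OF summable_on_cmult_right[OF int_weight_summable, of C]])
       (use C assms in auto)
qed

lemma periodization_bounds:
  assumes "Im z \<noteq> 0" "Im w \<noteq> 0" "R > 0"
  shows "\<exists>C>0. \<forall>s\<in>cap R. \<forall>x\<in>{0..1}. norm (periodization s z w x) \<le> C \<and>
          (\<forall>y\<in>{0..1}. norm (periodization s z w y - periodization s z w x) \<le> C * \<bar>y - x\<bar>)"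
proof -
  obtain A where A: "A > 0" "\<And>s x n. s \<in> cap R \<Longrightarrow> x \<in> {0..1} \<Longrightarrow> norm (lattice_term s z w x n) \<le> A * int_weight n"
    using lattice_term_bound[OF assms(1,2), of R] by auto
  obtain B where B: "B > 0" "\<And>s x y n. s \<in> cap R \<Longrightarrow> x \<in> {0..1} \<Longrightarrow> y \<in> {0..1} \<Longrightarrow>
     norm (lattice_term s z w y n - lattice_term s z w x n) \<le> B * \<bar>y - x\<bar> * int_weight n"
    using lattice_term_lipschitz[OF assms] by metis
  define S where "S = (\<Sum>\<^sub>\<infinity>n. int_weight n)"
  have S: "S \<ge> 0" by (simp add: S_def infsum_nonneg)
  define C where "C = (A + B) * (S + 1)"
  have AC: "A * S \<le> C" "B * S \<le> C"
    unfolding C_def using A B S by (intro mult_mono; simp)+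
  have 1: "norm (periodization s z w x) \<le> C" if "s \<in> cap R" "x \<in> {0..1}" for s x
  proof -
    have "norm (periodization s z w x) \<le> (\<Sum>\<^sub>\<infinity>n. A * int_weight n)"
      unfolding periodization_def
      by (rule summable_on_bound(2)[OF summable_on_cmult_right[OF int_weight_summable]]) (use A that in auto)
    also have "\<dots> = A * S" by (simp add: S_def infsum_cmult_right')
    finally show ?thesis using AC by linarith
  qed
  have 2: "norm (periodization s z w y - periodization s z w x) \<le> C * \<bar>y - x\<bar>"
    if "s \<in> cap R" "x \<in> {0..1}" "y \<in> {0..1}" for s x y
  proof -
    have "periodization s z w y - periodization s z w x = (\<Sum>\<^sub>\<infinity>n. lattice_term s z w y n - lattice_term s z w x n)"
    proof -
      have "lattice_term s z w x summable_on UNIV" "lattice_term s z w y summable_on UNIV"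
        by (rule summable_lattice_term; use assms that in blast)+
      then show ?thesis
        unfolding periodization_def diff_conv_add_uminus
        by (subst infsum_add) (auto simp: summable_on_uminus infsum_uminus)
    qed
    also have "norm \<dots> \<le> (\<Sum>\<^sub>\<infinity>n. (B * \<bar>y - x\<bar>) * int_weight n)"
      by (rule summable_on_bound(2)[OF summable_on_cmult_right[OF int_weight_summable]]) (use B that in auto)
    also have "\<dots> = (B * S) * \<bar>y - x\<bar>"
      unfolding infsum_cmult_right' S_def by (simp add: mult_ac)
    also have "\<dots> \<le> C * \<bar>y - x\<bar>" using AC by (intro mult_right_mono) auto
    finally show ?thesis .
  qed
  have "C > 0" using A B S by (simp add: C_def add_pos_nonneg)
  then show ?thesis using 1 2 by blast
qed

lemma periodization_periodic: "periodization s z w (x + of_int m) = periodization s z w x"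
proof -
  have "bij (\<lambda>n::int. n + m)" by (rule bij_betw_byWitness[of _ "\<lambda>n. n - m"]) auto
  then have "(\<Sum>\<^sub>\<infinity>n. lattice_term s z w x (n + m)) = (\<Sum>\<^sub>\<infinity>n. lattice_term s z w x n)"
    by (rule infsum_reindex_bij_betw)
  moreover have "lattice_term s z w x (n + m) = lattice_term s z w (x + of_int m) n" for n
    by (simp add: lattice_term_def add_ac)
  ultimately show ?thesis by (simp add: periodization_def)
qed

lemma periodization_holomorphic:
  assumes "Im z \<noteq> 0" "Im w \<noteq> 0" "x \<in> {0..1}"
  shows "(\<lambda>s. periodization s z w x) holomorphic_on cap R"
proof -
  obtain C where C: "C > 0" "\<And>s x n. s \<in> cap R \<Longrightarrow> x \<in> {0..1} \<Longrightarrow> norm (lattice_term s z w x n) \<le> C * int_weight n"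
    using lattice_term_bound[OF assms(1,2), of R] by auto
  show ?thesis
    unfolding periodization_def
    by (rule holomorphic_infsum[OF open_cap lattice_term_holomorphic _ summable_on_cmult_right[OF int_weight_summable, of C]])
       (use C assms in auto)
qed

section \<open>Circle means as limits of Riemann sums\<close>

definition riemann_avg :: "(real \<Rightarrow> complex) \<Rightarrow> nat \<Rightarrow> complex" where
  "riemann_avg f c = (\<Sum>b<c. f (real b / real c)) / of_nat c"

definition circle_mean :: "(real \<Rightarrow> complex) \<Rightarrow> complex" where
  "circle_mean f = lim (\<lambda>n. riemann_avg f (Suc n))"

text \<open>
  Comparing a Riemann sum with its refinements shows convergence without reference to an integral, and with a rate that is
  uniform in any parameter on which the Lipschitz constant does not depend. Uniformity is what makes the means
  holomorphic.
\<close>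

lemma riemann_avg_refine:
  assumes lip: "\<And>x y. x \<in> {0..1} \<Longrightarrow> y \<in> {0..1} \<Longrightarrow> norm (f y - f x) \<le> C * \<bar>y - x\<bar>"
    and "c > 0" "k > 0" "C \<ge> 0"
  shows "norm (riemann_avg f c - riemann_avg f (c * k)) \<le> C / c"
proof -
  have "(\<Sum>j<c * k. f (real j / real (c * k))) =
        (\<Sum>b<c. \<Sum>i<k. f (real (b * k + i) / real (c * k)))"
    using sum.nat_group[of "\<lambda>j. f (real j / real (c * k))" k c]
    by (simp add: sum.shift_bounds_nat_ivl atLeast0LessThan[symmetric]
      sum.atLeastLessThan_shift_0[of _ "_ * k"] add.commute mult.commute)
  then have eq: "riemann_avg f c - riemann_avg f (c * k) =
     (\<Sum>b<c. \<Sum>i<k. f (real b / real c) - f (real (b * k + i) / real (c * k))) / of_nat (c * k)"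
    using assms by (simp add: riemann_avg_def sum_subtractf diff_divide_distrib sum_distrib_left[symmetric])
  have "norm (\<Sum>b<c. \<Sum>i<k. f (real b / real c) - f (real (b * k + i) / real (c * k))) \<le> (\<Sum>b<c. \<Sum>i<k. C / c)"
  proof (intro sum_norm_le)
    fix b i assume b: "b \<in> {..<c}" and i: "i \<in> {..<k}"
    have "b * k + i < c * k"
    proof -
      have "b * k + i < (b + 1) * k" using i by simp
      also have "\<dots> \<le> c * k" using b by (intro mult_right_mono) auto
      finally show ?thesis .
    qed
    then have "real (b * k + i) / real (c * k) \<le> 1"
      unfolding divide_le_eq_1 using assms(2,3) by (simp del: of_nat_mult of_nat_add)
    then have in01: "real (b * k + i) / real (c * k) \<in> {0..1}" "real b / real c \<in> {0..1}"
      using b by simp_all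
    have "real b / real c - real (b * k + i) / real (c * k) = - (real i / real k) / real c"
      using assms by (simp add: field_simps)
    then have "\<bar>real b / real c - real (b * k + i) / real (c * k)\<bar> = (real i / real k) / real c" by simp
    also have "\<dots> \<le> 1 / real c" using i by (intro divide_right_mono) auto
    finally have d: "\<bar>real b / real c - real (b * k + i) / real (c * k)\<bar> \<le> 1 / real c" .
    have "norm (f (real b / real c) - f (real (b * k + i) / real (c * k))) \<le>
        C * \<bar>real b / real c - real (b * k + i) / real (c * k)\<bar>"
      by (intro lip in01)
    also have "\<dots> \<le> C * (1 / real c)" using d assms by (intro mult_left_mono) auto
    finally show "norm (f (real b / real c) - f (real (b * k + i) / real (c * k))) \<le> C / c" by simp
  qed
  also have "\<dots> = C * k" using assms by simp
  finally have "norm (riemann_avg f c - riemann_avg f (c * k)) \<le> (C * k) / real (c * k)"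
    unfolding eq norm_divide by (simp add: norm_mult divide_right_mono del: of_nat_mult)
  then show ?thesis using assms by simp
qed

lemma riemann_avg_close_to_mean:
  assumes lip: "\<And>x y. x \<in> {0..1} \<Longrightarrow> y \<in> {0..1} \<Longrightarrow> norm (f y - f x) \<le> C * \<bar>y - x\<bar>"
    and "c > 0" "C \<ge> 0"
  shows "norm (riemann_avg f c - circle_mean f) \<le> C / c"
proof -
  have close: "norm (riemann_avg f a - riemann_avg f b) \<le> C / a + C / b" if "a > 0" "b > 0" for a b
  proof -
    have "norm (riemann_avg f a - riemann_avg f (a * b)) \<le> C / a"
      "norm (riemann_avg f b - riemann_avg f (a * b)) \<le> C / b"
      using riemann_avg_refine[of f C, OF lip that(1,2) assms(3)]
        riemann_avg_refine[of f C, OF lip that(2,1) assms(3)] by (simp_all add: mult.commute)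
    then show ?thesis
      using norm_triangle_ineq4[of "riemann_avg f a - riemann_avg f (a * b)" "riemann_avg f b - riemann_avg f (a * b)"]
      by simp
  qed
  have lim0: "(\<lambda>n. C / real (Suc n)) \<longlonglongrightarrow> 0" by real_asymp
  have "Cauchy (\<lambda>n. riemann_avg f (Suc n))"
  proof (rule CauchyI)
    fix e :: real assume "e > 0"
    then have "\<forall>\<^sub>F n in sequentially. C / real (Suc n) < e / 2"
      using order_tendstoD(2)[OF lim0, of "e / 2"] by simp
    then obtain M where M: "\<And>n. n \<ge> M \<Longrightarrow> C / real (Suc n) < e / 2"
      by (auto simp: eventually_sequentially)
    show "\<exists>M. \<forall>m\<ge>M. \<forall>n\<ge>M. norm (riemann_avg f (Suc m) - riemann_avg f (Suc n)) < e"
    proof (intro exI[of _ M] allI impI)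
      fix m n assume "m \<ge> M" "n \<ge> M"
      then show "norm (riemann_avg f (Suc m) - riemann_avg f (Suc n)) < e"
        using M[of m] M[of n] close[of "Suc m" "Suc n"] by linarith
    qed
  qed
  then have "convergent (\<lambda>n. riemann_avg f (Suc n))" by (rule Cauchy_convergent)
  then have "(\<lambda>n. riemann_avg f (Suc n)) \<longlonglongrightarrow> circle_mean f"
    by (simp add: circle_mean_def convergent_LIMSEQ_iff)
  then have "(\<lambda>n. norm (riemann_avg f c - riemann_avg f (Suc n))) \<longlonglongrightarrow> norm (riemann_avg f c - circle_mean f)"
    by (intro tendsto_intros)
  moreover have "(\<lambda>n. C / c + C / real (Suc n)) \<longlonglongrightarrow> C / c + 0"
    by (intro tendsto_add tendsto_const lim0)
  ultimately have "norm (riemann_avg f c - circle_mean f) \<le> C / c + 0"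
    by (rule LIMSEQ_le) (auto intro!: exI[of _ 0] close simp: assms simp del: of_nat_Suc)
  then show ?thesis by simp
qed

text \<open>
  A uniform limit of finite averages of holomorphic functions.
\<close>

lemma periodization_mean_holomorphic:
  assumes "Im z \<noteq> 0" "Im w \<noteq> 0" "R > 0"
  shows "(\<lambda>s. circle_mean (periodization s z w)) holomorphic_on cap R"
proof -
  obtain C where C: "C > 0" "\<And>s x y. s \<in> cap R \<Longrightarrow> x \<in> {0..1} \<Longrightarrow> y \<in> {0..1} \<Longrightarrow>
       norm (periodization s z w y - periodization s z w x) \<le> C * \<bar>y - x\<bar>"
    using periodization_bounds[OF assms] by blast
  have ul: "uniform_limit (cap R) (\<lambda>n s. riemann_avg (periodization s z w) (Suc n))
      (\<lambda>s. circle_mean (periodization s z w)) sequentially"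
  proof (rule uniform_limitI)
    fix e :: real assume "e > 0"
    moreover have "(\<lambda>n. C / real (Suc n)) \<longlonglongrightarrow> 0" by real_asymp
    ultimately have "\<forall>\<^sub>F n in sequentially. C / real (Suc n) < e"
      by (simp add: order_tendstoD(2))
    then show "\<forall>\<^sub>F n in sequentially. \<forall>s\<in>cap R.
        dist (riemann_avg (periodization s z w) (Suc n)) (circle_mean (periodization s z w)) < e"
    proof eventually_elim
      case (elim n)
      show ?case
      proof
        fix s assume "s \<in> cap R"
        then have "norm (riemann_avg (periodization s z w) (Suc n) - circle_mean (periodization s z w)) \<le> C / real (Suc n)"
          using C by (intro riemann_avg_close_to_mean) auto
        then show "dist (riemann_avg (periodization s z w) (Suc n)) (circle_mean (periodization s z w)) < e"
          using elim by (simp add: dist_norm)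
      qed
    qed
  qed
  show ?thesis
  proof (rule holomorphic_uniform_sequence[OF open_cap])
    fix n
    show "(\<lambda>s. riemann_avg (periodization s z w) (Suc n)) holomorphic_on cap R"
      unfolding riemann_avg_def
      by (intro holomorphic_intros periodization_holomorphic assms) (auto simp del: of_nat_Suc)
  next
    fix x assume "x \<in> cap R"
    then obtain d where d: "d > 0" "cball x d \<subseteq> cap R" using open_cap open_contains_cball by blast
    then show "\<exists>d>0. cball x d \<subseteq> cap R \<and> uniform_limit (cball x d)
         (\<lambda>n s. riemann_avg (periodization s z w) (Suc n)) (\<lambda>s. circle_mean (periodization s z w)) sequentially"
      using uniform_limit_on_subset[OF ul] by blast
  qed
qed

lemma infsum_finite_sum:
  fixes f :: "'b \<Rightarrow> 'a \<Rightarrow> complex"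
  assumes "finite B" "\<And>b. b \<in> B \<Longrightarrow> f b summable_on A"
  shows "(\<lambda>n. \<Sum>b\<in>B. f b n) summable_on A \<and> (\<Sum>\<^sub>\<infinity>n\<in>A. \<Sum>b\<in>B. f b n) = (\<Sum>b\<in>B. \<Sum>\<^sub>\<infinity>n\<in>A. f b n)"
  using assms
proof (induction B rule: finite_induct)
  case (insert b B)
  then have IH: "(\<lambda>n. \<Sum>b\<in>B. f b n) summable_on A"
    "(\<Sum>\<^sub>\<infinity>n\<in>A. \<Sum>b\<in>B. f b n) = (\<Sum>b\<in>B. \<Sum>\<^sub>\<infinity>n\<in>A. f b n)" by auto
  have b: "f b summable_on A" using insert by auto
  show ?case
    using insert.hyps IH(2) summable_on_add[OF b IH(1)] infsum_add[OF b IH(1)] by simp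
qed auto

lemma telescoping_infsum_int:
  fixes f :: "int \<Rightarrow> complex"
  assumes "(\<lambda>n. f n - f (n + 1)) summable_on UNIV" "(\<lambda>N. f (int N)) \<longlonglongrightarrow> 0" "(\<lambda>N. f (- int N)) \<longlonglongrightarrow> 0"
  shows "(\<Sum>\<^sub>\<infinity>n. f n - f (n + 1)) = 0"
proof -
  have fl: "filterlim (\<lambda>N. {- int N..<int N}) (finite_subsets_at_top UNIV) sequentially"
    unfolding filterlim_finite_subsets_at_top
  proof (intro allI impI)
    fix X :: "int set" assume X: "finite X \<and> X \<subseteq> UNIV"
    define M where "M = nat (Max (insert 0 (abs ` X))) + 1"
    have "X \<subseteq> {- int N..<int N}" if "N \<ge> M" for N
    proof
      fix x assume "x \<in> X"
      then have "\<bar>x\<bar> \<le> Max (insert 0 (abs ` X))" using X by (intro Max_ge) auto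
      moreover have "0 \<le> Max (insert 0 (abs ` X))" using X by (intro Max_ge) auto
      ultimately have "\<bar>x\<bar> < int M" by (simp add: M_def)
      then show "x \<in> {- int N..<int N}" using that by auto
    qed
    then show "\<forall>\<^sub>F N in sequentially. finite {- int N..<int N} \<and> X \<subseteq> {- int N..<int N} \<and> {- int N..<int N} \<subseteq> UNIV"
      by (intro eventually_sequentiallyI[of M]) auto
  qed
  have "((\<lambda>X. \<Sum>n\<in>X. f n - f (n + 1)) \<longlongrightarrow> (\<Sum>\<^sub>\<infinity>n. f n - f (n + 1))) (finite_subsets_at_top UNIV)"
    using has_sum_infsum[OF assms(1)] by (simp add: has_sum_def)
  from filterlim_compose[OF this fl]
  have 1: "(\<lambda>N. \<Sum>n\<in>{- int N..<int N}. f n - f (n + 1)) \<longlonglongrightarrow> (\<Sum>\<^sub>\<infinity>n. f n - f (n + 1))" .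
  have "(\<Sum>n\<in>{- int N..<int N}. f n - f (n + 1)) = f (- int N) - f (int N)" for N
  proof (induction N)
    case (Suc N)
    have "{- int (Suc N)..<int (Suc N)} = insert (- int (Suc N)) (insert (int N) {- int N..<int N})"
      by auto
    then show ?case using Suc by (simp add: add.commute)
  qed auto
  then have "(\<lambda>N. f (- int N) - f (int N)) \<longlonglongrightarrow> (\<Sum>\<^sub>\<infinity>n. f n - f (n + 1))" using 1 by simp
  moreover have "(\<lambda>N. f (- int N) - f (int N)) \<longlonglongrightarrow> 0 - 0"
    by (intro tendsto_diff assms)
  ultimately show ?thesis using LIMSEQ_unique by force
qed

text \<open>
  At \<open>s = 1\<close> the summand is \<open>1/(x + n + z)^2\<close>, a derivative. With \<open>v\<close> running through the points
  \<open>b/c + n + z\<close> and \<open>h = 1/c\<close>, the term \<open>h / v^2\<close> of the Riemann sum differs from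
  \<open>1/v - 1/(v + h)\<close> by \<open>h^2 / (v^2 (v + h))\<close>; the latter differences telescope over all of \<open>\<int>\<close> to
  \<open>0\<close>, and the errors sum to \<open>O(1/c)\<close>.
\<close>

lemma circle_mean_at_1:
  assumes "Im z \<noteq> 0"
  shows "circle_mean (periodization 1 z z) = 0"
proof -
  let ?P = "periodization 1 z z"
  have one: "1 \<in> cap 2" by (simp add: cap_def)
  from nonreal_translate_bound[OF assms] obtain k where k: "0 < k" "k \<le> 1"
    "\<And>x n. 0 \<le> x \<Longrightarrow> x \<le> 1 \<Longrightarrow> k * (1 + \<bar>of_int n\<bar>) \<le> norm (of_real x + of_int n + z)" by blast
  have nz: "of_real x + of_int n + z \<noteq> 0" for x :: real and n
    using assms by (auto simp: complex_eq_iff)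
  have Imz: "norm (of_real x + of_int n + z) \<ge> \<bar>Im z\<bar>" for x :: real and n
    using abs_Im_le_cmod[of "of_real x + of_int n + z"] by simp
  have w: "1 / (1 + \<bar>real_of_int n\<bar>)\<^sup>2 \<le> int_weight n" for n
  proof -
    have "(1 + \<bar>real_of_int n\<bar>) powr (- 2) \<le> (1 + \<bar>real_of_int n\<bar>) powr (- (15/8))"
      by (intro powr_mono) auto
    moreover have "(1 + \<bar>real_of_int n\<bar>) powr (- 2) = 1 / (1 + \<bar>real_of_int n\<bar>)\<^sup>2"
      by (subst powr_minus_divide, subst powr_numeral) auto
    ultimately show ?thesis by (simp only: int_weight_def)
  qed
  have inv_bound: "1 / (norm (of_real x + of_int n + z) * norm (of_real y + of_int n + z)) \<le> int_weight n / k\<^sup>2"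
    if "x \<in> {0..1}" "y \<in> {0..1}" for x y :: real and n
  proof -
    define t where "t = k * (1 + \<bar>of_int n\<bar>)"
    have t: "t > 0" "t \<le> norm (of_real x + of_int n + z)" "t \<le> norm (of_real y + of_int n + z)"
      unfolding t_def using k(1) k(3)[of x n] k(3)[of y n] that by simp_all
    then have "t * t \<le> norm (of_real x + of_int n + z) * norm (of_real y + of_int n + z)"
      by (intro mult_mono) linarith+
    then have "1 / (norm (of_real x + of_int n + z) * norm (of_real y + of_int n + z)) \<le> 1 / (t * t)"
      using t(1) by (intro frac_le) simp_all
    also have "\<dots> = (1 / (1 + \<bar>real_of_int n\<bar>)\<^sup>2) / k\<^sup>2"
      by (simp add: t_def power2_eq_square mult_ac)
    also have "\<dots> \<le> int_weight n / k\<^sup>2" using w by (intro divide_right_mono) auto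
    finally show ?thesis .
  qed
  define g where "g = (\<lambda>n::int. 1 / (of_int n + z))"
  have g_diff: "g n - g (n + 1) = 1 / ((of_real 0 + of_int n + z) * (of_real 1 + of_int n + z))" for n
    using nz[of 0 n] nz[of 1 n] by (simp add: g_def field_simps)
  have T_bound: "norm (g n - g (n + 1)) \<le> 1 / k\<^sup>2 * int_weight n" for n
    unfolding g_diff norm_divide norm_mult using inv_bound[of 0 1 n] by simp
  have T_summable: "(\<lambda>n. g n - g (n + 1)) summable_on UNIV"
    by (rule summable_on_bound(1)[OF summable_on_cmult_right[OF int_weight_summable, of "1 / k\<^sup>2"]])
       (use T_bound in auto)
  have T_sum: "(\<Sum>\<^sub>\<infinity>n. g n - g (n + 1)) = 0"
  proof (rule telescoping_infsum_int[OF T_summable])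
    have lim: "(\<lambda>N. 1 / (k * (1 + real N))) \<longlonglongrightarrow> 0" using k by real_asymp
    have g: "norm (g n) \<le> 1 / (k * (1 + \<bar>of_int n\<bar>))" for n
      unfolding g_def norm_divide using k k(3)[of 0 n] nz[of 0 n] by (auto intro!: divide_left_mono mult_pos_pos)
    show "(\<lambda>N. g (int N)) \<longlonglongrightarrow> 0" "(\<lambda>N. g (- int N)) \<longlonglongrightarrow> 0"
      by (rule Lim_null_comparison[OF always_eventually lim], use g[of "int _"] g[of "- int _"] in simp)+
  qed
  define D where "D = (1 / (k\<^sup>2 * \<bar>Im z\<bar>)) * (\<Sum>\<^sub>\<infinity>n. int_weight n)"
  have avg: "norm (riemann_avg ?P c) \<le> D / c" if c: "c > 0" for c
  proof -
    define F where "F = (\<lambda>n. \<Sum>b<c. lattice_term 1 z z (real b / real c) n / of_nat c)"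
    have "F summable_on UNIV \<and> infsum F UNIV = (\<Sum>b<c. \<Sum>\<^sub>\<infinity>n. lattice_term 1 z z (real b / real c) n / of_nat c)"
      unfolding F_def
    proof (rule infsum_finite_sum)
      fix b assume "b \<in> {..<c}"
      then have "real b / real c \<in> {0..1}" by auto
      then have "(\<lambda>n. lattice_term 1 z z (real b / real c) n * inverse (of_nat c)) summable_on UNIV"
        by (intro summable_on_cmult_left summable_lattice_term[OF assms assms one])
      then show "(\<lambda>n. lattice_term 1 z z (real b / real c) n / of_nat c) summable_on UNIV"
        by (simp only: divide_inverse[of "lattice_term _ _ _ _ _"])
    qed auto
    moreover have "(\<Sum>b<c. \<Sum>\<^sub>\<infinity>n. lattice_term 1 z z (real b / real c) n / of_nat c) = riemann_avg ?P c"
      unfolding divide_inverse[of "lattice_term _ _ _ _ _"] infsum_cmult_left' riemann_avg_def periodization_def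
      by (simp add: sum_distrib_right[symmetric] divide_inverse[of "sum _ _"])
    ultimately have F: "F summable_on UNIV" "riemann_avg ?P c = infsum F UNIV"
      by simp_all
    have diff: "norm (F n - (g n - g (n + 1))) \<le> (1 / (k\<^sup>2 * \<bar>Im z\<bar>) / c) * int_weight n" for n
    proof -
      define v where "v = (\<lambda>b::nat. of_real (real b / real c) + of_int n + z)"
      have v0: "v b \<noteq> 0" for b unfolding v_def by (rule nz)
      have step: "v (Suc b) = v b + 1 / of_nat c" for b using c by (simp add: v_def field_simps)
      have "g n - g (n + 1) = (\<Sum>b<c. 1 / v b - 1 / v (Suc b))"
        using sum_lessThan_telescope'[of "\<lambda>b. 1 / v b" c] c by (simp add: v_def g_def add_ac)
      then have "F n - (g n - g (n + 1)) = (\<Sum>b<c. lattice_term 1 z z (real b / real c) n / of_nat c - (1 / v b - 1 / v (Suc b)))"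
        by (simp add: F_def sum_subtractf)
      also have "\<dots> = (\<Sum>b<c. 1 / (of_nat c)\<^sup>2 * (1 / (v b * v b) * (1 / v (Suc b))))"
      proof (intro sum.cong refl)
        fix b
        have "lattice_term 1 z z (real b / real c) n = 1 / (v b * v b)"
          using psi_at_1[OF v0[of b]] by (simp add: lattice_term_def v_def)
        moreover have "1 / (v b * v b) / of_nat c - (1 / v b - 1 / v (Suc b)) =
            1 / (of_nat c)\<^sup>2 * (1 / (v b * v b) * (1 / v (Suc b)))"
        proof -
          define x y h where "x = v b" and "y = v (Suc b)" and "h = 1 / complex_of_nat c"
          have "x \<noteq> 0" "y \<noteq> 0" unfolding x_def y_def by (rule v0)+
          moreover have "y = x + h" by (simp add: x_def y_def h_def step)
          ultimately have "1 / (x * x) * h - (1 / x - 1 / y) = h\<^sup>2 * (1 / (x * x) * (1 / y))"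
            by (simp add: divide_simps) (simp add: algebra_simps power2_eq_square)
          then show ?thesis by (simp add: x_def y_def h_def power_divide)
        qed
        ultimately show "lattice_term 1 z z (real b / real c) n / of_nat c - (1 / v b - 1 / v (Suc b)) =
            1 / (of_nat c)\<^sup>2 * (1 / (v b * v b) * (1 / v (Suc b)))" by simp
      qed
      also have "norm \<dots> \<le> (\<Sum>b<c. 1 / (real c)\<^sup>2 * (int_weight n / k\<^sup>2 * (1 / \<bar>Im z\<bar>)))"
      proof (rule sum_norm_le)
        fix b assume b: "b \<in> {..<c}"
        have "1 / norm (v (Suc b)) \<le> 1 / \<bar>Im z\<bar>"
          by (rule frac_le) (use assms Imz[of "real (Suc b) / real c" n] in \<open>simp_all add: v_def\<close>)
        then show "norm (1 / (of_nat c)\<^sup>2 * (1 / (v b * v b) * (1 / v (Suc b)))) \<le>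
            1 / (real c)\<^sup>2 * (int_weight n / k\<^sup>2 * (1 / \<bar>Im z\<bar>))"
          unfolding norm_mult norm_divide norm_power using inv_bound[of "real b / real c" "real b / real c" n] b
          by (intro mult_mono) (auto simp: v_def)
      qed
      also have "\<dots> = (1 / (k\<^sup>2 * \<bar>Im z\<bar>) / c) * int_weight n"
        using c by (simp add: power2_eq_square field_simps)
      finally show ?thesis .
    qed
    have "riemann_avg ?P c = (\<Sum>\<^sub>\<infinity>n. F n + - (g n - g (n + 1)))"
      by (subst infsum_add) (use F T_summable T_sum in \<open>auto simp: summable_on_uminus infsum_uminus simp del: minus_diff_eq\<close>)
    also have "norm \<dots> \<le> (\<Sum>\<^sub>\<infinity>n. (1 / (k\<^sup>2 * \<bar>Im z\<bar>) / c) * int_weight n)"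
      by (rule summable_on_bound(2)[OF summable_on_cmult_right[OF int_weight_summable]])
         (use diff in \<open>simp only: add_uminus_conv_diff\<close>)
    also have "\<dots> = D / c" unfolding infsum_cmult_right' D_def by simp
    finally show ?thesis .
  qed
  obtain C where C: "C > 0" "\<And>s x y. s \<in> cap 2 \<Longrightarrow> x \<in> {0..1} \<Longrightarrow> y \<in> {0..1} \<Longrightarrow>
       norm (periodization s z z y - periodization s z z x) \<le> C * \<bar>y - x\<bar>"
    using periodization_bounds[OF assms assms, of 2] by auto
  have "norm (circle_mean ?P) \<le> D / real (Suc n) + C / real (Suc n)" for n
  proof -
    have "norm (riemann_avg ?P (Suc n) - circle_mean ?P) \<le> C / real (Suc n)"
      by (rule riemann_avg_close_to_mean) (use C one in auto)
    then show ?thesis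
      using avg[of "Suc n"] norm_triangle_sub[of "circle_mean ?P" "riemann_avg ?P (Suc n)"]
      by (simp add: norm_minus_commute del: of_nat_Suc)
  qed
  moreover have "(\<lambda>n. D / real (Suc n) + C / real (Suc n)) \<longlonglongrightarrow> 0" by real_asymp
  ultimately have "norm (circle_mean ?P) \<le> 0"
    by (intro LIMSEQ_le_const) auto
  then show ?thesis by simp
qed

section \<open>The Dirichlet series of the totient function over multiples of N\<close>

text \<open>
  This is \<open>c^(2-4s)\<close>, written through \<open>psi\<close> because that is how it arises and because multiplicativity is then
  inherited.
\<close>

definition chi :: "complex \<Rightarrow> nat \<Rightarrow> complex" where
  "chi s c = psi s (of_nat c) ^ 2"

lemma chi_mult: "chi s (c * d) = chi s c * chi s d"
  by (simp add: chi_def psi_mult power_mult_distrib)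

lemma norm_chi: "norm (chi s c) = real c powr (2 - 4 * Re s)"
  by (simp add: chi_def norm_psi norm_mult power2_eq_square flip: powr_add)

lemma chi_holomorphic: "c > 0 \<Longrightarrow> (\<lambda>s. chi s c) holomorphic_on A"
  unfolding chi_def by (intro holomorphic_intros holomorphic_psi) auto

lemma chi_eq_exp: "c > 0 \<Longrightarrow> of_nat c * chi s c = exp ((3 - 4 * s) * of_real (ln (real c)))"
proof -
  assume c: "c > 0"
  have "of_nat c * chi s c = of_nat c * (of_nat c * exp (- (2 * s * of_real (ln (real c))))) ^ 2"
    using c by (simp add: chi_def psi_eq_exp)
  also have "\<dots> = of_nat c ^ 3 * exp (of_nat 2 * (- (2 * s * of_real (ln (real c)))))"
    unfolding exp_of_nat_mult by (simp add: power_mult_distrib eval_nat_numeral)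
  also have "\<dots> = exp (of_real (ln (real c))) ^ 3 * exp (of_nat 2 * (- (2 * s * of_real (ln (real c)))))"
    using c by (simp add: exp_of_real)
  also have "exp (of_real (ln (real c))) ^ 3 * exp (of_nat 2 * (- (2 * s * of_real (ln (real c))))) =
     exp ((3 - 4 * s) * complex_of_real (ln (real c)))"
    by (simp add: algebra_simps flip: exp_of_nat_mult exp_add)
  finally show ?thesis .
qed

lemma norm_exp_remainder_le: "norm (exp (w :: complex) - 1 - w) \<le> (norm w)\<^sup>2 * exp (norm w)"
proof -
  have "norm ((exp w - w) - (exp 0 - 0)) \<le> (norm w * exp (norm w)) * norm (w - 0)"
  proof (rule field_differentiable_bound[of "cball 0 (norm w)" "\<lambda>z. exp z - z" "\<lambda>z. exp z - 1"])
    fix z :: complex assume "z \<in> cball 0 (norm w)"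
    then have z: "norm z \<le> norm w" by simp
    show "((\<lambda>z. exp z - z) has_field_derivative exp z - 1) (at z within cball 0 (norm w))"
      by (auto intro!: derivative_eq_intros)
    have "norm (exp z - 1) \<le> norm z * exp (norm z)" by (rule norm_exp_minus_1_le)
    also have "\<dots> \<le> norm w * exp (norm w)" using z by (intro mult_mono) auto
    finally show "norm (exp z - 1) \<le> norm w * exp (norm w)" .
  qed auto
  then show ?thesis by (simp add: power2_eq_square algebra_simps)
qed

lemma one_plus_powr_remainder:
  fixes v :: complex
  assumes "norm v \<le> Q" "0 \<le> t" "t \<le> 1"
  shows "norm (exp (v * of_real (ln (1 + t))) - 1 - v * of_real t) \<le> (Q\<^sup>2 * exp Q + Q) * t\<^sup>2"
proof -
  define L where "L = ln (1 + t)"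
  have Q: "Q \<ge> 0" using assms(1) norm_ge_zero order_trans by blast
  have L: "0 \<le> L" "L \<le> t" "\<bar>L - t\<bar> \<le> t\<^sup>2"
    using assms abs_ln_one_plus_x_minus_x_bound_nonneg[of t] ln_add_one_self_le_self[of t] by (auto simp: L_def)
  have nv: "norm (v * of_real L) = norm v * L" using L by (simp add: norm_mult)
  have le: "norm v * L \<le> Q * t" using L assms Q by (intro mult_mono) auto
  have "exp (v * of_real L) - 1 - v * of_real t = (exp (v * of_real L) - 1 - v * of_real L) + v * of_real (L - t)"
    by (simp add: algebra_simps)
  also have "norm \<dots> \<le> norm (exp (v * of_real L) - 1 - v * of_real L) + norm (v * of_real (L - t))"
    by (rule norm_triangle_ineq)
  also have "norm (v * of_real (L - t)) \<le> Q * t\<^sup>2"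
    unfolding norm_mult norm_of_real using L assms Q by (intro mult_mono) auto
  also have "norm (exp (v * of_real L) - 1 - v * of_real L) \<le> (norm v * L)\<^sup>2 * exp (norm v * L)"
    using norm_exp_remainder_le[of "v * of_real L"] by (simp add: nv)
  also have "\<dots> \<le> (Q * t)\<^sup>2 * exp Q"
  proof (intro mult_mono power_mono le)
    have "Q * t \<le> Q * 1" using Q assms by (intro mult_left_mono) auto
    then show "exp (norm v * L) \<le> exp Q" using le by simp
  qed (use L assms Q in auto)
  finally show ?thesis by (simp add: L_def power_mult_distrib algebra_simps)
qed

text \<open>
  With \<open>v = 4 - 4s\<close> this is \<open>(k+1)^v - k^v - v k^(v-1)\<close>, the error in replacing an increment of \<open>x^v\<close> by its
  linear part. It is smaller than \<open>k^(v-1)\<close> by a factor \<open>1/k\<close>, which is the room needed to pass the pole.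
\<close>

definition zeta_term :: "complex \<Rightarrow> nat \<Rightarrow> complex" where
  "zeta_term s k = - (4 - 4 * s) * (of_nat k * chi s k)
     + exp ((4 - 4 * s) * of_real (ln (real (Suc k)))) - exp ((4 - 4 * s) * of_real (ln (real k)))"

definition zeta_cont :: "complex \<Rightarrow> complex" where
  "zeta_cont s = (1 + (\<Sum>\<^sub>\<infinity>k\<in>{0<..}. zeta_term s k)) / 4"

lemma zeta_term_bound:
  "\<exists>C>0. \<forall>s\<in>cap R. \<forall>k>0. norm (zeta_term s k) \<le> C * real k powr (- (15/8))"
proof -
  define Q where "Q = 4 + 4 * \<bar>R\<bar>"
  define C where "C = Q\<^sup>2 * exp Q + Q"
  have "norm (zeta_term s k) \<le> C * real k powr (- (15/8))" if s: "s \<in> cap R" and k: "k > 0" for s k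
  proof -
    define v where "v = 4 - 4 * s"
    define t where "t = 1 / real k"
    have v: "norm v \<le> Q"
      using norm_triangle_ineq4[of 4 "4 * s"] capD[OF s] by (simp add: v_def Q_def norm_mult)
    have t: "0 \<le> t" "t \<le> 1" using k by (auto simp: t_def)
    have Suc: "ln (real (Suc k)) = ln (real k) + ln (1 + t)"
      using k by (subst ln_mult_pos[symmetric]) (auto simp: t_def field_simps add_pos_pos)
    have chi: "of_nat k * chi s k = exp (v * of_real (ln (real k))) * of_real t"
    proof -
      have "of_nat k * chi s k = exp (v * of_real (ln (real k)) - of_real (ln (real k)))"
        using k by (simp add: chi_eq_exp v_def algebra_simps)
      also have "\<dots> = exp (v * of_real (ln (real k))) / of_nat k"
        using k by (simp add: exp_diff exp_of_real)
      finally show ?thesis by (simp add: t_def)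
    qed
    have "zeta_term s k = exp (v * of_real (ln (real k))) * (exp (v * of_real (ln (1 + t))) - 1 - v * of_real t)"
      unfolding zeta_term_def v_def[symmetric] chi Suc
      by (simp add: algebra_simps exp_add)
    then have "norm (zeta_term s k) = norm (exp (v * of_real (ln (real k)))) * norm (exp (v * of_real (ln (1 + t))) - 1 - v * of_real t)"
      by (simp add: norm_mult)
    also have "\<dots> \<le> real k powr (1/8) * (C * t\<^sup>2)"
    proof (rule mult_mono)
      have "norm (exp (v * of_real (ln (real k)))) = real k powr (4 - 4 * Re s)"
        using k by (simp add: v_def powr_def)
      also have "\<dots> \<le> real k powr (1/8)"
        using k capD[OF s] by (intro powr_mono) auto
      finally show "norm (exp (v * of_real (ln (real k)))) \<le> real k powr (1/8)" .
      show "norm (exp (v * of_real (ln (1 + t))) - 1 - v * of_real t) \<le> C * t\<^sup>2"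
        unfolding C_def by (rule one_plus_powr_remainder[OF v t])
    qed auto
    also have "t\<^sup>2 = real k powr (- 2)"
      using k by (simp add: t_def powr_minus powr_numeral power_inverse divide_inverse)
    also have "real k powr (1/8) * (C * real k powr (- 2)) = C * real k powr (- (15/8))"
      by (simp add: mult.left_commute[of _ C] flip: powr_add)
    finally show ?thesis .
  qed
  moreover have "C > 0" by (simp add: C_def Q_def add_pos_nonneg)
  ultimately show ?thesis by blast
qed

lemma zeta_cont_holomorphic: "zeta_cont holomorphic_on cap R"
proof -
  obtain C where C: "C > 0" "\<And>s k. s \<in> cap R \<Longrightarrow> k > 0 \<Longrightarrow> norm (zeta_term s k) \<le> C * real k powr (- (15/8))"
    using zeta_term_bound[of R] by blast
  have "(\<lambda>s. \<Sum>\<^sub>\<infinity>k\<in>{0<..}. zeta_term s k) holomorphic_on cap R"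
  proof (rule holomorphic_infsum[OF open_cap])
    fix k :: nat assume "k \<in> {0<..}"
    then show "(\<lambda>s. zeta_term s k) holomorphic_on cap R"
      unfolding zeta_term_def by (intro holomorphic_intros chi_holomorphic) auto
  next
    show "(\<lambda>k. C * real k powr (- (15/8))) summable_on {0<..}"
      by (intro summable_on_cmult_right summable_on_pos_nat_powr) auto
  qed (use C in auto)
  then show ?thesis unfolding zeta_cont_def[abs_def] by (intro holomorphic_intros) auto
qed

lemma chi_weighted_summable:
  assumes "Re s > 1"
  shows "(\<lambda>k. of_nat k * chi s k) summable_on A"
proof (rule summable_on_bound(1)[OF summable_on_pos_nat_powr[of "4 * Re s - 3"]])
  fix k :: nat
  show "norm (of_nat k * chi s k) \<le> real k powr - (4 * Re s - 3)"
  proof (cases "k = 0")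
    case False
    then have "real k * real k powr (2 - 4 * Re s) = real k powr (1 + (2 - 4 * Re s))"
      by (subst powr_add) auto
    then show ?thesis by (simp add: norm_mult norm_chi)
  qed auto
qed (use assms in auto)

lemma telescoping_infsum_nat:
  fixes f :: "nat \<Rightarrow> complex"
  assumes "(\<lambda>n. f (Suc n) - f n) summable_on {0<..}" "f \<longlonglongrightarrow> 0"
  shows "(\<Sum>\<^sub>\<infinity>n\<in>{0<..}. f (Suc n) - f n) = - f 1"
proof -
  have bij: "bij_betw Suc UNIV {0<..}"
    by (rule bij_betw_byWitness[of _ "\<lambda>n. n - 1"]) auto
  have s: "(\<lambda>n. f (Suc (Suc n)) - f (Suc n)) summable_on UNIV"
    using assms(1) summable_on_reindex_bij_betw[OF bij, of "\<lambda>n. f (Suc n) - f n"] by simp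
  have "(\<lambda>n. f (Suc (Suc n)) - f (Suc n)) sums (\<Sum>\<^sub>\<infinity>n. f (Suc (Suc n)) - f (Suc n))"
    by (rule has_sum_imp_sums[OF has_sum_infsum[OF s]])
  moreover have "(\<lambda>n. f (Suc (Suc n)) - f (Suc n)) sums (0 - f (Suc 0))"
    by (rule telescope_sums[of "\<lambda>n. f (Suc n)"]) (use assms(2) LIMSEQ_Suc in blast)
  ultimately have "(\<Sum>\<^sub>\<infinity>n. f (Suc (Suc n)) - f (Suc n)) = 0 - f (Suc 0)"
    by (rule sums_unique2)
  then show ?thesis
    using infsum_reindex_bij_betw[OF bij, of "\<lambda>n. f (Suc n) - f n"] by simp
qed

text \<open>
  The increments of \<open>k^v\<close> telescope to \<open>-1\<close>. The sum on the right is \<open>\<zeta>(4s-3)\<close>.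
\<close>

lemma zeta_cont_eq:
  assumes "Re s > 1"
  shows "zeta_cont s = (s - 1) * (\<Sum>\<^sub>\<infinity>k\<in>{0<..}. of_nat k * chi s k)"
proof -
  obtain C where C: "C > 0" "\<And>s' k. s' \<in> cap (norm s + 1) \<Longrightarrow> k > 0 \<Longrightarrow> norm (zeta_term s' k) \<le> C * real k powr (- (15/8))"
    using zeta_term_bound[of "norm s + 1"] by blast
  have s: "s \<in> cap (norm s + 1)" using assms by (simp add: cap_def)
  have sz: "zeta_term s summable_on {0<..}"
    by (rule summable_on_bound(1)[OF summable_on_cmult_right[OF summable_on_pos_nat_powr[of "15/8"], of C]])
       (use C s in auto)
  define e where "e = (\<lambda>k. exp ((4 - 4 * s) * of_real (ln (real k))))"
  have sc: "(\<lambda>k. (4 - 4 * s) * (of_nat k * chi s k)) summable_on {0<..}"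
    by (intro summable_on_cmult_right chi_weighted_summable assms)
  have sum_e: "(\<lambda>k. e (Suc k) - e k) summable_on {0<..}"
    using summable_on_add[OF sz sc] by (simp add: zeta_term_def e_def algebra_simps)
  have "e \<longlonglongrightarrow> 0"
  proof (rule tendsto_norm_zero_cancel)
    have "(\<lambda>k. real k powr (4 - 4 * Re s)) \<longlonglongrightarrow> 0"
      using assms by (intro tendsto_neg_powr filterlim_real_sequentially) auto
    moreover have "\<forall>\<^sub>F k in sequentially. real k powr (4 - 4 * Re s) = norm (e k)"
      by (rule eventually_sequentiallyI[of 1]) (simp add: e_def powr_def)
    ultimately show "(\<lambda>k. norm (e k)) \<longlonglongrightarrow> 0" by (rule Lim_transform_eventually)
  qed
  from telescoping_infsum_nat[OF sum_e this]
  have tel: "(\<Sum>\<^sub>\<infinity>k\<in>{0<..}. e (Suc k) - e k) = - 1" by (simp add: e_def)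
  have "(\<Sum>\<^sub>\<infinity>k\<in>{0<..}. zeta_term s k) = (\<Sum>\<^sub>\<infinity>k\<in>{0<..}. (- (4 - 4 * s)) * (of_nat k * chi s k) + (e (Suc k) - e k))"
    by (rule infsum_cong) (simp add: zeta_term_def e_def)
  also have "\<dots> = (\<Sum>\<^sub>\<infinity>k\<in>{0<..}. (- (4 - 4 * s)) * (of_nat k * chi s k)) + (\<Sum>\<^sub>\<infinity>k\<in>{0<..}. e (Suc k) - e k)"
    by (intro infsum_add sum_e summable_on_cmult_right chi_weighted_summable assms)
  also have "\<dots> = - (4 - 4 * s) * (\<Sum>\<^sub>\<infinity>k\<in>{0<..}. of_nat k * chi s k) - 1"
    unfolding tel infsum_cmult_right' by simp
  finally have eq: "(\<Sum>\<^sub>\<infinity>k\<in>{0<..}. zeta_term s k) =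
      - (4 - 4 * s) * (\<Sum>\<^sub>\<infinity>k\<in>{0<..}. of_nat k * chi s k) - 1" .
  show ?thesis unfolding zeta_cont_def eq by (simp add: field_simps)
qed

text \<open>
  Finite sets of primes stand for squarefree integers, and \<open>(-1) ^ card P\<close> for the Moebius function.
\<close>

definition prime_sets :: "nat set set" where
  "prime_sets = {P. finite P \<and> (\<forall>p\<in>P. prime p)}"

lemma prod_prime_set_pos: "P \<in> prime_sets \<Longrightarrow> \<Prod>P > 0"
  by (auto simp: prime_sets_def intro!: prod_pos prime_gt_0_nat)

lemma prime_dvd_prod_prime_set_iff:
  assumes "P \<in> prime_sets" "prime p"
  shows "p dvd \<Prod>P \<longleftrightarrow> p \<in> P"
proof
  assume "p dvd \<Prod>P"
  then obtain q where "q \<in> P" "p dvd q"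
    using assms by (auto simp: prime_sets_def prime_dvd_prod_iff)
  moreover then have "prime q" using assms by (auto simp: prime_sets_def)
  ultimately show "p \<in> P" using primes_dvd_imp_eq assms(2) by blast
qed (use assms in \<open>auto simp: prime_sets_def dvd_prod_eqI\<close>)

lemma inj_on_prod_prime_sets: "inj_on Prod prime_sets"
proof (rule inj_onI)
  fix P Q :: "nat set" assume *: "P \<in> prime_sets" "Q \<in> prime_sets" "\<Prod>P = \<Prod>Q"
  have "p \<in> P \<longleftrightarrow> p \<in> Q" for p
  proof (cases "prime p")
    case True
    then show ?thesis using * prime_dvd_prod_prime_set_iff by metis
  next
    case False
    then show ?thesis using * by (auto simp: prime_sets_def)
  qed
  then show "P = Q" by blast
qed

lemma prod_prime_set_dvd:
  assumes "P \<in> prime_sets" "\<And>p. p \<in> P \<Longrightarrow> p dvd n"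
  shows "\<Prod>P dvd n"
proof -
  have "finite P" using assms by (simp add: prime_sets_def)
  then show ?thesis using assms
  proof (induction P rule: finite_induct)
    case (insert p P)
    have "coprime p (\<Prod>P)"
      using insert.prems insert.hyps
      by (intro prod_coprime_right) (auto simp: prime_sets_def intro!: primes_coprime)
    moreover have "\<Prod>P dvd n" using insert by (auto simp: prime_sets_def)
    ultimately show ?case using insert by (simp add: divides_mult)
  qed auto
qed

lemma subset_prime_factors_iff:
  assumes "n > 0"
  shows "P \<in> Pow (prime_factors n) \<longleftrightarrow> P \<in> prime_sets \<and> \<Prod>P dvd (n :: nat)"
proof
  assume P: "P \<in> Pow (prime_factors n)"
  then have "finite P" using finite_subset by blast
  then have "P \<in> prime_sets" using P by (auto simp: prime_sets_def)
  then show "P \<in> prime_sets \<and> \<Prod>P dvd n"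
    using P by (auto intro!: prod_prime_set_dvd)
next
  assume P: "P \<in> prime_sets \<and> \<Prod>P dvd n"
  have "p dvd n" if "p \<in> P" for p
    using P that prime_dvd_prod_prime_set_iff[of P p] by (auto simp: prime_sets_def intro: dvd_trans)
  then show "P \<in> Pow (prime_factors n)"
    using P assms by (auto simp: prime_sets_def prime_factors_dvd)
qed

text \<open>
  Expansion of the product formula \<open>\<phi>(n) = n \<Prod>(1 - 1/p)\<close>.
\<close>

lemma totient_as_sum:
  "complex_of_nat (totient n) = (\<Sum>P\<in>Pow (prime_factors n). (-1) ^ card P / of_nat (\<Prod>P) * of_nat n)"
proof -
  have "real (totient n) = real n * (\<Prod>p\<in>prime_factors n. - (1 / real p) + 1)"
    unfolding totient_formula2 by simp
  also have "\<dots> = real n * (\<Sum>P\<in>Pow (prime_factors n). (\<Prod>p\<in>P. - (1 / real p)) * (\<Prod>p\<in>prime_factors n - P. 1))"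
    by (subst prod_add) auto
  also have "\<dots> = (\<Sum>P\<in>Pow (prime_factors n). (-1) ^ card P / real (\<Prod>P) * real n)"
    unfolding prod_uminus by (simp add: sum_distrib_left prod_dividef mult_ac)
  finally have "complex_of_real (real (totient n)) =
      complex_of_real (\<Sum>P\<in>Pow (prime_factors n). (-1) ^ card P / real (\<Prod>P) * real n)" by (rule arg_cong)
  then show ?thesis by simp
qed

text \<open>
  The quotient of the totient series over the multiples of \<open>N\<close> by \<open>\<zeta>(4s-3)\<close>: the numbers divisible by
  \<open>N\<close> and by all primes of \<open>P\<close> are the multiples of their least common multiple.
\<close>

definition level_factor :: "nat \<Rightarrow> complex \<Rightarrow> complex" where
  "level_factor N s = (\<Sum>\<^sub>\<infinity>P\<in>prime_sets. (-1) ^ card P / of_nat (\<Prod>P) *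
      (of_nat (lcm N (\<Prod>P)) * chi s (lcm N (\<Prod>P))))"

lemma norm_chi_weighted: "c > 0 \<Longrightarrow> norm (of_nat c * chi s c) = real c powr (3 - 4 * Re s)"
proof -
  assume "c > 0"
  then have "real c * real c powr (2 - 4 * Re s) = real c powr (1 + (2 - 4 * Re s))"
    by (subst powr_add) auto
  then show ?thesis by (simp add: norm_mult norm_chi)
qed

text \<open>
  The least common multiple is at least \<open>\<Prod>P\<close> and the exponent \<open>3 - 4 Re s\<close> is negative.
\<close>

lemma level_term_bound:
  assumes "N > 0" "Re s > 3/4" "P \<in> prime_sets"
  shows "norm ((-1) ^ card P / of_nat (\<Prod>P) * (of_nat (lcm N (\<Prod>P)) * chi s (lcm N (\<Prod>P)))) \<le>
           real (\<Prod>P) powr (2 - 4 * Re s)"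
proof -
  have P: "\<Prod>P > 0" by (rule prod_prime_set_pos) fact
  have "norm ((-1) ^ card P / of_nat (\<Prod>P) * (of_nat (lcm N (\<Prod>P)) * chi s (lcm N (\<Prod>P)))) =
     norm ((-1) ^ card P / complex_of_nat (\<Prod>P)) * real (lcm N (\<Prod>P)) powr (3 - 4 * Re s)"
    using norm_chi_weighted[of "lcm N (\<Prod>P)" s] P assms(1) by (simp only: norm_mult[of "_ / _"] lcm_pos_nat)
  also have "norm ((-1) ^ card P / complex_of_nat (\<Prod>P)) = real (\<Prod>P) powr (- 1)"
    using P by (simp add: norm_mult norm_inverse norm_power powr_minus divide_inverse del: of_nat_prod)
  also have "real (\<Prod>P) powr (- 1) * real (lcm N (\<Prod>P)) powr (3 - 4 * Re s) \<le>
      real (\<Prod>P) powr (- 1) * real (\<Prod>P) powr (3 - 4 * Re s)"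
    using assms P by (intro mult_left_mono powr_mono2' of_nat_mono dvd_imp_le lcm_pos_nat) (auto simp del: of_nat_prod)
  also have "real (\<Prod>P) powr (- 1) * real (\<Prod>P) powr (3 - 4 * Re s) = real (\<Prod>P) powr (2 - 4 * Re s)"
    by (subst powr_add[symmetric]) simp
  finally show ?thesis .
qed

lemma prime_sets_summable:
  assumes "p > 1"
  shows "(\<lambda>P. real (\<Prod>P) powr (- p)) summable_on prime_sets"
proof -
  have "(\<lambda>n. real n powr (- p)) summable_on (Prod ` prime_sets)"
    by (rule summable_on_pos_nat_powr) fact
  then show ?thesis
    by (subst (asm) summable_on_reindex[OF inj_on_prod_prime_sets]) (simp add: o_def)
qed

lemma level_factor_holomorphic:
  assumes "N > 0"
  shows "level_factor N holomorphic_on cap R"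
  unfolding level_factor_def[abs_def]
proof (rule holomorphic_infsum[OF open_cap])
  fix P assume P: "P \<in> prime_sets"
  then show "(\<lambda>s. (-1) ^ card P / of_nat (\<Prod>P) * (of_nat (lcm N (\<Prod>P)) * chi s (lcm N (\<Prod>P)))) holomorphic_on cap R"
    using prod_prime_set_pos[OF P] assms by (intro holomorphic_intros chi_holomorphic lcm_pos_nat) auto
  fix s assume s: "s \<in> cap R"
  have "norm ((-1) ^ card P / of_nat (\<Prod>P) * (of_nat (lcm N (\<Prod>P)) * chi s (lcm N (\<Prod>P)))) \<le>
      real (\<Prod>P) powr (2 - 4 * Re s)"
    by (rule level_term_bound) (use assms P capD[OF s] in auto)
  also have "\<dots> \<le> real (\<Prod>P) powr (- (15/8))"
    using prod_prime_set_pos[OF P] capD[OF s] by (intro powr_mono) (auto simp: Suc_leI simp del: of_nat_prod)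
  finally show "norm ((-1) ^ card P / of_nat (\<Prod>P) * (of_nat (lcm N (\<Prod>P)) * chi s (lcm N (\<Prod>P)))) \<le>
      real (\<Prod>P) powr (- (15/8))" .
next
  show "(\<lambda>P. real (\<Prod>P) powr (- (15/8))) summable_on prime_sets" by (rule prime_sets_summable) simp
qed

text \<open>
  Both sides are the same absolutely convergent sum over pairs of a modulus \<open>c\<close> and a set \<open>P\<close> of prime factors of
  \<open>c\<close>; the substitution \<open>c = lcm(N, \<Prod>P) k\<close> changes the order of summation.
\<close>

lemma totient_series:
  assumes "N > 0" "Re s > 1"
  shows "(\<Sum>\<^sub>\<infinity>c\<in>{c. c > 0 \<and> N dvd c}. of_nat (totient c) * chi s c) =
          level_factor N s * (\<Sum>\<^sub>\<infinity>k\<in>{0<..}. of_nat k * chi s k)"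
proof -
  define l where "l = (\<lambda>P. lcm N (\<Prod>P))"
  have l: "l P > 0" if "P \<in> prime_sets" for P
    using prod_prime_set_pos[OF that] assms by (simp add: l_def lcm_pos_nat)
  define \<epsilon> where "\<epsilon> = (\<lambda>P. (-1) ^ card P / complex_of_nat (\<Prod>P))"
  define F where "F = (\<lambda>(P, c). \<epsilon> P * (of_nat c * chi s c))"
  define q where "q = 4 * Re s - 3"
  have q: "q > 1" using assms by (simp add: q_def)
  have F_bound: "norm (F (P, l P * k)) \<le> real (\<Prod>P) powr (- (q + 1)) * real k powr (- q)"
    if "P \<in> prime_sets" "k > 0" for P k
  proof -
    have "F (P, l P * k) = (\<epsilon> P * (of_nat (l P) * chi s (l P))) * (of_nat k * chi s k)"
      by (simp add: F_def chi_mult)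
    then have "norm (F (P, l P * k)) = norm (\<epsilon> P * (of_nat (l P) * chi s (l P))) * real k powr (- q)"
      using norm_chi_weighted[OF that(2), of s] by (simp add: norm_mult q_def)
    also have "\<dots> \<le> real (\<Prod>P) powr (2 - 4 * Re s) * real k powr (- q)"
      unfolding \<epsilon>_def l_def by (intro mult_right_mono level_term_bound) (use assms that in auto)
    finally show ?thesis by (simp add: q_def)
  qed
  have "(\<lambda>(P, k). real (\<Prod>P) powr (- (q + 1)) * real k powr (- q)) summable_on prime_sets \<times> {0<..}"
  proof (rule summable_on_SigmaI)
    fix P show "((\<lambda>k. case (P, k) of (P, k) \<Rightarrow> real (\<Prod>P) powr (- (q + 1)) * real k powr (- q)) has_sum
        real (\<Prod>P) powr (- (q + 1)) * (\<Sum>\<^sub>\<infinity>k\<in>{0<..}. real k powr (- q))) {0<..}"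
      unfolding prod.case by (intro has_sum_cmult_right has_sum_infsum summable_on_pos_nat_powr q)
  next
    show "(\<lambda>P. real (\<Prod>P) powr (- (q + 1)) * (\<Sum>\<^sub>\<infinity>k\<in>{0<..}. real k powr (- q))) summable_on prime_sets"
      by (intro summable_on_cmult_left prime_sets_summable) (use q in simp)
  qed auto
  then have sum1: "(\<lambda>(P, k). F (P, l P * k)) summable_on prime_sets \<times> {0<..}"
    by (rule summable_on_bound(1)) (use F_bound in auto)
  define \<Omega> where "\<Omega> = (SIGMA c:{c. c > 0 \<and> N dvd c}. Pow (prime_factors c))"
  have bij: "bij_betw (\<lambda>(P, k). (l P * k, P)) (prime_sets \<times> {0<..}) \<Omega>"
  proof (rule bij_betw_byWitness[where f' = "\<lambda>(c, P). (P, c div l P)"])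
    show "\<forall>x\<in>prime_sets \<times> {0<..}. (\<lambda>(c, P). (P, c div l P)) ((\<lambda>(P, k). (l P * k, P)) x) = x"
      using l by auto
    have \<Omega>_iff: "(c, P) \<in> \<Omega> \<longleftrightarrow> c > 0 \<and> P \<in> prime_sets \<and> l P dvd c" for c P
      using subset_prime_factors_iff[of c P] by (auto simp: \<Omega>_def l_def)
    show "\<forall>x\<in>\<Omega>. (\<lambda>(P, k). (l P * k, P)) ((\<lambda>(c, P). (P, c div l P)) x) = x"
      using \<Omega>_iff by auto
    show "(\<lambda>(P, k). (l P * k, P)) ` (prime_sets \<times> {0<..}) \<subseteq> \<Omega>"
      using \<Omega>_iff l by auto
    show "(\<lambda>(c, P). (P, c div l P)) ` \<Omega> \<subseteq> prime_sets \<times> {0<..}"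
    proof (rule image_subsetI)
      fix x assume "x \<in> \<Omega>"
      moreover obtain c P where x: "x = (c, P)" by force
      ultimately have *: "c > 0" "P \<in> prime_sets" "l P dvd c" using \<Omega>_iff by auto
      then have "l P \<le> c" by (intro dvd_imp_le)
      then have "c div l P > 0" using l[OF *(2)] by (simp add: div_greater_zero_iff)
      then show "(\<lambda>(c, P). (P, c div l P)) x \<in> prime_sets \<times> {0<..}"
        using * x by simp
    qed
  qed
  have sum2: "(\<lambda>(c, P). F (P, c)) summable_on \<Omega>"
    using sum1 summable_on_reindex_bij_betw[OF bij, of "\<lambda>(c, P). F (P, c)"]
    by (simp add: case_prod_unfold)
  have "level_factor N s * (\<Sum>\<^sub>\<infinity>k\<in>{0<..}. of_nat k * chi s k) =
      (\<Sum>\<^sub>\<infinity>P\<in>prime_sets. \<Sum>\<^sub>\<infinity>k\<in>{0<..}. F (P, l P * k))"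
    unfolding level_factor_def
  proof (subst infsum_cmult_left'[symmetric], intro infsum_cong)
    fix P
    show "(-1) ^ card P / of_nat (\<Prod>P) * (of_nat (lcm N (\<Prod>P)) * chi s (lcm N (\<Prod>P))) *
        (\<Sum>\<^sub>\<infinity>k\<in>{0<..}. of_nat k * chi s k) = (\<Sum>\<^sub>\<infinity>k\<in>{0<..}. F (P, l P * k))"
      unfolding infsum_cmult_right'[symmetric]
      by (simp add: F_def \<epsilon>_def l_def chi_mult mult_ac)
  qed
  also have "\<dots> = (\<Sum>\<^sub>\<infinity>x\<in>prime_sets \<times> {0<..}. (\<lambda>(P, k). F (P, l P * k)) x)"
    using infsum_Sigma_banach[OF sum1] by simp
  also have "\<dots> = (\<Sum>\<^sub>\<infinity>x\<in>\<Omega>. (\<lambda>(c, P). F (P, c)) x)"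
    using infsum_reindex_bij_betw[OF bij, of "\<lambda>(c, P). F (P, c)"] by (simp add: case_prod_unfold)
  also have "\<dots> = (\<Sum>\<^sub>\<infinity>c\<in>{c. c > 0 \<and> N dvd c}. \<Sum>\<^sub>\<infinity>P\<in>Pow (prime_factors c). F (P, c))"
    using infsum_Sigma_banach[OF sum2[unfolded \<Omega>_def]] by (simp add: \<Omega>_def)
  also have "\<dots> = (\<Sum>\<^sub>\<infinity>c\<in>{c. c > 0 \<and> N dvd c}. of_nat (totient c) * chi s c)"
    by (intro infsum_cong) (simp add: totient_as_sum F_def \<epsilon>_def sum_distrib_left sum_distrib_right mult_ac)
  finally show ?thesis by simp
qed

section \<open>The Bruhat cell of matrices with positive lower left entry\<close>

lemma int_weight_product_has_sum:
  "((\<lambda>(m, n). int_weight m * int_weight n) has_sum (\<Sum>\<^sub>\<infinity>n. int_weight n)\<^sup>2) (UNIV \<times> UNIV)"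
proof (rule has_sum_SigmaI)
  let ?S = "\<Sum>\<^sub>\<infinity>n. int_weight n"
  show 1: "((\<lambda>n. case (m, n) of (m, n) \<Rightarrow> int_weight m * int_weight n) has_sum int_weight m * ?S) UNIV" for m
    unfolding prod.case by (intro has_sum_cmult_right has_sum_infsum int_weight_summable)
  show 2: "((\<lambda>m. int_weight m * ?S) has_sum ?S\<^sup>2) UNIV"
    unfolding power2_eq_square by (intro has_sum_cmult_left has_sum_infsum int_weight_summable)
  show "(\<lambda>(m, n). int_weight m * int_weight n) summable_on UNIV \<times> UNIV"
    by (rule summable_on_SigmaI[OF 1 has_sum_imp_summable[OF 2]]) auto
qed

text \<open>
  Matrix entries are meant by \<open>$\<close> from here on; the competing reading as a coefficient of a power series would
  make the terms below ambiguous.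
\<close>

no_notation fps_nth (infixl "$" 75)

definition level_moduli :: "nat \<Rightarrow> nat set" where
  "level_moduli N = {c. c > 0 \<and> N dvd c}"

type_synonym cell_index = "nat \<times> (int \<times> int) \<times> int \<times> int"

text \<open>
  An index is a modulus \<open>c\<close>, an inverse pair \<open>(\<alpha>, \<delta>)\<close> of residues, and the integers \<open>(m, n)\<close> with
  \<open>a = \<alpha> + c m\<close> and \<open>d = \<delta> + c n\<close>.
\<close>

definition cell_indices :: "nat \<Rightarrow> cell_index set" where
  "cell_indices N = (SIGMA c:level_moduli N. inv_pairs c \<times> (UNIV \<times> UNIV))"

lemma cell_indices_cases:
  assumes "x \<in> cell_indices N"
  obtains c \<alpha> \<delta> m n where "x = (c, (\<alpha>, \<delta>), (m, n))" "c > 0" "N dvd c" "(\<alpha>, \<delta>) \<in> inv_pairs c"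
proof -
  obtain c y t where 1: "x = (c, y, t)" by (cases x)
  obtain \<alpha> \<delta> where 2: "y = (\<alpha>, \<delta>)" by (cases y)
  obtain m n where 3: "t = (m, n)" by (cases t)
  show ?thesis
    using that[of c \<alpha> \<delta> m n] assms unfolding 1 2 3 by (simp add: cell_indices_def level_moduli_def)
qed

definition cell_matrix :: "cell_index \<Rightarrow> int^2^2" where
  "cell_matrix = (\<lambda>(c, (\<alpha>, \<delta>), (m, n)). let a = \<alpha> + int c * m; d = \<delta> + int c * n in
     vector [vector [a, (a * d - 1) div int c], vector [int c, d]])"

text \<open>
  There are \<open>\<phi>(c) \<le> c\<close> inverse pairs for each modulus, which accounts for the threshold \<open>2\<close>.
\<close>

lemma cell_majorant_summable:
  assumes "p > 2"
  shows "(\<lambda>(c, p', m, n). real c powr (- p) * (int_weight m * int_weight n)) summable_on cell_indices N"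
  unfolding cell_indices_def
proof (rule summable_on_SigmaI)
  let ?S = "\<Sum>\<^sub>\<infinity>n. int_weight n"
  fix c assume c: "c \<in> level_moduli N"
  have inner: "((\<lambda>x. case x of (p', m, n) \<Rightarrow> int_weight m * int_weight n) has_sum (\<Sum>p'\<in>inv_pairs c. ?S\<^sup>2))
      (inv_pairs c \<times> (UNIV \<times> UNIV))"
  proof (rule has_sum_SigmaI)
    show 1: "((\<lambda>y. case (p', y) of (p', m, n) \<Rightarrow> int_weight m * int_weight n) has_sum ?S\<^sup>2) (UNIV \<times> UNIV)" for p' :: "int \<times> int"
      using int_weight_product_has_sum by simp
    show 2: "((\<lambda>p'. ?S\<^sup>2) has_sum (\<Sum>p'\<in>inv_pairs c. ?S\<^sup>2)) (inv_pairs c)"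
      by (rule has_sum_finite) simp
    show "(\<lambda>(p', m, n). int_weight m * int_weight n) summable_on inv_pairs c \<times> UNIV \<times> UNIV"
      by (rule summable_on_SigmaI[OF 1 has_sum_imp_summable[OF 2]]) auto
  qed
  then show "((\<lambda>y. case (c, y) of (c, p', m, n) \<Rightarrow> real c powr (- p) * (int_weight m * int_weight n)) has_sum
      real c powr (- p) * (\<Sum>p'\<in>inv_pairs c. ?S\<^sup>2)) (inv_pairs c \<times> UNIV \<times> UNIV)"
    using has_sum_cmult_right[OF inner, of "real c powr (- p)"] by (simp add: case_prod_unfold)
next
  let ?S = "\<Sum>\<^sub>\<infinity>n. int_weight n"
  show "(\<lambda>c. real c powr (- p) * (\<Sum>p'\<in>inv_pairs c. ?S\<^sup>2)) summable_on level_moduli N"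
  proof (rule summable_on_bound(1))
    show "(\<lambda>c. real c powr (- (p - 1)) * ?S\<^sup>2) summable_on level_moduli N"
      by (intro summable_on_cmult_left summable_on_pos_nat_powr) (use assms in simp)
    fix c assume c: "c \<in> level_moduli N"
    then have c0: "c > 0" by (simp add: level_moduli_def)
    have "norm (real c powr (- p) * (\<Sum>p'\<in>inv_pairs c. ?S\<^sup>2)) = real c powr (- p) * real (totient c) * ?S\<^sup>2"
      using c0 by (simp add: card_inv_pairs)
    also have "\<dots> \<le> real c powr (- p) * real c powr 1 * ?S\<^sup>2"
      using totient_le[of c] c0 by (intro mult_right_mono mult_left_mono) auto
    also have "real c powr (- p) * real c powr 1 = real c powr (- (p - 1))"
      by (subst powr_add[symmetric]) simp
    finally show "norm (real c powr (- p) * (\<Sum>p'\<in>inv_pairs c. ?S\<^sup>2)) \<le> real c powr (- (p - 1)) * ?S\<^sup>2" .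
  qed
qed auto

lemma cell_matrix_entries:
  "cell_matrix (c, (\<alpha>, \<delta>), (m, n)) $ 1 $ 1 = \<alpha> + int c * m"
  "cell_matrix (c, (\<alpha>, \<delta>), (m, n)) $ 1 $ 2 = ((\<alpha> + int c * m) * (\<delta> + int c * n) - 1) div int c"
  "cell_matrix (c, (\<alpha>, \<delta>), (m, n)) $ 2 $ 1 = int c"
  "cell_matrix (c, (\<alpha>, \<delta>), (m, n)) $ 2 $ 2 = \<delta> + int c * n"
  by (simp_all add: cell_matrix_def Let_def)

lemma cell_corner:
  assumes "(\<alpha>, \<delta>) \<in> inv_pairs c"
  shows "int c * (((\<alpha> + int c * m) * (\<delta> + int c * n) - 1) div int c) = (\<alpha> + int c * m) * (\<delta> + int c * n) - 1"
proof -
  have "[(\<alpha> + int c * m) * (\<delta> + int c * n) = \<alpha> * \<delta>] (mod int c)"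
    by (intro cong_mult) (auto simp: cong_def)
  also have "[\<alpha> * \<delta> = 1] (mod int c)" using inv_pairsD(5)[OF assms] .
  finally have "int c dvd (\<alpha> + int c * m) * (\<delta> + int c * n) - 1"
    by (simp add: cong_iff_dvd_diff)
  then show ?thesis by simp
qed

definition cell_coordinates :: "int^2^2 \<Rightarrow> cell_index" where
  "cell_coordinates \<gamma> = (nat (\<gamma> $ 2 $ 1),
    (\<gamma> $ 1 $ 1 mod \<gamma> $ 2 $ 1, \<gamma> $ 2 $ 2 mod \<gamma> $ 2 $ 1), (\<gamma> $ 1 $ 1 div \<gamma> $ 2 $ 1, \<gamma> $ 2 $ 2 div \<gamma> $ 2 $ 1))"

lemma bij_cell_matrix:
  "bij_betw cell_matrix (cell_indices N) {\<gamma>\<in>Gamma0 N. \<gamma> $ 2 $ 1 > 0}"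
proof (rule bij_betw_byWitness[where f' = cell_coordinates], goal_cases)
  case 1
  show ?case
  proof
    fix x assume "x \<in> cell_indices N"
    then obtain c \<alpha> \<delta> m n where x: "x = (c, (\<alpha>, \<delta>), (m, n))" and c: "c > 0" "N dvd c"
      and p: "(\<alpha>, \<delta>) \<in> inv_pairs c" by (rule cell_indices_cases)
    show "cell_coordinates (cell_matrix x) = x"
      unfolding x cell_coordinates_def cell_matrix_entries using inv_pairsD(1-4)[OF p] c
      by (simp only: nat_int mod_mult_self2 div_mult_self2 mod_pos_pos_trivial div_pos_pos_trivial
          prod.inject of_nat_eq_0_iff) simp
  qed
next
  case 2
  show ?case
  proof
    fix \<gamma> :: "int^2^2" assume "\<gamma> \<in> {\<gamma> \<in> Gamma0 N. 0 < \<gamma> $ 2 $ 1}"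
    then have c: "\<gamma> $ 2 $ 1 > 0" and det: "\<gamma> $ 1 $ 1 * \<gamma> $ 2 $ 2 - \<gamma> $ 1 $ 2 * \<gamma> $ 2 $ 1 = 1"
      by (auto simp: Gamma0_def det_2)
    have "\<gamma> $ 1 $ 1 * \<gamma> $ 2 $ 2 - 1 = \<gamma> $ 1 $ 2 * \<gamma> $ 2 $ 1" using det by linarith
    then have "(\<gamma> $ 1 $ 1 * \<gamma> $ 2 $ 2 - 1) div \<gamma> $ 2 $ 1 = \<gamma> $ 1 $ 2"
      using c by simp
    then show "cell_matrix (cell_coordinates \<gamma>) = \<gamma>"
      using c by (simp add: cell_coordinates_def vec_eq_iff forall_2 cell_matrix_entries)
  qed
next
  case 3
  show ?case
  proof (rule image_subsetI)
    fix x assume "x \<in> cell_indices N"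
    then obtain c \<alpha> \<delta> m n where x: "x = (c, (\<alpha>, \<delta>), (m, n))" and c: "c > 0" "N dvd c"
      and p: "(\<alpha>, \<delta>) \<in> inv_pairs c" by (rule cell_indices_cases)
    define \<gamma> where "\<gamma> = cell_matrix x"
    have "int c * \<gamma> $ 1 $ 2 = \<gamma> $ 1 $ 1 * \<gamma> $ 2 $ 2 - 1" "\<gamma> $ 2 $ 1 = int c"
      unfolding \<gamma>_def x cell_matrix_entries by (rule cell_corner[OF p], rule refl)
    then have "\<gamma> \<in> {\<gamma> \<in> Gamma0 N. 0 < \<gamma> $ 2 $ 1}"
      using c by (simp add: Gamma0_def det_2 cong_0_iff mult.commute)
    then show "cell_matrix x \<in> {\<gamma> \<in> Gamma0 N. 0 < \<gamma> $ 2 $ 1}" by (simp add: \<gamma>_def)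
  qed
next
  case 4
  show ?case
  proof (rule image_subsetI)
    fix \<gamma> :: "int^2^2" assume g: "\<gamma> \<in> {\<gamma> \<in> Gamma0 N. 0 < \<gamma> $ 2 $ 1}"
    then have c: "\<gamma> $ 2 $ 1 > 0" and det: "\<gamma> $ 1 $ 1 * \<gamma> $ 2 $ 2 - \<gamma> $ 1 $ 2 * \<gamma> $ 2 $ 1 = 1"
      and N: "int N dvd \<gamma> $ 2 $ 1"
      by (auto simp: Gamma0_def det_2 cong_0_iff)
    have "\<gamma> $ 1 $ 1 * \<gamma> $ 2 $ 2 - 1 = \<gamma> $ 1 $ 2 * \<gamma> $ 2 $ 1" using det by linarith
    then have "[\<gamma> $ 1 $ 1 * \<gamma> $ 2 $ 2 = 1] (mod \<gamma> $ 2 $ 1)"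
      by (simp add: cong_iff_dvd_diff)
    then have "[(\<gamma> $ 1 $ 1 mod \<gamma> $ 2 $ 1) * (\<gamma> $ 2 $ 2 mod \<gamma> $ 2 $ 1) = 1] (mod \<gamma> $ 2 $ 1)"
      by (simp add: cong_def mod_mult_eq)
    then show "cell_coordinates \<gamma> \<in> cell_indices N"
      using c N by (auto simp: cell_coordinates_def cell_indices_def level_moduli_def inv_pairs_def nat_dvd_iff int_dvd_int_iff[symmetric] simp del: int_dvd_int_iff)
  qed
qed

definition cell_left :: "complex \<Rightarrow> cell_index \<Rightarrow> complex" where
  "cell_left z = (\<lambda>(c, (\<alpha>, \<delta>), (m, n)). of_real (real_of_int \<delta> / real c) + of_int n + z)"

definition cell_right :: "complex \<Rightarrow> cell_index \<Rightarrow> complex" where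
  "cell_right w = (\<lambda>(c, (\<alpha>, \<delta>), (m, n)). of_real (real_of_int \<alpha> / real c) + of_int m + w)"

definition cell_deviation :: "complex \<Rightarrow> complex \<Rightarrow> cell_index \<Rightarrow> complex" where
  "cell_deviation z w x = 1 - 1 / ((of_nat (fst x))\<^sup>2 * cell_left z x * cell_right w x)"

lemma cell_left_nonzero: "Im z \<noteq> 0 \<Longrightarrow> cell_left z x \<noteq> 0"
  by (auto simp: cell_left_def complex_eq_iff split: prod.splits)

lemma cell_right_nonzero: "Im w \<noteq> 0 \<Longrightarrow> cell_right w x \<noteq> 0"
  by (auto simp: cell_right_def complex_eq_iff split: prod.splits)

text \<open>
  Since \<open>b = (a d - 1)/c\<close>, the value of \<open>mu\<close> is \<open>c ((d/c + z)(a/c - w) - 1/c^2)\<close>.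
\<close>

lemma mu_cell_matrix:
  assumes "x \<in> cell_indices N" "Im z \<noteq> 0" "Im w \<noteq> 0"
  shows "mu (cell_matrix x) z (- w) = of_nat (fst x) * cell_left z x * cell_right (- w) x * cell_deviation z (- w) x"
proof -
  from assms(1) obtain c \<alpha> \<delta> m n where x: "x = (c, (\<alpha>, \<delta>), (m, n))" and c: "c > 0" "N dvd c"
    and p: "(\<alpha>, \<delta>) \<in> inv_pairs c" by (rule cell_indices_cases)
  define C X Y where "C = complex_of_nat c"
    and "X = complex_of_real (real_of_int \<delta> / real c) + of_int n"
    and "Y = complex_of_real (real_of_int \<alpha> / real c) + of_int m"
  have C: "C \<noteq> 0" using c by (simp add: C_def)
  define a d b where "a = \<alpha> + int c * m" and "d = \<delta> + int c * n" and "b = (a * d - 1) div int c"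
  have a: "of_int a = C * Y" and d: "of_int d = C * X"
    using c by (simp_all add: a_def d_def C_def X_def Y_def ring_distribs)
  have "int c * b = a * d - 1"
    unfolding b_def a_def d_def by (rule cell_corner[OF p])
  then have "complex_of_int (int c * b) = of_int (a * d - 1)" by (rule arg_cong)
  then have b: "of_int b = (C * Y * (C * X) - 1) / C"
    using C by (simp add: a d field_simps) (simp add: C_def mult_ac)
  have l: "X + z \<noteq> 0" and r: "Y - w \<noteq> 0"
    using cell_left_nonzero[OF assms(2), of x] cell_right_nonzero[of "- w" x] assms(3)
    by (simp_all add: x cell_left_def cell_right_def X_def Y_def)
  have "mu (cell_matrix x) z (- w) = C * z * (- w) + (C * X) * (- w) + (C * Y) * z + (C * Y * (C * X) - 1) / C"
    unfolding mu_def x cell_matrix_entries a_def[symmetric] d_def[symmetric] b_def[symmetric] a b d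
    by (simp add: C_def)
  also have "\<dots> = C * (X + z) * (Y - w) * (1 - 1 / (C\<^sup>2 * (X + z) * (Y - w)))"
  proof -
    have "C * (X + z) * (Y - w) * (1 - 1 / (C\<^sup>2 * (X + z) * (Y - w))) = C * (X + z) * (Y - w) - 1 / C"
    proof -
      have "C * V * W * (1 - 1 / (C\<^sup>2 * V * W)) = C * V * W - 1 / C" if "V \<noteq> 0" "W \<noteq> 0" for V W
        using C that by (simp add: field_simps power2_eq_square)
      then show ?thesis using l r by blast
    qed
    also have "\<dots> = C * z * (- w) + (C * X) * (- w) + (C * Y) * z + (C * Y * (C * X) - 1) / C"
      using C by (simp add: field_simps)
    finally show ?thesis by simp
  qed
  finally show ?thesis by (simp add: x cell_left_def cell_right_def cell_deviation_def C_def X_def Y_def)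
qed

text \<open>
  The order of magnitude of \<open>c^2 |d/c + z| |a/c - w|\<close>.
\<close>

definition cell_size :: "cell_index \<Rightarrow> real" where
  "cell_size = (\<lambda>(c, p, m, n). (real c)\<^sup>2 * ((1 + \<bar>of_int n\<bar>) * (1 + \<bar>of_int m\<bar>)))"

lemma inv_pairs_unit_interval:
  assumes "(\<alpha>, \<delta>) \<in> inv_pairs c"
  shows "real_of_int \<alpha> / real c \<in> {0..1}" "real_of_int \<delta> / real c \<in> {0..1}"
proof -
  note p = inv_pairsD[OF assms]
  have "real_of_int \<alpha> \<le> real c" "real_of_int \<delta> \<le> real c" using p(2,4) by linarith+
  moreover have "0 \<le> real_of_int \<alpha>" "0 \<le> real_of_int \<delta>" using p by simp_all
  ultimately show "real_of_int \<alpha> / real c \<in> {0..1}" "real_of_int \<delta> / real c \<in> {0..1}"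
    using p(1,2) by (simp_all add: divide_le_eq_1)
qed

lemma cell_deviation_close:
  assumes "Im z \<noteq> 0" "Im w \<noteq> 0"
  shows "\<exists>D>0. \<forall>x\<in>cell_indices N. norm (cell_deviation z w x - 1) \<le> D / cell_size x"
proof -
  from nonreal_translate_bound[OF assms(1)] obtain k where k: "0 < k"
    "\<And>x n. 0 \<le> x \<Longrightarrow> x \<le> 1 \<Longrightarrow> k * (1 + \<bar>of_int n\<bar>) \<le> norm (of_real x + of_int n + z)" by blast
  from nonreal_translate_bound[OF assms(2)] obtain l where l: "0 < l"
    "\<And>x n. 0 \<le> x \<Longrightarrow> x \<le> 1 \<Longrightarrow> l * (1 + \<bar>of_int n\<bar>) \<le> norm (of_real x + of_int n + w)" by blast
  have "norm (cell_deviation z w x - 1) \<le> (1 / (k * l)) / cell_size x" if "x \<in> cell_indices N" for x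
  proof -
    from that obtain c \<alpha> \<delta> m n where x: "x = (c, (\<alpha>, \<delta>), (m, n))" and c: "c > 0" "N dvd c"
      and p: "(\<alpha>, \<delta>) \<in> inv_pairs c" by (rule cell_indices_cases)
    note i = inv_pairs_unit_interval[OF p]
    define A B where "A = k * (1 + \<bar>of_int n\<bar>)" and "B = l * (1 + \<bar>of_int m\<bar>)"
    have A: "A > 0" "A \<le> norm (cell_left z x)"
      using k(1) k(2)[of "real_of_int \<delta> / real c" n] i by (simp_all add: A_def x cell_left_def)
    have B: "B > 0" "B \<le> norm (cell_right w x)"
      using l(1) l(2)[of "real_of_int \<alpha> / real c" m] i by (simp_all add: B_def x cell_right_def)
    have "norm (cell_deviation z w x - 1) = 1 / ((real c)\<^sup>2 * (norm (cell_left z x) * norm (cell_right w x)))"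
      by (simp add: cell_deviation_def x norm_divide norm_mult norm_power mult_ac)
    also have "\<dots> \<le> 1 / ((real c)\<^sup>2 * (A * B))"
      by (intro frac_le mult_left_mono mult_mono mult_pos_pos) (use A B c in auto)
    also have "\<dots> = (1 / (k * l)) / cell_size x"
      by (simp add: A_def B_def x cell_size_def mult_ac)
    finally show ?thesis .
  qed
  moreover have "1 / (k * l) > 0" using k l by simp
  ultimately show ?thesis by blast
qed

lemma cell_size_ge:
  assumes "x \<in> cell_indices N" "x = (c, p, m, n)"
  shows "cell_size x \<ge> (real c)\<^sup>2" "cell_size x \<ge> real c" "cell_size x \<ge> \<bar>of_int m\<bar>" "cell_size x \<ge> \<bar>of_int n\<bar>" "cell_size x > 0"
proof -
  have c: "c > 0" using assms by (auto simp: cell_indices_def level_moduli_def)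
  define M K where "M = 1 + \<bar>real_of_int m\<bar>" and "K = 1 + \<bar>real_of_int n\<bar>"
  have MK: "M \<ge> 1" "K \<ge> 1" "M \<ge> \<bar>of_int m\<bar>" "K \<ge> \<bar>of_int n\<bar>" by (auto simp: M_def K_def)
  have e: "cell_size x = (real c)\<^sup>2 * (K * M)" by (simp add: assms(2) cell_size_def M_def K_def)
  have c2: "(real c)\<^sup>2 \<ge> 1" "(real c)\<^sup>2 \<ge> real c" using c by (auto simp: self_le_power)
  have KM: "K * M \<ge> K" "K * M \<ge> M" using MK by (simp_all add: mult_left_le_one_le mult_le_cancel_left1 mult_le_cancel_right1)
  then have KM1: "K * M \<ge> 1" using MK by linarith
  have "(real c)\<^sup>2 * (K * M) \<ge> (real c)\<^sup>2 * 1" using KM1 c2 by (intro mult_left_mono) auto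
  then show 1: "cell_size x \<ge> (real c)\<^sup>2" using e by simp
  then show "cell_size x \<ge> real c" using c2 by linarith
  have "(real c)\<^sup>2 * (K * M) \<ge> 1 * (K * M)" using KM1 c2 by (intro mult_right_mono) auto
  then have "cell_size x \<ge> K * M" using e by simp
  then show "cell_size x \<ge> \<bar>of_int m\<bar>" "cell_size x \<ge> \<bar>of_int n\<bar>" using KM MK by linarith+
  show "cell_size x > 0" using 1 c2 by linarith
qed

text \<open>
  The deviation is within \<open>1/2\<close> of \<open>1\<close> outside a finite set of indices, so its values, none of which is
  \<open>0\<close>, stay away from \<open>0\<close>. Nonvanishing is where the orbit condition on \<open>z2\<close> enters.
\<close>

lemma psi_cell_deviation_bound:
  assumes "Im z \<noteq> 0" "Im w \<noteq> 0" "R > 0" and nz: "\<And>x. x \<in> cell_indices N \<Longrightarrow> cell_deviation z w x \<noteq> 0"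
  shows "\<exists>C>0. \<forall>s\<in>cap R. \<forall>x\<in>cell_indices N. norm (psi s (cell_deviation z w x) - 1) \<le> C / (real (fst x))\<^sup>2"
proof -
  obtain D where D: "D > 0" "\<And>x. x \<in> cell_indices N \<Longrightarrow> norm (cell_deviation z w x - 1) \<le> D / cell_size x"
    using cell_deviation_close[OF assms(1,2)] by blast
  define S where "S = {x \<in> cell_indices N. norm (cell_deviation z w x) < 1/2}"
  define B where "B = nat \<lceil>2 * D\<rceil>"
  have BD: "2 * D \<le> real B" unfolding B_def by linarith
  have "S \<subseteq> (SIGMA c:{..B}. inv_pairs c \<times> ({- int B..int B} \<times> {- int B..int B}))"
  proof
    fix x assume x: "x \<in> S"
    then have xi: "x \<in> cell_indices N" by (simp add: S_def)
    from xi obtain c \<alpha> \<delta> m n where xe: "x = (c, (\<alpha>, \<delta>), (m, n))" and c: "c > 0" "N dvd c"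
      and p: "(\<alpha>, \<delta>) \<in> inv_pairs c" by (rule cell_indices_cases)
    note g = cell_size_ge[OF xi xe]
    have "1/2 < norm (cell_deviation z w x - 1)"
      using x norm_triangle_ineq2[of 1 "1 - cell_deviation z w x"] by (simp add: S_def norm_minus_commute)
    also have "\<dots> \<le> D / cell_size x" by (rule D) fact
    finally have "cell_size x < 2 * D" using g(5) by (simp add: field_simps)
    then have "real c \<le> real B" "\<bar>real_of_int m\<bar> \<le> real B" "\<bar>real_of_int n\<bar> \<le> real B"
      using g BD by linarith+
    then have "c \<le> B" "\<bar>m\<bar> \<le> int B" "\<bar>n\<bar> \<le> int B" by linarith+
    then show "x \<in> (SIGMA c:{..B}. inv_pairs c \<times> ({- int B..int B} \<times> {- int B..int B}))"
      using p by (auto simp: xe)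
  qed
  then have "finite S" by (rule finite_subset) (intro finite_SigmaI; simp)
  define \<kappa> where "\<kappa> = Min (insert (1/2) ((\<lambda>x. norm (cell_deviation z w x)) ` S))"
  have "\<kappa> \<in> insert (1/2) ((\<lambda>x. norm (cell_deviation z w x)) ` S)"
    unfolding \<kappa>_def using \<open>finite S\<close> by (intro Min_in) auto
  then have \<kappa>0: "\<kappa> > 0" using nz by (auto simp: S_def)
  have \<kappa>1: "\<kappa> \<le> 1/2" unfolding \<kappa>_def using \<open>finite S\<close> by (intro Min_le) auto
  have \<kappa>2: "\<kappa> \<le> norm (cell_deviation z w x)" if "x \<in> cell_indices N" for x
  proof (cases "x \<in> S")
    case True
    then show ?thesis unfolding \<kappa>_def using \<open>finite S\<close> by (intro Min_le) auto
  next
    case False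
    then show ?thesis using that \<kappa>1 by (simp add: S_def)
  qed
  have "0 < 1 + D" "\<kappa> \<le> 1" using D \<kappa>1 by auto
  then obtain C where C: "C > 0" "\<And>s u. norm s \<le> R \<Longrightarrow> \<kappa> \<le> norm u \<Longrightarrow> norm u \<le> 1 + D \<Longrightarrow>
           norm (psi s u - 1) \<le> C * norm (u - 1)"
    using psi_lipschitz_at_1[of \<kappa> R "1 + D"] \<kappa>0 assms(3) by blast
  have "norm (psi s (cell_deviation z w x) - 1) \<le> (C * D) / (real (fst x))\<^sup>2"
    if s: "s \<in> cap R" and x: "x \<in> cell_indices N" for s x
  proof -
    obtain c p m n where xe: "x = (c, p, m, n)" by (metis prod_cases4)
    note g = cell_size_ge[OF x xe]
    have c: "c > 0" using x by (auto simp: xe cell_indices_def level_moduli_def)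
    have "D / cell_size x \<le> D / (real c)\<^sup>2"
      using g D(1) c by (intro divide_left_mono mult_pos_pos) auto
    then have d: "norm (cell_deviation z w x - 1) \<le> D / (real c)\<^sup>2" using D(2)[OF x] by linarith
    also have "D / (real c)\<^sup>2 \<le> D / 1" using D(1) c by (intro divide_left_mono) auto
    finally have "norm (cell_deviation z w x) \<le> 1 + D"
      using norm_triangle_ineq[of 1 "cell_deviation z w x - 1"] by simp
    then have "norm (psi s (cell_deviation z w x) - 1) \<le> C * norm (cell_deviation z w x - 1)"
      using capD(2)[OF s] by (intro C(2) \<kappa>2 x) auto
    also have "\<dots> \<le> C * (D / (real c)\<^sup>2)" using d C(1) by (intro mult_left_mono) auto
    finally show ?thesis by (simp add: xe)
  qed
  moreover have "C * D > 0" using C D by simp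
  ultimately show ?thesis by blast
qed

text \<open>
  The term with \<open>1/c^2\<close> dropped from \<open>mu\<close>: a function of \<open>c\<close> times one of \<open>d/c\<close> times one of
  \<open>a/c\<close>.
\<close>

definition cell_main :: "complex \<Rightarrow> complex \<Rightarrow> complex \<Rightarrow> cell_index \<Rightarrow> complex" where
  "cell_main z1 z2 s = (\<lambda>(c, (\<alpha>, \<delta>), (m, n)). chi s c *
     (lattice_term s z1 z1 (real_of_int \<delta> / real c) n *
      lattice_term s (- z2) (- cnj z2) (real_of_int \<alpha> / real c) m))"

definition cell_correction :: "complex \<Rightarrow> complex \<Rightarrow> complex \<Rightarrow> cell_index \<Rightarrow> complex" where
  "cell_correction z1 z2 s x = psi s (cell_deviation z1 (- z2) x) * psi s (cell_deviation z1 (- cnj z2) x) - 1"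

lemma Xi_term_cell_matrix:
  assumes "x \<in> cell_indices N" "Im z1 \<noteq> 0" "Im z2 \<noteq> 0"
  shows "Xi_term z1 z2 s (cell_matrix x) = cell_main z1 z2 s x + cell_main z1 z2 s x * cell_correction z1 z2 s x"
proof -
  from assms(1) obtain c \<alpha> \<delta> m n where x: "x = (c, (\<alpha>, \<delta>), (m, n))" and c: "c > 0" "N dvd c"
    and p: "(\<alpha>, \<delta>) \<in> inv_pairs c" by (rule cell_indices_cases)
  have 2: "Im (cnj z2) \<noteq> 0" using assms by simp
  have m: "cell_main z1 z2 s x = psi s (of_nat c) * psi s (of_nat c) * (psi s (cell_left z1 x) * psi s (cell_left z1 x)) *
      (psi s (cell_right (- z2) x) * psi s (cell_right (- cnj z2) x))"
    by (simp add: x cell_main_def chi_def lattice_term_def cell_left_def cell_right_def power2_eq_square)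
  show ?thesis
    unfolding Xi_term_eq_psi mu_cell_matrix[OF assms] mu_cell_matrix[OF assms(1,2) 2] psi_mult cell_correction_def m
    by (simp add: x algebra_simps)
qed

lemma cell_main_bound:
  assumes "Im z1 \<noteq> 0" "Im z2 \<noteq> 0"
  shows "\<exists>C>0. \<forall>s\<in>cap R. \<forall>(c, p, m, n)\<in>cell_indices N. norm (cell_main z1 z2 s (c, p, m, n)) \<le>
           C * (real c powr (2 - 4 * Re s) * (int_weight m * int_weight n))"
proof -
  obtain A where A: "A > 0" "\<And>s x n. s \<in> cap R \<Longrightarrow> x \<in> {0..1} \<Longrightarrow> norm (lattice_term s z1 z1 x n) \<le> A * int_weight n"
    using lattice_term_bound[OF assms(1,1), of R] by auto
  obtain B where B: "B > 0" "\<And>s x n. s \<in> cap R \<Longrightarrow> x \<in> {0..1} \<Longrightarrow> norm (lattice_term s (- z2) (- cnj z2) x n) \<le> B * int_weight n"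
    using lattice_term_bound[of "- z2" "- cnj z2" R] assms(2) by auto
  have "norm (cell_main z1 z2 s x) \<le> A * B * (real (fst x) powr (2 - 4 * Re s) * (int_weight (fst (snd (snd x))) * int_weight (snd (snd (snd x)))))"
    if s: "s \<in> cap R" and x: "x \<in> cell_indices N" for s x
  proof -
    from x obtain c \<alpha> \<delta> m n where xe: "x = (c, (\<alpha>, \<delta>), (m, n))" and c: "c > 0" "N dvd c"
      and p: "(\<alpha>, \<delta>) \<in> inv_pairs c" by (rule cell_indices_cases)
    note i = inv_pairs_unit_interval[OF p]
    have "norm (cell_main z1 z2 s x) = real c powr (2 - 4 * Re s) *
       (norm (lattice_term s z1 z1 (real_of_int \<delta> / real c) n) * norm (lattice_term s (- z2) (- cnj z2) (real_of_int \<alpha> / real c) m))"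
      by (simp add: xe cell_main_def norm_mult norm_chi)
    also have "\<dots> \<le> real c powr (2 - 4 * Re s) * ((A * int_weight n) * (B * int_weight m))"
      using A(1) B(1) by (intro mult_left_mono mult_mono A(2) B(2) s i) auto
    finally show ?thesis by (simp add: xe mult_ac)
  qed
  moreover have "A * B > 0" using A B by simp
  ultimately show ?thesis by (intro exI[of _ "A * B"]) fastforce
qed

section \<open>The cell of upper triangular matrices\<close>

text \<open>
  The base point may be real here, so the lower bound comes from the finitely many integers near it.
\<close>

lemma int_translate_bound:
  fixes z :: complex
  assumes "\<And>n. of_int n + z \<noteq> 0"
  shows "\<exists>k. 0 < k \<and> k \<le> 1 \<and> (\<forall>n. k * (1 + \<bar>of_int n\<bar>) \<le> norm (of_int n + z))"
proof -
  define B where "B = \<lceil>norm z\<rceil> + 1"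
  define \<delta> where "\<delta> = Min (insert 1 ((\<lambda>n. norm (of_int n + z)) ` {- B..B}))"
  have "\<delta> \<in> insert 1 ((\<lambda>n. norm (of_int n + z)) ` {- B..B})"
    unfolding \<delta>_def by (intro Min_in) auto
  then have \<delta>: "\<delta> > 0" using assms by auto
  have ge: "\<delta> \<le> norm (of_int n + z)" for n
  proof (cases "n \<in> {- B..B}")
    case True
    then show ?thesis unfolding \<delta>_def by (intro Min_le) auto
  next
    case False
    then have "\<bar>n\<bar> \<ge> B + 1" by auto
    then have "\<bar>real_of_int n\<bar> \<ge> norm z + 1" unfolding B_def by linarith
    moreover have "\<bar>real_of_int n\<bar> \<le> norm (of_int n + z) + norm z"
      using norm_triangle_ineq4[of "of_int n + z" z] by (simp add: norm_of_int)
    moreover have "\<delta> \<le> 1" unfolding \<delta>_def by (intro Min_le) auto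
    ultimately show ?thesis by linarith
  qed
  show ?thesis
  proof (intro exI conjI allI)
    let ?k = "min (1/4) (\<delta> / (3 + 2 * norm z))"
    show "0 < ?k" using \<delta> by (simp add: add_pos_nonneg)
    show "?k \<le> 1" by linarith
    fix n
    show "?k * (1 + \<bar>of_int n\<bar>) \<le> norm (of_int n + z)"
      using norm_translate_ge[OF \<delta>, of 0 n z] ge[of n] by simp
  qed
qed

text \<open>
  The matrices with lower left entry \<open>0\<close>: their diagonal is \<open>(e, e)\<close> with \<open>e = 1\<close> or \<open>e = -1\<close>.
\<close>

definition border_matrix :: "int \<times> int \<Rightarrow> int^2^2" where
  "border_matrix = (\<lambda>(e, b). vector [vector [e, b], vector [0, e]])"

lemma bij_border_matrix:
  "bij_betw border_matrix ({1, -1} \<times> UNIV) {\<gamma>\<in>Gamma0 N. \<gamma> $ 2 $ 1 = 0}"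
proof (rule bij_betw_byWitness[where f' = "\<lambda>\<gamma>. (\<gamma> $ 1 $ 1, \<gamma> $ 1 $ 2)"], goal_cases)
  case 1
  show ?case by (auto simp: border_matrix_def)
next
  case 2
  show ?case
  proof
    fix \<gamma> :: "int^2^2" assume "\<gamma> \<in> {\<gamma>\<in>Gamma0 N. \<gamma> $ 2 $ 1 = 0}"
    then have c: "\<gamma> $ 2 $ 1 = 0" and "\<gamma> $ 1 $ 1 * \<gamma> $ 2 $ 2 = 1"
      by (auto simp: Gamma0_def det_2)
    then have "\<gamma> $ 2 $ 2 = \<gamma> $ 1 $ 1" by (auto simp: zmult_eq_1_iff)
    then show "border_matrix (\<gamma> $ 1 $ 1, \<gamma> $ 1 $ 2) = \<gamma>"
      using c by (simp add: border_matrix_def vec_eq_iff forall_2)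
  qed
next
  case 3
  show ?case by (auto simp: border_matrix_def Gamma0_def det_2)
next
  case 4
  show ?case by (auto simp: Gamma0_def det_2 zmult_eq_1_iff)
qed

lemma psi_minus: "psi s (- v) = psi s (- 1) * psi s v"
  using psi_mult[of s "- 1" v] by simp

lemma psi_minus_1_square: "psi s (- 1) * psi s (- 1) = 1"
  using psi_mult[of s "- 1" "- 1"] by simp

text \<open>
  The term is even in \<open>mu\<close>, so the matrices with negative lower left entry repeat those with positive entry and
  cancel the factor \<open>1/2\<close> in front of the series.
\<close>

lemma Xi_term_uminus: "Xi_term z1 z2 s (- \<gamma>) = Xi_term z1 z2 s \<gamma>"
proof -
  have "mu (- \<gamma>) z1 w = - mu \<gamma> z1 w" for w by (simp add: mu_def algebra_simps)
  then have "Xi_term z1 z2 s (- \<gamma>) =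
      (psi s (- 1) * psi s (- 1)) * (psi s (mu \<gamma> z1 (- z2)) * psi s (mu \<gamma> z1 (- cnj z2)))"
    unfolding Xi_term_eq_psi using psi_minus[of s "mu \<gamma> z1 (- z2)"] psi_minus[of s "mu \<gamma> z1 (- cnj z2)"]
    by simp
  then show ?thesis by (simp add: psi_minus_1_square Xi_term_eq_psi)
qed

lemma bij_uminus_cell:
  "bij_betw uminus {\<gamma>\<in>Gamma0 N. \<gamma> $ 2 $ 1 > 0} {\<gamma>\<in>Gamma0 N. \<gamma> $ 2 $ 1 < 0}"
  by (rule bij_betw_byWitness[where f' = uminus])
     (auto simp: Gamma0_def det_2 cong_0_iff)

section \<open>The continuation\<close>

lemma infsum_product:
  fixes f g :: "int \<Rightarrow> complex"
  assumes "(\<lambda>(m, n). f n * g m) summable_on UNIV \<times> UNIV"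
  shows "(\<Sum>\<^sub>\<infinity>(m, n)\<in>UNIV \<times> UNIV. f n * g m) = infsum f UNIV * infsum g UNIV"
proof -
  have "(\<Sum>\<^sub>\<infinity>(m, n)\<in>UNIV \<times> UNIV. f n * g m) = (\<Sum>\<^sub>\<infinity>m. \<Sum>\<^sub>\<infinity>n. f n * g m)"
    using infsum_Sigma_banach[OF assms] by simp
  also have "\<dots> = infsum f UNIV * infsum g UNIV"
    unfolding infsum_cmult_left' infsum_cmult_right' ..
  finally show ?thesis .
qed

lemma dft_0_eq_riemann_avg: "dft c (\<lambda>b. f (real_of_int b / real c)) 0 = riemann_avg f c"
proof -
  have "(\<Sum>b\<in>{0..<int c}. f (real_of_int b / real c)) = (\<Sum>b<c. f (real b / real c))"
    by (rule sum.reindex_bij_witness[of _ int nat]) auto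
  then show ?thesis by (simp add: dft_def riemann_avg_def)
qed

locale level_pair =
  fixes N :: nat and z1 z2 :: complex
  assumes N: "N \<ge> 1"
    and z1: "z1 \<in> upper_half_plane" and z2: "z2 \<in> upper_half_plane"
    and off_orbit: "z2 \<notin> Gamma0_orbit N z1"
begin

lemma Im_nonzero: "Im z1 \<noteq> 0" "Im z2 \<noteq> 0" "Im (- z2) \<noteq> 0" "Im (cnj z2) \<noteq> 0" "Im (- cnj z2) \<noteq> 0"
  using z1 z2 by (auto simp: upper_half_plane_def)

lemmas mu_nonzero' = mu_nonzero[OF _ z1 z2 off_orbit]

lemma cell_deviation_nonzero:
  assumes "x \<in> cell_indices N"
  shows "cell_deviation z1 (- z2) x \<noteq> 0" "cell_deviation z1 (- cnj z2) x \<noteq> 0"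
proof -
  have "cell_matrix x \<in> Gamma0 N"
    using bij_betwE[OF bij_cell_matrix[of N]] assms by blast
  then show "cell_deviation z1 (- z2) x \<noteq> 0" "cell_deviation z1 (- cnj z2) x \<noteq> 0"
    using mu_nonzero'[of "cell_matrix x"] mu_cell_matrix[OF assms Im_nonzero(1,2)]
      mu_cell_matrix[OF assms Im_nonzero(1,4)] by auto
qed

text \<open>
  On upper triangular matrices \<open>mu\<close> is a translate by \<open>b\<close>, so this part of the series converges absolutely as far
  as a single translation orbit does, well beyond \<open>1\<close>.
\<close>

lemma border_term_bound:
  "\<exists>C>0. \<forall>s\<in>cap R. \<forall>(e, b)\<in>{1, -1} \<times> UNIV. norm (Xi_term z1 z2 s (border_matrix (e, b))) \<le> C * int_weight b"
proof -
  have mu: "mu (border_matrix (e, b)) z1 (- w) = of_int b + of_int e * (z1 - w)" for e b w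
    by (simp add: mu_def border_matrix_def algebra_simps)
  have nz: "of_int b + of_int e * (z1 - z2) \<noteq> 0" "of_int b + of_int e * (z1 - cnj z2) \<noteq> 0" if "e \<in> {1, -1}" for e b
  proof -
    have "border_matrix (e, b) \<in> Gamma0 N"
      using bij_betwE[OF bij_border_matrix[of N]] that by blast
    then show "of_int b + of_int e * (z1 - z2) \<noteq> 0" "of_int b + of_int e * (z1 - cnj z2) \<noteq> 0"
      using mu_nonzero'[of "border_matrix (e, b)"] by (simp_all add: mu)
  qed
  have one: "\<exists>C>0. \<forall>s\<in>cap R. \<forall>b. norm (Xi_term z1 z2 s (border_matrix (e, b))) \<le> C * int_weight b"
    if e: "e \<in> {1, -1}" for e
  proof -
    obtain k where k: "0 < k" "k \<le> 1" "\<And>b. k * (1 + \<bar>of_int b\<bar>) \<le> norm (of_int b + of_int e * (z1 - z2))"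
      using int_translate_bound[of "of_int e * (z1 - z2)"] nz(1)[OF e] by blast
    obtain l where l: "0 < l" "l \<le> 1" "\<And>b. l * (1 + \<bar>of_int b\<bar>) \<le> norm (of_int b + of_int e * (z1 - cnj z2))"
      using int_translate_bound[of "of_int e * (z1 - cnj z2)"] nz(2)[OF e] by blast
    define C where "C = k powr (1 - 2 * R) * l powr (1 - 2 * R)"
    have "norm (Xi_term z1 z2 s (border_matrix (e, b))) \<le> C * int_weight b" if s: "s \<in> cap R" for s b
    proof -
      let ?t = "1 + \<bar>real_of_int b\<bar>"
      have "norm (Xi_term z1 z2 s (border_matrix (e, b))) \<le>
         (k powr (1 - 2 * R) * ?t powr (- (15/16))) * (l powr (1 - 2 * R) * ?t powr (- (15/16)))"
        unfolding Xi_term_eq_psi mu norm_mult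
        by (intro mult_mono norm_psi_le[OF s]) (use k l in auto)
      then show ?thesis by (simp add: C_def int_weight_eq mult_ac)
    qed
    moreover have "C > 0" using k l by (simp add: C_def)
    ultimately show ?thesis by blast
  qed
  obtain C where C: "C > 0" "\<And>s b. s \<in> cap R \<Longrightarrow> norm (Xi_term z1 z2 s (border_matrix (1, b))) \<le> C * int_weight b"
    using one[of 1] by blast
  obtain D where D: "D > 0" "\<And>s b. s \<in> cap R \<Longrightarrow> norm (Xi_term z1 z2 s (border_matrix (- 1, b))) \<le> D * int_weight b"
    using one[of "- 1"] by blast
  have le: "C * int_weight b \<le> (C + D) * int_weight b" "D * int_weight b \<le> (C + D) * int_weight b" for b
    using C D by (auto intro!: mult_right_mono)
  have "norm (Xi_term z1 z2 s (border_matrix (e, b))) \<le> (C + D) * int_weight b"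
    if "s \<in> cap R" "e \<in> {1, -1}" for s e b
    using that C(2)[of s b] D(2)[of s b] le[of b] by auto
  moreover have "C + D > 0" using C D by simp
  ultimately show ?thesis by (intro exI[of _ "C + D"]) auto
qed

lemma border_majorant_summable:
  assumes "C > 0"
  shows "(\<lambda>(e, b). C * int_weight b) summable_on {1, -1 :: int} \<times> UNIV"
proof (rule summable_on_SigmaI)
  fix e :: int show "((\<lambda>b. case (e, b) of (e, b) \<Rightarrow> C * int_weight b) has_sum (\<Sum>\<^sub>\<infinity>b. C * int_weight b)) UNIV"
    unfolding prod.case by (intro has_sum_infsum summable_on_cmult_right int_weight_summable)
qed (use assms in auto)

lemma Xi_term_holomorphic:
  assumes "\<gamma> \<in> Gamma0 N"
  shows "(\<lambda>s. Xi_term z1 z2 s \<gamma>) holomorphic_on A"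
  unfolding Xi_term_eq_psi by (intro holomorphic_on_mult holomorphic_psi mu_nonzero' assms)

definition border_sum :: "complex \<Rightarrow> complex" where
  "border_sum s = (\<Sum>\<^sub>\<infinity>x\<in>{1, -1} \<times> UNIV. Xi_term z1 z2 s (border_matrix x))"

lemma border_sum_holomorphic: "border_sum holomorphic_on cap R"
proof -
  obtain C where C0: "C > 0" and C: "\<And>s e b. s \<in> cap R \<Longrightarrow> e \<in> {1, -1} \<Longrightarrow> norm (Xi_term z1 z2 s (border_matrix (e, b))) \<le> C * int_weight b"
    using border_term_bound[of R] by blast
  show ?thesis
    unfolding border_sum_def[abs_def]
  proof (rule holomorphic_infsum[OF open_cap _ _ border_majorant_summable[OF C0]])
    fix x :: "int \<times> int" assume "x \<in> {1, -1} \<times> UNIV"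
    then have "border_matrix x \<in> Gamma0 N" using bij_betwE[OF bij_border_matrix[of N]] by blast
    then show "(\<lambda>s. Xi_term z1 z2 s (border_matrix x)) holomorphic_on cap R"
      by (rule Xi_term_holomorphic)
  next
    fix s and x :: "int \<times> int" assume "s \<in> cap R" "x \<in> {1, -1} \<times> UNIV"
    then show "norm (Xi_term z1 z2 s (border_matrix x)) \<le> (case x of (e, b) \<Rightarrow> C * int_weight b)"
      using C by auto
  qed
qed

lemma cell_correction_bound:
  assumes "R > 0"
  shows "\<exists>C>0. \<forall>s\<in>cap R. \<forall>x\<in>cell_indices N. norm (cell_correction z1 z2 s x) \<le> C / (real (fst x))\<^sup>2"
proof -
  obtain A where A: "A > 0" "\<And>s x. s \<in> cap R \<Longrightarrow> x \<in> cell_indices N \<Longrightarrow>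
      norm (psi s (cell_deviation z1 (- z2) x) - 1) \<le> A / (real (fst x))\<^sup>2"
    using psi_cell_deviation_bound[OF Im_nonzero(1,3) assms cell_deviation_nonzero(1)] by blast
  obtain B where B: "B > 0" "\<And>s x. s \<in> cap R \<Longrightarrow> x \<in> cell_indices N \<Longrightarrow>
      norm (psi s (cell_deviation z1 (- cnj z2) x) - 1) \<le> B / (real (fst x))\<^sup>2"
    using psi_cell_deviation_bound[OF Im_nonzero(1,5) assms cell_deviation_nonzero(2)] by blast
  have "norm (cell_correction z1 z2 s x) \<le> (A * (1 + B) + B) / (real (fst x))\<^sup>2"
    if s: "s \<in> cap R" and x: "x \<in> cell_indices N" for s x
  proof -
    have c: "fst x > 0" using x by (auto simp: cell_indices_def level_moduli_def)
    then have "B / (real (fst x))\<^sup>2 \<le> B / 1" using B(1) by (intro divide_left_mono) auto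
    then have b: "norm (psi s (cell_deviation z1 (- cnj z2) x) - 1) \<le> B" using B(2)[OF s x] by simp
    have "norm (cell_correction z1 z2 s x) \<le> norm (psi s (cell_deviation z1 (- z2) x) - 1) *
        (1 + norm (psi s (cell_deviation z1 (- cnj z2) x) - 1)) + norm (psi s (cell_deviation z1 (- cnj z2) x) - 1)"
      unfolding cell_correction_def by (rule norm_mult_minus_1_le)
    also have "\<dots> \<le> (A / (real (fst x))\<^sup>2) * (1 + B) + B / (real (fst x))\<^sup>2"
      using b A(1) by (intro add_mono mult_mono A(2) B(2) s x) auto
    finally show ?thesis by (simp add: add_divide_distrib)
  qed
  moreover have "A * (1 + B) + B > 0" using A B by (simp add: add_pos_pos)
  ultimately show ?thesis by blast
qed

lemma cell_main_summable:
  assumes "Re s > 1"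
  shows "(\<lambda>x. norm (cell_main z1 z2 s x)) summable_on cell_indices N"
proof -
  have s: "s \<in> cap (norm s + 1)" using assms by (simp add: cap_def)
  obtain C where C: "C > 0" "\<And>c p m n. (c, p, m, n) \<in> cell_indices N \<Longrightarrow> norm (cell_main z1 z2 s (c, p, m, n)) \<le>
           C * (real c powr (2 - 4 * Re s) * (int_weight m * int_weight n))"
    using cell_main_bound[OF Im_nonzero(1,2), of "norm s + 1" N] s by blast
  show ?thesis
  proof (rule Infinite_Sum.abs_summable_on_comparison_test')
    show "(\<lambda>x. C * (\<lambda>(c, p, m, n). real c powr (- (4 * Re s - 2)) * (int_weight m * int_weight n)) x) summable_on cell_indices N"
      by (intro summable_on_cmult_right cell_majorant_summable) (use assms in simp)
  qed (use C in auto)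
qed

text \<open>
  The gain \<open>1/c^2\<close> makes \<open>4 Re s\<close> the exponent of \<open>1/c\<close>; in the half-plane it exceeds \<open>3\<close>,
  beyond the threshold \<open>2\<close> of \<open>cell_majorant_summable\<close>.
\<close>

lemma cell_correction_term_bound:
  assumes "R > 0"
  shows "\<exists>C>0. \<forall>s\<in>cap R. \<forall>(c, p, m, n)\<in>cell_indices N.
     norm (cell_main z1 z2 s (c, p, m, n) * cell_correction z1 z2 s (c, p, m, n)) \<le> C * (real c powr (- 3) * (int_weight m * int_weight n))"
proof -
  obtain A where A: "A > 0" "\<And>s c p m n. s \<in> cap R \<Longrightarrow> (c, p, m, n) \<in> cell_indices N \<Longrightarrow> norm (cell_main z1 z2 s (c, p, m, n)) \<le>
           A * (real c powr (2 - 4 * Re s) * (int_weight m * int_weight n))"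
    using cell_main_bound[OF Im_nonzero(1,2), of R N] by blast
  obtain B where B: "B > 0" "\<And>s x. s \<in> cap R \<Longrightarrow> x \<in> cell_indices N \<Longrightarrow> norm (cell_correction z1 z2 s x) \<le> B / (real (fst x))\<^sup>2"
    using cell_correction_bound[OF assms] by blast
  have "norm (cell_main z1 z2 s (c, p, m, n) * cell_correction z1 z2 s (c, p, m, n)) \<le> (A * B) * (real c powr (- 3) * (int_weight m * int_weight n))"
    if s: "s \<in> cap R" and x: "(c, p, m, n) \<in> cell_indices N" for s c p m n
  proof -
    have c: "c > 0" using x by (auto simp: cell_indices_def level_moduli_def)
    have "real c powr (2 - 4 * Re s) / (real c)\<^sup>2 = real c powr (2 - 4 * Re s - 2)"
      using c by (simp add: powr_diff powr_numeral powr_minus_divide)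
    also have "\<dots> \<le> real c powr (- 3)"
      using c capD[OF s] by (intro powr_mono) auto
    finally have pw: "real c powr (2 - 4 * Re s) / (real c)\<^sup>2 \<le> real c powr (- 3)" .
    have "norm (cell_main z1 z2 s (c, p, m, n) * cell_correction z1 z2 s (c, p, m, n)) \<le>
        (A * (real c powr (2 - 4 * Re s) * (int_weight m * int_weight n))) * (B / (real c)\<^sup>2)"
      unfolding norm_mult using B(2)[OF s x] A(1) by (intro mult_mono A(2) s x) auto
    also have "\<dots> = (A * B) * ((real c powr (2 - 4 * Re s) / (real c)\<^sup>2) * (int_weight m * int_weight n))"
      by simp
    also have "\<dots> \<le> (A * B) * (real c powr (- 3) * (int_weight m * int_weight n))"
      using A B pw by (intro mult_left_mono mult_right_mono) auto
    finally show ?thesis .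
  qed
  moreover have "A * B > 0" using A B by simp
  ultimately show ?thesis by (intro exI[of _ "A * B"]) auto
qed

definition correction_sum :: "complex \<Rightarrow> complex" where
  "correction_sum s = (\<Sum>\<^sub>\<infinity>x\<in>cell_indices N. cell_main z1 z2 s x * cell_correction z1 z2 s x)"

lemma cell_correction_term_majorant_summable:
  "(\<lambda>x. C * (\<lambda>(c, p, m, n). real c powr (- 3) * (int_weight m * int_weight n)) x) summable_on cell_indices N"
  by (intro summable_on_cmult_right cell_majorant_summable) simp

lemma correction_sum_holomorphic:
  assumes "R > 0"
  shows "correction_sum holomorphic_on cap R"
proof -
  obtain C where C: "\<And>s c p m n. s \<in> cap R \<Longrightarrow> (c, p, m, n) \<in> cell_indices N \<Longrightarrow>
     norm (cell_main z1 z2 s (c, p, m, n) * cell_correction z1 z2 s (c, p, m, n)) \<le> C * (real c powr (- 3) * (int_weight m * int_weight n))"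
    using cell_correction_term_bound[OF assms] by blast
  show ?thesis
    unfolding correction_sum_def[abs_def]
  proof (rule holomorphic_infsum[OF open_cap _ _ cell_correction_term_majorant_summable[of C]])
    fix x assume xi: "x \<in> cell_indices N"
    from xi obtain c \<alpha> \<delta> m n where x: "x = (c, (\<alpha>, \<delta>), (m, n))" and c: "c > 0" "N dvd c"
      and p: "(\<alpha>, \<delta>) \<in> inv_pairs c" by (rule cell_indices_cases)
    have "(\<lambda>s. cell_main z1 z2 s x) holomorphic_on cap R"
      unfolding x cell_main_def prod.case
      by (intro holomorphic_on_mult chi_holomorphic lattice_term_holomorphic Im_nonzero c)
    moreover have "(\<lambda>s. cell_correction z1 z2 s x) holomorphic_on cap R"
      unfolding cell_correction_def
      by (intro holomorphic_on_mult holomorphic_on_diff holomorphic_on_const holomorphic_psi cell_deviation_nonzero xi)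
    ultimately show "(\<lambda>s. cell_main z1 z2 s x * cell_correction z1 z2 s x) holomorphic_on cap R"
      by (rule holomorphic_on_mult)
  next
    fix s x assume "s \<in> cap R" "x \<in> cell_indices N"
    then show "norm (cell_main z1 z2 s x * cell_correction z1 z2 s x) \<le>
        C * (\<lambda>(c, p, m, n). real c powr (- 3) * (int_weight m * int_weight n)) x"
      using C by (cases x) auto
  qed
qed

lemma cell_correction_term_summable:
  assumes "Re s > 1"
  shows "(\<lambda>x. norm (cell_main z1 z2 s x * cell_correction z1 z2 s x)) summable_on cell_indices N"
proof -
  have s: "s \<in> cap (norm s + 1)" using assms by (simp add: cap_def)
  obtain C where C: "\<And>c p m n. (c, p, m, n) \<in> cell_indices N \<Longrightarrow>
     norm (cell_main z1 z2 s (c, p, m, n) * cell_correction z1 z2 s (c, p, m, n)) \<le> C * (real c powr (- 3) * (int_weight m * int_weight n))"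
    using cell_correction_term_bound[of "norm s + 1"] s norm_ge_zero[of s] by (metis (mono_tags, lifting) add_nonneg_pos case_prodD zero_less_one)
  show ?thesis
    by (rule Infinite_Sum.abs_summable_on_comparison_test'[OF cell_correction_term_majorant_summable[of C]]) (use C in auto)
qed

abbreviation per_left :: "complex \<Rightarrow> real \<Rightarrow> complex" where
  "per_left s \<equiv> periodization s z1 z1"

abbreviation per_right :: "complex \<Rightarrow> real \<Rightarrow> complex" where
  "per_right s \<equiv> periodization s (- z2) (- cnj z2)"

definition cell_sum :: "complex \<Rightarrow> nat \<Rightarrow> complex" where
  "cell_sum s c = (\<Sum>(\<alpha>, \<delta>)\<in>inv_pairs c. per_left s (real_of_int \<delta> / real c) * per_right s (real_of_int \<alpha> / real c))"

text \<open>
  For fixed \<open>c\<close> and fixed residues the sums over \<open>m\<close> and \<open>n\<close> separate into the two periodizations.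
\<close>

lemma infsum_cell_main:
  assumes "Re s > 1"
  shows "(\<Sum>\<^sub>\<infinity>x\<in>cell_indices N. cell_main z1 z2 s x) = (\<Sum>\<^sub>\<infinity>c\<in>level_moduli N. chi s c * cell_sum s c)"
    and "(\<lambda>c. chi s c * cell_sum s c) summable_on level_moduli N"
proof -
  have s: "s \<in> cap (norm s + 1)" using assms by (simp add: cap_def)
  have sm: "cell_main z1 z2 s summable_on (SIGMA c:level_moduli N. inv_pairs c \<times> (UNIV \<times> UNIV))"
    using abs_summable_summable[OF cell_main_summable[OF assms]] by (simp add: cell_indices_def)
  obtain A where A: "\<And>x n. x \<in> {0..1} \<Longrightarrow> norm (lattice_term s z1 z1 x n) \<le> A * int_weight n" "A > 0"
    using lattice_term_bound[OF Im_nonzero(1,1), of "norm s + 1"] s by blast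
  obtain B where B: "\<And>x n. x \<in> {0..1} \<Longrightarrow> norm (lattice_term s (- z2) (- cnj z2) x n) \<le> B * int_weight n" "B > 0"
    using lattice_term_bound[OF Im_nonzero(3,5), of "norm s + 1"] s by blast
  have inner: "(\<Sum>\<^sub>\<infinity>y\<in>inv_pairs c \<times> (UNIV \<times> UNIV). cell_main z1 z2 s (c, y)) = chi s c * cell_sum s c"
    if c: "c \<in> level_moduli N" for c
  proof -
    have "(\<lambda>y. cell_main z1 z2 s (c, y)) summable_on inv_pairs c \<times> (UNIV \<times> UNIV)"
      using sm c by (rule summable_on_SigmaD1[of "\<lambda>c y. cell_main z1 z2 s (c, y)", simplified case_prod_eta])
    then have "(\<Sum>\<^sub>\<infinity>y\<in>inv_pairs c \<times> (UNIV \<times> UNIV). cell_main z1 z2 s (c, y)) =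
        (\<Sum>p\<in>inv_pairs c. \<Sum>\<^sub>\<infinity>t\<in>UNIV \<times> UNIV. cell_main z1 z2 s (c, p, t))"
      using infsum_Sigma_banach[of "\<lambda>y. cell_main z1 z2 s (c, y)" "inv_pairs c" "\<lambda>_. UNIV \<times> UNIV"]
      by (simp del: UNIV_Times_UNIV)
    also have "\<dots> = (\<Sum>p\<in>inv_pairs c. chi s c * (case p of (\<alpha>, \<delta>) \<Rightarrow>
        per_left s (real_of_int \<delta> / real c) * per_right s (real_of_int \<alpha> / real c)))"
    proof (intro sum.cong refl)
      fix p assume "p \<in> inv_pairs c"
      moreover obtain \<alpha> \<delta> where p: "p = (\<alpha>, \<delta>)" by (cases p)
      ultimately have pi: "(\<alpha>, \<delta>) \<in> inv_pairs c" by simp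
      note i = inv_pairs_unit_interval[OF pi]
      let ?f = "lattice_term s z1 z1 (real_of_int \<delta> / real c)"
      let ?g = "lattice_term s (- z2) (- cnj z2) (real_of_int \<alpha> / real c)"
      have fg: "(\<lambda>(m, n). ?f n * ?g m) summable_on UNIV \<times> UNIV"
      proof (rule summable_on_bound(1)[OF summable_on_cmult_right[OF has_sum_imp_summable[OF int_weight_product_has_sum], of "A * B"]])
        fix x :: "int \<times> int"
        obtain m n where x: "x = (m, n)" by (cases x)
        have "norm (?f n * ?g m) \<le> (A * int_weight n) * (B * int_weight m)"
          unfolding norm_mult using A(2) B(2) by (intro mult_mono A(1) B(1) i) auto
        then show "norm (case x of (m, n) \<Rightarrow> ?f n * ?g m) \<le> A * B * (case x of (m, n) \<Rightarrow> int_weight m * int_weight n)"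
          by (simp add: x mult_ac)
      qed
      have "(\<Sum>\<^sub>\<infinity>t\<in>UNIV \<times> UNIV. cell_main z1 z2 s (c, p, t)) = (\<Sum>\<^sub>\<infinity>t\<in>UNIV \<times> UNIV. chi s c * (case t of (m, n) \<Rightarrow> ?f n * ?g m))"
        by (intro infsum_cong) (simp add: cell_main_def p split: prod.splits)
      also have "\<dots> = chi s c * (infsum ?f UNIV * infsum ?g UNIV)"
        unfolding infsum_cmult_right' infsum_product[OF fg, unfolded case_prod_unfold] case_prod_unfold ..
      finally show "(\<Sum>\<^sub>\<infinity>t\<in>UNIV \<times> UNIV. cell_main z1 z2 s (c, p, t)) = chi s c * (case p of (\<alpha>, \<delta>) \<Rightarrow>
        per_left s (real_of_int \<delta> / real c) * per_right s (real_of_int \<alpha> / real c))"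
        by (simp add: p periodization_def)
    qed
    also have "\<dots> = chi s c * cell_sum s c"
      by (simp add: cell_sum_def sum_distrib_left)
    finally show ?thesis .
  qed
  have "(\<Sum>\<^sub>\<infinity>x\<in>cell_indices N. cell_main z1 z2 s x) =
      (\<Sum>\<^sub>\<infinity>c\<in>level_moduli N. \<Sum>\<^sub>\<infinity>y\<in>inv_pairs c \<times> (UNIV \<times> UNIV). cell_main z1 z2 s (c, y))"
    unfolding cell_indices_def by (rule infsum_Sigma_banach[OF sm, symmetric])
  also have "\<dots> = (\<Sum>\<^sub>\<infinity>c\<in>level_moduli N. chi s c * cell_sum s c)"
    by (intro infsum_cong inner)
  finally show "(\<Sum>\<^sub>\<infinity>x\<in>cell_indices N. cell_main z1 z2 s x) = (\<Sum>\<^sub>\<infinity>c\<in>level_moduli N. chi s c * cell_sum s c)" .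
  have "(\<lambda>c. \<Sum>\<^sub>\<infinity>y\<in>inv_pairs c \<times> (UNIV \<times> UNIV). cell_main z1 z2 s (c, y)) summable_on level_moduli N"
    using summable_on_Sigma_banach[of "\<lambda>c y. cell_main z1 z2 s (c, y)"] sm by simp
  then show "(\<lambda>c. chi s c * cell_sum s c) summable_on level_moduli N"
    using inner by (simp cong: summable_on_cong)
qed

definition mean_left :: "complex \<Rightarrow> complex" where
  "mean_left s = circle_mean (per_left s)"

definition mean_right :: "complex \<Rightarrow> complex" where
  "mean_right s = circle_mean (per_right s)"

text \<open>
  The discrepancy of the inverse pairs modulo \<open>c\<close>.
\<close>

definition cell_error :: "complex \<Rightarrow> nat \<Rightarrow> complex" where
  "cell_error s c = cell_sum s c - of_nat (totient c) * mean_left s * mean_right s"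

text \<open>
  Equidistribution gives the averages over the points \<open>b/c\<close> in the main term; replacing them by the means costs
  \<open>O(1/c)\<close> for each of the \<open>\<phi>(c)\<close> pairs.
\<close>

lemma cell_error_bound:
  assumes "R > 0"
  shows "\<exists>C>0. \<forall>s\<in>cap R. \<forall>c>0. norm (cell_error s c) \<le> C * (real c powr (3/4) * real (divisor_count c))"
proof -
  obtain L where L0: "L > 0" and L': "\<forall>s\<in>cap R. \<forall>x\<in>{0..1}. norm (per_left s x) \<le> L \<and>
      (\<forall>y\<in>{0..1}. norm (per_left s y - per_left s x) \<le> L * \<bar>y - x\<bar>)"
    using periodization_bounds[OF Im_nonzero(1,1) assms] by (elim exE conjE)
  have L: "norm (per_left s x) \<le> L" "norm (per_left s y - per_left s x) \<le> L * \<bar>y - x\<bar>"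
    if "s \<in> cap R" "x \<in> {0..1}" "y \<in> {0..1}" for s x y
    using L' that by blast+
  obtain M where M0: "M > 0" and M': "\<forall>s\<in>cap R. \<forall>x\<in>{0..1}. norm (per_right s x) \<le> M \<and>
      (\<forall>y\<in>{0..1}. norm (per_right s y - per_right s x) \<le> M * \<bar>y - x\<bar>)"
    using periodization_bounds[OF Im_nonzero(3,5) assms] by (elim exE conjE)
  have M: "norm (per_right s x) \<le> M" "norm (per_right s y - per_right s x) \<le> M * \<bar>y - x\<bar>"
    if "s \<in> cap R" "x \<in> {0..1}" "y \<in> {0..1}" for s x y
    using M' that by blast+
  define D where "D = 2 * dft_const\<^sup>2 * L * M"
  have D: "D \<ge> 0" using L0 M0 by (simp add: D_def)
  have "norm (cell_error s c) \<le> (D + 3 * (L * M)) * (real c powr (3/4) * real (divisor_count c))"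
    if s: "s \<in> cap R" and c: "c > 0" for s c
  proof -
    let ?G = "\<lambda>b. per_left s (real_of_int b / real c)" and ?K = "\<lambda>b. per_right s (real_of_int b / real c)"
    have unit: "real_of_int b / real c \<in> {0..1}" "real_of_int (b + 1) / real c \<in> {0..1}" if "b \<in> {0..<int c}" for b
    proof -
      have "b + 1 \<le> int c" using that by simp
      then have "real_of_int (b + 1) \<le> real_of_int (int c)" by (simp only: of_int_le_iff)
      then have "real_of_int (b + 1) \<le> real c" by simp
      then show "real_of_int b / real c \<in> {0..1}" "real_of_int (b + 1) / real c \<in> {0..1}"
        using that c by (simp_all add: divide_le_eq_1)
    qed
    have shift: "real_of_int (b + int c) / real c = real_of_int b / real c + of_int 1" for b
      using c by (simp add: add_divide_distrib)
    have step: "\<bar>real_of_int (b + 1) / real c - real_of_int b / real c\<bar> = 1 / c" for b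
      using c by (simp add: add_divide_distrib)
    have eq: "norm ((\<Sum>(a, d)\<in>inv_pairs c. ?G d * ?K a) - of_nat (totient c) * dft c ?G 0 * dft c ?K 0)
           \<le> D * (real c powr (3/4) * real (divisor_count c))"
      unfolding D_def
    proof (rule inverse_pairs_equidistributed[OF c])
      show "?G (b + int c) = ?G b" "?K (b + int c) = ?K b" for b
        unfolding shift by (rule periodization_periodic)+
      fix b assume b: "b \<in> {0..<int c}"
      show "norm (?G b) \<le> L" "norm (?K b) \<le> M" by (rule L(1)[OF s unit(1)[OF b] unit(1)[OF b]], rule M(1)[OF s unit(1)[OF b] unit(1)[OF b]])
      show "norm (?G (b + 1) - ?G b) \<le> L / c" "norm (?K (b + 1) - ?K b) \<le> M / c"
        using L(2)[OF s unit[OF b]] M(2)[OF s unit[OF b]] unfolding step by simp_all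
    qed (use L0 M0 in auto)
    have G1: "norm (dft c ?G 0 - mean_left s) \<le> L / c"
      unfolding dft_0_eq_riemann_avg mean_left_def
      by (rule riemann_avg_close_to_mean) (use L(2)[OF s] L0 c in auto)
    have K1: "norm (dft c ?K 0 - mean_right s) \<le> M / c"
      unfolding dft_0_eq_riemann_avg mean_right_def
      by (rule riemann_avg_close_to_mean) (use M(2)[OF s] M0 c in auto)
    have avg: "norm (dft c f 0) \<le> B" if f: "\<And>b. b \<in> {0..<int c} \<Longrightarrow> norm (f b) \<le> B" for f :: "int \<Rightarrow> complex" and B
    proof -
      have "norm (\<Sum>b\<in>{0..<int c}. f b) \<le> (\<Sum>b\<in>{0..<int c}. B)"
        by (rule sum_norm_le) (rule f)
      then show ?thesis using c by (simp add: dft_def norm_divide field_simps)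
    qed
    have G2: "norm (dft c ?G 0) \<le> L" by (rule avg) (rule L(1)[OF s unit(1) unit(1)])
    have K2: "norm (dft c ?K 0) \<le> M" by (rule avg) (rule M(1)[OF s unit(1) unit(1)])
    have "norm (mean_right s) \<le> norm (dft c ?K 0) + norm (dft c ?K 0 - mean_right s)"
      using norm_triangle_ineq4[of "dft c ?K 0" "dft c ?K 0 - mean_right s"] by simp
    also have "\<dots> \<le> M + M / c" by (intro add_mono K1 K2)
    also have "M / c \<le> M / 1" using c M0 by (intro divide_left_mono) auto
    finally have J: "norm (mean_right s) \<le> 2 * M" by simp
    have "dft c ?G 0 * dft c ?K 0 - mean_left s * mean_right s =
        dft c ?G 0 * (dft c ?K 0 - mean_right s) + (dft c ?G 0 - mean_left s) * mean_right s"
      by (simp add: algebra_simps)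
    then have "norm (dft c ?G 0 * dft c ?K 0 - mean_left s * mean_right s) \<le>
        norm (dft c ?G 0) * norm (dft c ?K 0 - mean_right s) + norm (dft c ?G 0 - mean_left s) * norm (mean_right s)"
      using norm_triangle_ineq[of "dft c ?G 0 * (dft c ?K 0 - mean_right s)" "(dft c ?G 0 - mean_left s) * mean_right s"]
      by (simp add: norm_mult)
    also have "\<dots> \<le> L * (M / c) + (L / c) * (2 * M)"
      using L0 M0 by (intro add_mono mult_mono G1 G2 K1 J) auto
    also have "\<dots> = 3 * (L * M) / c" by (simp add: add_divide_distrib[symmetric])
    finally have diff: "norm (dft c ?G 0 * dft c ?K 0 - mean_left s * mean_right s) \<le> 3 * (L * M) / c" .
    have "norm (of_nat (totient c) * (dft c ?G 0 * dft c ?K 0 - mean_left s * mean_right s)) \<le>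
        real c * (3 * (L * M) / c)"
      unfolding norm_mult norm_of_nat using totient_le[of c] by (intro mult_mono diff) auto
    also have "\<dots> = 3 * (L * M) * 1" using c by simp
    also have "\<dots> \<le> 3 * (L * M) * (real c powr (3/4) * real (divisor_count c))"
    proof (rule mult_left_mono)
      have "1 * 1 \<le> real c powr (3/4) * real (divisor_count c)"
        using c divisor_count_pos[OF c] by (intro mult_mono ge_one_powr_ge_zero) auto
      then show "1 \<le> real c powr (3/4) * real (divisor_count c)" by simp
    qed (use L0 M0 in auto)
    finally have two: "norm (of_nat (totient c) * (dft c ?G 0 * dft c ?K 0 - mean_left s * mean_right s)) \<le>
        3 * (L * M) * (real c powr (3/4) * real (divisor_count c))" .
    have "cell_error s c = ((\<Sum>(a, d)\<in>inv_pairs c. ?G d * ?K a) - of_nat (totient c) * dft c ?G 0 * dft c ?K 0) +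
        of_nat (totient c) * (dft c ?G 0 * dft c ?K 0 - mean_left s * mean_right s)"
      by (simp add: cell_error_def cell_sum_def algebra_simps)
    then have "norm (cell_error s c) \<le> norm ((\<Sum>(a, d)\<in>inv_pairs c. ?G d * ?K a) - of_nat (totient c) * dft c ?G 0 * dft c ?K 0) +
        norm (of_nat (totient c) * (dft c ?G 0 * dft c ?K 0 - mean_left s * mean_right s))"
      by (simp only: norm_triangle_ineq)
    then show ?thesis using eq two by (simp add: distrib_right)
  qed
  moreover have "D + 3 * (L * M) > 0" using D L0 M0 by (simp add: add_nonneg_pos)
  ultimately show ?thesis by blast
qed

lemma mean_left_holomorphic: "R > 0 \<Longrightarrow> mean_left holomorphic_on cap R"
  unfolding mean_left_def[abs_def] by (rule periodization_mean_holomorphic[OF Im_nonzero(1,1)])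

lemma mean_right_holomorphic: "R > 0 \<Longrightarrow> mean_right holomorphic_on cap R"
  unfolding mean_right_def[abs_def] by (rule periodization_mean_holomorphic[OF Im_nonzero(3,5)])

lemma cell_error_holomorphic:
  assumes "R > 0"
  shows "(\<lambda>s. cell_error s c) holomorphic_on cap R"
proof -
  have "(\<lambda>s. per_left s (real_of_int (snd p) / real c) * per_right s (real_of_int (fst p) / real c)) holomorphic_on cap R"
    if "p \<in> inv_pairs c" for p
    using that inv_pairs_unit_interval[of "fst p" "snd p" c]
    by (intro holomorphic_on_mult periodization_holomorphic Im_nonzero) auto
  then have "(\<lambda>s. cell_sum s c) holomorphic_on cap R"
    unfolding cell_sum_def case_prod_unfold by (rule holomorphic_on_sum)
  moreover have "(\<lambda>s. of_nat (totient c) * mean_left s * mean_right s) holomorphic_on cap R"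
    by (intro holomorphic_on_mult holomorphic_on_const mean_left_holomorphic mean_right_holomorphic assms)
  ultimately show ?thesis unfolding cell_error_def by (rule holomorphic_on_diff)
qed

definition error_sum :: "complex \<Rightarrow> complex" where
  "error_sum s = (\<Sum>\<^sub>\<infinity>c\<in>level_moduli N. chi s c * cell_error s c)"

text \<open>
  The exponent \<open>9/8 = 15/8 - 3/4\<close> exceeds \<open>1\<close>: the saving over the trivial bound carries the series across
  \<open>Re s = 1\<close>.
\<close>

lemma cell_error_majorant:
  assumes "R > 0"
  shows "\<exists>C>0. \<forall>s\<in>cap R. \<forall>c\<in>level_moduli N. norm (chi s c * cell_error s c) \<le>
           C * (real (divisor_count c) * real c powr (- (9/8)))"
proof -
  obtain C where C: "C > 0" "\<And>s c. s \<in> cap R \<Longrightarrow> c > 0 \<Longrightarrow> norm (cell_error s c) \<le> C * (real c powr (3/4) * real (divisor_count c))"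
    using cell_error_bound[OF assms] by blast
  have "norm (chi s c * cell_error s c) \<le> C * (real (divisor_count c) * real c powr (- (9/8)))"
    if s: "s \<in> cap R" and c: "c \<in> level_moduli N" for s c
  proof -
    have c0: "c > 0" using c by (simp add: level_moduli_def)
    have "norm (chi s c * cell_error s c) \<le> real c powr (- (15/8)) * (C * (real c powr (3/4) * real (divisor_count c)))"
      unfolding norm_mult norm_chi using capD[OF s] c0 by (intro mult_mono powr_mono C(2) s) auto
    also have "\<dots> = C * (real (divisor_count c) * (real c powr (- (15/8)) * real c powr (3/4)))" by simp
    also have "real c powr (- (15/8)) * real c powr (3/4) = real c powr (- (9/8))"
      by (subst powr_add[symmetric]) simp
    finally show ?thesis .
  qed
  then show ?thesis using C(1) by blast
qed

lemma error_majorant_summable: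
  "(\<lambda>c. C * (real (divisor_count c) * real c powr (- (9/8)))) summable_on level_moduli N"
  by (intro summable_on_cmult_right summable_on_subset_banach[OF divisor_count_series_summable])
     (auto simp: level_moduli_def)

lemma error_sum_holomorphic:
  assumes "R > 0"
  shows "error_sum holomorphic_on cap R"
proof -
  obtain C where C: "\<And>s c. s \<in> cap R \<Longrightarrow> c \<in> level_moduli N \<Longrightarrow> norm (chi s c * cell_error s c) \<le>
           C * (real (divisor_count c) * real c powr (- (9/8)))"
    using cell_error_majorant[OF assms] by blast
  show ?thesis
    unfolding error_sum_def[abs_def]
    by (rule holomorphic_infsum[OF open_cap _ _ error_majorant_summable[of C]])
       (auto intro!: holomorphic_on_mult chi_holomorphic cell_error_holomorphic assms C simp: level_moduli_def)
qed

definition half_plane :: "complex set" where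
  "half_plane = {s. Re s > 31/32}"

lemma holomorphic_on_half_plane:
  assumes "\<And>R. R > 0 \<Longrightarrow> f holomorphic_on cap R"
  shows "f holomorphic_on half_plane"
proof (rule holomorphic_on_if_locally)
  fix x assume "x \<in> half_plane"
  then have "open (cap (norm x + 1))" "x \<in> cap (norm x + 1)" "f holomorphic_on cap (norm x + 1)"
    using assms[of "norm x + 1"] open_cap by (auto simp: half_plane_def cap_def add_nonneg_pos)
  then show "\<exists>T. open T \<and> x \<in> T \<and> f holomorphic_on T" by blast
qed

text \<open>
  \<open>I(s) / (s - 1)\<close> with its removable singularity filled in; \<open>mean_left 1\<close> is in fact \<open>0\<close>.
\<close>

definition mean_quotient :: "complex \<Rightarrow> complex" where
  "mean_quotient s = (if s = 1 then deriv mean_left 1 else (mean_left s - mean_left 1) / (s - 1))"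

text \<open>
  The last summand is \<open>I J \<Sum> \<phi>(c) c^(2-4s)\<close>, with the zero of \<open>I\<close> and the pole of the Dirichlet series at
  \<open>1\<close> cancelled against each other.
\<close>

definition big_cell_cont :: "complex \<Rightarrow> complex" where
  "big_cell_cont s = correction_sum s + error_sum s + mean_quotient s * mean_right s * (level_factor N s * zeta_cont s)"

lemma half_plane_open: "open half_plane"
  unfolding half_plane_def by (intro open_Collect_less continuous_intros)

lemma big_cell_cont_holomorphic: "big_cell_cont holomorphic_on half_plane"
proof -
  have "mean_quotient holomorphic_on half_plane"
    unfolding mean_quotient_def[abs_def]
    by (rule pole_lemma_open[OF holomorphic_on_half_plane[OF mean_left_holomorphic] half_plane_open])
  then show ?thesis
    unfolding big_cell_cont_def[abs_def]
    by (intro holomorphic_on_add holomorphic_on_mult holomorphic_on_half_plane[OF correction_sum_holomorphic]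
        holomorphic_on_half_plane[OF error_sum_holomorphic] holomorphic_on_half_plane[OF mean_right_holomorphic]
        holomorphic_on_half_plane[OF level_factor_holomorphic] holomorphic_on_half_plane[OF zeta_cont_holomorphic])
       (use N in auto)
qed

lemma infsum_cell_eq:
  assumes "Re s > 1"
  shows "(\<lambda>x. norm (Xi_term z1 z2 s (cell_matrix x))) summable_on cell_indices N"
    and "(\<Sum>\<^sub>\<infinity>x\<in>cell_indices N. Xi_term z1 z2 s (cell_matrix x)) = big_cell_cont s"
proof -
  have s: "s \<in> cap (norm s + 1)" and R: "norm s + 1 > 0"
    using assms by (auto simp: cap_def add_nonneg_pos)
  have eq: "Xi_term z1 z2 s (cell_matrix x) = cell_main z1 z2 s x + cell_main z1 z2 s x * cell_correction z1 z2 s x"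
    if "x \<in> cell_indices N" for x
    by (rule Xi_term_cell_matrix[OF that Im_nonzero(1,2)])
  show "(\<lambda>x. norm (Xi_term z1 z2 s (cell_matrix x))) summable_on cell_indices N"
    by (rule Infinite_Sum.abs_summable_on_comparison_test'[OF
          summable_on_add[OF cell_main_summable[OF assms] cell_correction_term_summable[OF assms]]])
       (simp add: eq norm_triangle_ineq)
  have "(\<Sum>\<^sub>\<infinity>x\<in>cell_indices N. Xi_term z1 z2 s (cell_matrix x)) =
     (\<Sum>\<^sub>\<infinity>x\<in>cell_indices N. cell_main z1 z2 s x + cell_main z1 z2 s x * cell_correction z1 z2 s x)"
    by (intro infsum_cong eq)
  also have "\<dots> = (\<Sum>\<^sub>\<infinity>x\<in>cell_indices N. cell_main z1 z2 s x) + correction_sum s"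
    unfolding correction_sum_def
    by (intro infsum_add abs_summable_summable[OF cell_main_summable[OF assms]]
        abs_summable_summable[OF cell_correction_term_summable[OF assms]])
  also have "(\<Sum>\<^sub>\<infinity>x\<in>cell_indices N. cell_main z1 z2 s x) = (\<Sum>\<^sub>\<infinity>c\<in>level_moduli N. chi s c * cell_sum s c)"
    by (rule infsum_cell_main[OF assms])
  also have "\<dots> = error_sum s + (\<Sum>\<^sub>\<infinity>c\<in>level_moduli N. (mean_left s * mean_right s) * (of_nat (totient c) * chi s c))"
  proof -
    obtain C where C: "\<And>c. c \<in> level_moduli N \<Longrightarrow> norm (chi s c * cell_error s c) \<le>
           C * (real (divisor_count c) * real c powr (- (9/8)))"
      using cell_error_majorant[OF R] s by blast
    have e: "(\<lambda>c. chi s c * cell_error s c) summable_on level_moduli N"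
      by (rule summable_on_bound(1)[OF error_majorant_summable C])
    have split: "chi s c * cell_sum s c = chi s c * cell_error s c + (mean_left s * mean_right s) * (of_nat (totient c) * chi s c)" for c
      by (simp add: cell_error_def algebra_simps)
    have "(\<lambda>c. chi s c * cell_sum s c + - (chi s c * cell_error s c)) summable_on level_moduli N"
      by (intro summable_on_add infsum_cell_main(2)[OF assms]) (simp add: summable_on_uminus e)
    then have t: "(\<lambda>c. (mean_left s * mean_right s) * (of_nat (totient c) * chi s c)) summable_on level_moduli N"
      unfolding split by simp
    show ?thesis
      unfolding split error_sum_def by (rule infsum_add[OF e t])
  qed
  also have "(\<Sum>\<^sub>\<infinity>c\<in>level_moduli N. (mean_left s * mean_right s) * (of_nat (totient c) * chi s c)) =
      (mean_left s * mean_right s) * (level_factor N s * (\<Sum>\<^sub>\<infinity>k\<in>{0<..}. of_nat k * chi s k))"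
    unfolding infsum_cmult_right' level_moduli_def using N assms by (simp add: totient_series)
  also have "\<dots> = mean_quotient s * mean_right s * (level_factor N s * zeta_cont s)"
  proof -
    have "s \<noteq> 1" using assms by auto
    moreover have "mean_left 1 = 0"
      unfolding mean_left_def by (rule circle_mean_at_1[OF Im_nonzero(1)])
    ultimately show ?thesis
      using zeta_cont_eq[OF assms] by (simp add: mean_quotient_def)
  qed
  finally show "(\<Sum>\<^sub>\<infinity>x\<in>cell_indices N. Xi_term z1 z2 s (cell_matrix x)) = big_cell_cont s"
    by (simp add: big_cell_cont_def add_ac)
qed

lemma border_summable:
  assumes "Re s > 1"
  shows "(\<lambda>x. norm (Xi_term z1 z2 s (border_matrix x))) summable_on {1, -1} \<times> UNIV"
proof -
  have s: "s \<in> cap (norm s + 1)" using assms by (simp add: cap_def)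
  obtain C where C: "C > 0" "\<And>e b. e \<in> {1, -1} \<Longrightarrow> norm (Xi_term z1 z2 s (border_matrix (e, b))) \<le> C * int_weight b"
    using border_term_bound[of "norm s + 1"] s by blast
  show ?thesis
    by (rule Infinite_Sum.abs_summable_on_comparison_test'[OF border_majorant_summable[OF C(1)]]) (use C(2) in auto)
qed

theorem Xi_series:
  assumes "Re s > 1"
  shows "(\<lambda>\<gamma>. norm (Xi_term z1 z2 s \<gamma>)) summable_on Gamma0 N"
    and "Xi N z1 z2 s = 1 / 2 * border_sum s + big_cell_cont s"
proof -
  let ?Z = "{\<gamma>\<in>Gamma0 N. \<gamma> $ 2 $ 1 = 0}" and ?P = "{\<gamma>\<in>Gamma0 N. \<gamma> $ 2 $ 1 > 0}" and ?M = "{\<gamma>\<in>Gamma0 N. \<gamma> $ 2 $ 1 < 0}"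
  let ?f = "Xi_term z1 z2 s"
  have split: "Gamma0 N = ?Z \<union> (?P \<union> ?M)" by auto
  have disj: "?Z \<inter> (?P \<union> ?M) = {}" "?P \<inter> ?M = {}" by auto
  have Z: "(\<lambda>\<gamma>. norm (?f \<gamma>)) summable_on ?Z"
    using border_summable[OF assms] summable_on_reindex_bij_betw[OF bij_border_matrix[of N], of "\<lambda>\<gamma>. norm (?f \<gamma>)"] by simp
  have P: "(\<lambda>\<gamma>. norm (?f \<gamma>)) summable_on ?P"
    using infsum_cell_eq(1)[OF assms] summable_on_reindex_bij_betw[OF bij_cell_matrix[of N], of "\<lambda>\<gamma>. norm (?f \<gamma>)"] by simp
  then have M: "(\<lambda>\<gamma>. norm (?f \<gamma>)) summable_on ?M"
    using summable_on_reindex_bij_betw[OF bij_uminus_cell[of N], of "\<lambda>\<gamma>. norm (?f \<gamma>)"] by (simp add: Xi_term_uminus)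
  have PM: "(\<lambda>\<gamma>. norm (?f \<gamma>)) summable_on ?P \<union> ?M"
    by (rule summable_on_Un_disjoint[OF P M disj(2)])
  show "(\<lambda>\<gamma>. norm (?f \<gamma>)) summable_on Gamma0 N"
    by (rule ssubst[OF split], rule summable_on_Un_disjoint[OF Z PM disj(1)])
  have "infsum ?f (Gamma0 N) = infsum ?f (?Z \<union> (?P \<union> ?M))"
    using split by (rule arg_cong)
  also have "\<dots> = infsum ?f ?Z + (infsum ?f ?P + infsum ?f ?M)"
    using infsum_Un_disjoint[OF abs_summable_summable[OF Z] abs_summable_summable[OF PM] disj(1)]
      infsum_Un_disjoint[OF abs_summable_summable[OF P] abs_summable_summable[OF M] disj(2)] by simp
  also have "infsum ?f ?M = infsum ?f ?P"
    using infsum_reindex_bij_betw[OF bij_uminus_cell[of N], of ?f] by (simp add: Xi_term_uminus)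
  also have "infsum ?f ?P = big_cell_cont s"
    using infsum_reindex_bij_betw[OF bij_cell_matrix[of N], of ?f] infsum_cell_eq(2)[OF assms] by simp
  also have "infsum ?f ?Z = border_sum s"
    using infsum_reindex_bij_betw[OF bij_border_matrix[of N], of ?f] by (simp add: border_sum_def)
  finally show "Xi N z1 z2 s = 1 / 2 * border_sum s + big_cell_cont s"
    by (simp add: Xi_def algebra_simps)
qed

lemma Xi_continues: "continues_analytically_to (Xi N z1 z2) {s. Re s > 1} 1"
  unfolding continues_analytically_to_def
proof (intro exI conjI ballI)
  show "open half_plane" by (rule half_plane_open)
  have "convex half_plane" unfolding half_plane_def by (rule convex_halfspace_Re_gt)
  then show "connected half_plane" by (rule convex_connected)
  show "{s. Re s > 1} \<subseteq> half_plane" "1 \<in> half_plane" by (auto simp: half_plane_def)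
  show "(\<lambda>s. 1 / 2 * border_sum s + big_cell_cont s) holomorphic_on half_plane"
    by (intro holomorphic_on_add holomorphic_on_mult holomorphic_on_const big_cell_cont_holomorphic
        holomorphic_on_half_plane[OF border_sum_holomorphic])
  fix s assume "s \<in> {s. Re s > 1}"
  then show "1 / 2 * border_sum s + big_cell_cont s = Xi N z1 z2 s" by (simp add: Xi_series(2))
qed

end

theorem theorem5:
  fixes N :: nat and z1 z2 :: complex
  assumes "N \<ge> 1"
    and "z1 \<in> upper_half_plane" and "z2 \<in> upper_half_plane"
    and "z2 \<notin> Gamma0_orbit N z1"
  shows "(\<forall>s. Re s > 1 \<longrightarrow> (\<lambda>\<gamma>. norm (Xi_term z1 z2 s \<gamma>)) summable_on Gamma0 N) \<and>
         continues_analytically_to (Xi N z1 z2) {s. Re s > 1} 1"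
proof -
  interpret level_pair N z1 z2 by unfold_locales (fact assms)+
  show ?thesis using Xi_series(1) Xi_continues by blast
qed

end
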